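(* Any two cycle-free $4$-partitions of the complete graph $K_8$ are involution equivalent.
   Context: All graphs are simple and undirected; $(i,j)$ and $(j,i)$ denote the same edge. $K_n$ is the complete graph on $\{1,\dots,n\}$. A $d$-partition of $K_n$ is an ordered tuple $(\Gamma_1,\dots,\Gamma_d)$ of subgraphs of $K_n$, each with vertex set $\{1,\dots,n\}$, whose edge sets are pairwise disjoint and have union $E(K_n)$. It is cycle-free if no $\Gamma_i$ contains a cycle. $\mathcal{P}_d^{cf}(K_{2d})$ is the set of cycle-free $d$-partitions of $K_{2d}$ (here $d=4$). Involutions: it is known that for every $\mathcal{P}\in\mathcal{P}_d^{cf}(K_{2d})$ and distinct vertices $x,y,z$ there is a unique $\mathcal{Q}\in\mathcal{P}_d^{cf}(K_{2d})$ such that $\mathcal{P}$ and $\mathcal{Q}$ coincide (assign the edge to the component of the same index) on every edge of $K_{2d}$ other than $(x,y),(x,z),(y,z)$, and differ on at least two of these three edges. This $\mathcal{Q}$ is denoted $\mathcal{P}^{(x,y,z)}$; the map $\mathcal{P}\mapsto\mathcal{P}^{(x,y,z)}$ is an involution. Involution equivalence: $\mathcal{P},\mathcal{Q}\in\mathcal{P}_d^{cf}(K_{2d})$ are involution equivalent if there are $n\ge 0$, $\mathcal{P}_0,\dots,\mathcal{P}_n\in\mathcal{P}_d^{cf}(K_{2d})$ and $1\le x_i<y_i<z_i\le 2d$ ($1\le i\le n$) with $\mathcal{P}_0=\mathcal{P}$, $\mathcal{P}_n=\mathcal{Q}$ and $\mathcal{P}_i^{(x_i,y_i,z_i)}=\mathcal{P}_{i-1}$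 for all $1\le i\le n$. *)

theory Defs
  imports Main
begin

text \<open>
  Edges are two-element sets of vertices. All graphs below are spanning subgraphs of \<open>K\<^sub>n\<close>, so a
  graph is represented by its edge set alone, and an ordered tuple of \<open>d\<close> graphs by a list of
  length \<open>d\<close> (component \<open>i\<close> of the tuple is list position \<open>i - 1\<close>).
\<close>

definition complete_graph_edges :: "nat \<Rightarrow> nat set set" where
  "complete_graph_edges n = {{i, j} | i j. i \<in> {1..n} \<and> j \<in> {1..n} \<and> i \<noteq> j}"

definition is_cycle :: "nat set set \<Rightarrow> nat list \<Rightarrow> bool" where
  "is_cycle E vs \<longleftrightarrow> 3 \<le> length vs \<and> distinct vs \<and>
     (\<forall>k < length vs. {vs ! k, vs ! (Suc k mod length vs)} \<in> E)"

definition partitions :: "nat \<Rightarrow> nat \<Rightarrow> nat set set list set" where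
  "partitions d n = {P. length P = d \<and>
     (\<forall>i < d. \<forall>j < d. i \<noteq> j \<longrightarrow> P ! i \<inter> P ! j = {}) \<and>
     (\<Union>i < d. P ! i) = complete_graph_edges n}"

definition cycle_free_partitions :: "nat \<Rightarrow> nat \<Rightarrow> nat set set list set" where
  "cycle_free_partitions d n =
     {P \<in> partitions d n. \<forall>i < d. \<not> (\<exists>vs. is_cycle (P ! i) vs)}"

definition coincide_on :: "nat \<Rightarrow> nat set set list \<Rightarrow> nat set set list \<Rightarrow> nat set \<Rightarrow> bool" where
  "coincide_on d P Q e \<longleftrightarrow> (\<forall>i < d. e \<in> P ! i \<longleftrightarrow> e \<in> Q ! i)"

definition triangle_edges :: "nat \<Rightarrow> nat \<Rightarrow> nat \<Rightarrow> nat set set" where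
  "triangle_edges x y z = {{x, y}, {x, z}, {y, z}}"

text \<open>
  The partition \<open>P\<^bsup>(x,y,z)\<^esup>\<close>. The definite description is proper whenever \<open>P\<close> is a cycle-free
  \<open>d\<close>-partition of \<open>K\<^bsub>2d\<^esub>\<close> and \<open>x\<close>, \<open>y\<close>, \<open>z\<close> are distinct vertices.
\<close>

definition involution ::
  "nat \<Rightarrow> nat set set list \<Rightarrow> nat \<Rightarrow> nat \<Rightarrow> nat \<Rightarrow> nat set set list" where
  "involution d P x y z = (THE Q. Q \<in> cycle_free_partitions d (2 * d) \<and>
     (\<forall>e \<in> complete_graph_edges (2 * d) - triangle_edges x y z. coincide_on d P Q e) \<and>
     2 \<le> card {e \<in> triangle_edges x y z. \<not> coincide_on d P Q e})"

definition involution_equivalent ::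
  "nat \<Rightarrow> nat set set list \<Rightarrow> nat set set list \<Rightarrow> bool" where
  "involution_equivalent d P Q \<longleftrightarrow>
     (\<exists>(n :: nat) (R :: nat \<Rightarrow> nat set set list) (x :: nat \<Rightarrow> nat) (y :: nat \<Rightarrow> nat) (z :: nat \<Rightarrow> nat).
        (\<forall>i \<le> n. R i \<in> cycle_free_partitions d (2 * d)) \<and> R 0 = P \<and> R n = Q \<and>
        (\<forall>i \<in> {1..n}. 1 \<le> x i \<and> x i < y i \<and> y i < z i \<and> z i \<le> 2 * d \<and>
           involution d (R i) (x i) (y i) (z i) = R (i - 1)))"

end

theory Submission
  imports Defs
begin

text \<open>
  Counting edges shows that the classes of a cycle-free \<open>d\<close>-partition of \<open>K\<^bsub>2d\<^esub>\<close> are spanning trees, and that an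
  involution is the same thing as a nontrivial recolouring of one triangle. Connectivity under such
  recolourings is proved by removing the vertices one at a time. When a vertex \<open>v\<close> is removed, fix a colour
  \<open>A\<close> and maximise the \<open>A\<close>-degree of \<open>v\<close>. Regard the colour of \<open>{v, y}\<close> as a token lying on \<open>y\<close>. If no
  sequence of recolourings increases the \<open>A\<close>-degree, then for every \<open>A\<close>-edge \<open>{y, z}\<close> avoiding \<open>v\<close> the tokens of
  \<open>y\<close> and \<open>z\<close> can be exchanged, so a token can travel through its whole \<open>A\<close>-component \<open>K\<close>; hence the
  component of the token's colour contains \<open>K\<close>, and the tokens on \<open>K\<close> have different colours. For at most four
  colours this forces every colour other than \<open>A\<close> to have degree one at \<open>v\<close>. Such a colouring is determined, up to
  exchanging tokens, by its restriction to the other vertices, and the recolourings of the restriction lift.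

  After the removal of one vertex from \<open>K\<^bsub>2m\<^esub>\<close> the class of \<open>A\<close> is a forest with \<open>m - 1\<close> edges, and after the
  removal of a second vertex it is empty, which leaves \<open>K\<^bsub>2m-2\<^esub>\<close> with \<open>m - 1\<close> colours.
\<close>

section \<open>Forests\<close>

text \<open>Why a failed gain yields an exchange: let \<open>{y, z}\<close> have colour A in a
  triangle with x. The only obstruction to creating another A-edge at x is that the colours of
  \<open>{x, y}\<close> and \<open>{x, z}\<close> differ and each joins y to z without x, and
  exactly then these two colours may be exchanged.

  The bound four enters by counting. Every colour of \<open>S\<close> has a token in each of its
  components off v. If some B in \<open>S\<close> had two tokens, A would keep at most three of them
  in even order and at most two in odd order, which leaves few configurations. Those with small
  A-components fall to component sizes. In the others B has several components off v, no A-edge can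
  cross between them, and an A-edge inside one is pushed around until it would have to cross.

  The obstacle to lifting: off v the class of A may have several components, each possibly with a
  token, and a recolouring there may merge two of them. The tokens have to be moved out of the way
  first.\<close>

definition conn :: "'a set set \<Rightarrow> 'a \<Rightarrow> 'a \<Rightarrow> bool" where
  "conn E = (\<lambda>x y. {x, y} \<in> E)\<^sup>*\<^sup>*"

text \<open>Edge deletion is used instead of cycles so that inserting an edge becomes a connectivity
  test (\<open>forest_insert\<close>). Since \<open>conn\<close> is reflexive, a forest contains no
  singleton edge.\<close>

definition forest :: "'a set set \<Rightarrow> bool" where
  "forest E \<longleftrightarrow> (\<forall>x y. {x, y} \<in> E \<longrightarrow> \<not> conn (E - {{x, y}}) x y)"

lemma conn_refl [simp, intro]: "conn E x x"
  by (simp add: conn_def)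

lemma conn_trans [trans]: "conn E x y \<Longrightarrow> conn E y z \<Longrightarrow> conn E x z"
  by (simp add: conn_def)

lemma conn_edge: "{x, y} \<in> E \<Longrightarrow> conn E x y"
  by (auto simp: conn_def)

lemma conn_sym: "conn E x y \<Longrightarrow> conn E y x"
proof -
  have "symp (\<lambda>x y. {x, y} \<in> E)"
    by (auto intro!: sympI simp: insert_commute)
  then show "conn E x y \<Longrightarrow> conn E y x"
    unfolding conn_def by (metis sympD symp_rtranclp)
qed

lemma conn_commute: "conn E x y \<longleftrightarrow> conn E y x"
  by (blast intro: conn_sym)

lemma conn_mono: "conn E x y \<Longrightarrow> E \<subseteq> E' \<Longrightarrow> conn E' x y"
  unfolding conn_def by (erule rtranclp_mono[THEN predicate2D, rotated]) auto

lemma conn_induct [consumes 1, case_names refl step]: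
  assumes "conn E x y" "P x"
    and "\<And>u w. conn E x u \<Longrightarrow> {u, w} \<in> E \<Longrightarrow> P u \<Longrightarrow> P w"
  shows "P y"
  using assms(1) unfolding conn_def
  by (induction rule: rtranclp_induct) (use assms(2,3) in \<open>auto simp: conn_def\<close>)

lemma conn_step: "conn E x u \<Longrightarrow> {u, w} \<in> E \<Longrightarrow> conn E x w"
  by (meson conn_edge conn_trans)

lemma conn_in: "conn E x y \<Longrightarrow> \<Union>E \<subseteq> W \<Longrightarrow> x \<in> W \<Longrightarrow> y \<in> W"
  by (induction rule: conn_induct) auto

lemma conn_into:
  assumes "conn E x y" "\<And>u w. {u, w} \<in> E \<Longrightarrow> conn E' u w"
  shows "conn E' x y"
  using assms(1) by (induction rule: conn_induct) (auto intro: conn_trans assms(2))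

text \<open>Whenever a walk returns to x its past can be discarded, so some walk leaves x once and
  never uses that first edge again.\<close>

lemma conn_first_edge:
  assumes "conn E x y" "x \<noteq> y"
  shows "\<exists>w. {x, w} \<in> E \<and> conn (E - {{x, w}}) w y"
proof -
  have "y = x \<or> (\<exists>w. {x, w} \<in> E \<and> conn (E - {{x, w}}) w y)"
    using assms(1)
  proof (induction rule: conn_induct)
    case (step u w)
    show ?case
    proof (cases "u = x \<or> w = x")
      case True
      then show ?thesis using step by (auto intro: exI[of _ w])
    next
      case False
      then obtain t where t: "{x, t} \<in> E" "conn (E - {{x, t}}) t u" using step by blast
      have "{u, w} \<in> E - {{x, t}}" using step False by (auto simp: doubleton_eq_iff)
      then show ?thesis using t(1) conn_step[OF t(2)] by blast
    qed
  qed simp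
  then show ?thesis using assms(2) by auto
qed

lemma conn_insert:
  "conn (insert {x, y} E) u w \<longleftrightarrow>
     conn E u w \<or> conn E u x \<and> conn E y w \<or> conn E u y \<and> conn E x w" (is "?l \<longleftrightarrow> ?r")
proof
  assume ?l then show ?r
  proof (induction rule: conn_induct)
    case (step a b)
    show ?case
    proof (cases "{a, b} \<in> E")
      case True
      then show ?thesis using step(3) conn_step[of E _ a b] by blast
    next
      case False
      then have "a = x \<and> b = y \<or> a = y \<and> b = x" using step(2) by (auto simp: doubleton_eq_iff)
      then show ?thesis using step(3) by blast
    qed
  qed simp
next
  have m: "conn (insert {x, y} E) a b" if "conn E a b" for a b
    using that by (rule conn_mono) auto
  have e: "conn (insert {x, y} E) x y" by (rule conn_edge) simp
  assume ?r then show ?l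
    using m e conn_trans conn_sym by metis
qed

lemma forest_mono: "forest E \<Longrightarrow> E' \<subseteq> E \<Longrightarrow> forest E'"
  unfolding forest_def by (meson Diff_mono conn_mono order_refl subsetD)

lemma forest_empty [simp]: "forest {}"
  by (simp add: forest_def)

lemma forestD: "forest E \<Longrightarrow> {x, y} \<in> E \<Longrightarrow> \<not> conn (E - {{x, y}}) x y"
  by (auto simp: forest_def)

lemma forest_insert:
  assumes "{x, y} \<notin> E"
  shows "forest (insert {x, y} E) \<longleftrightarrow> forest E \<and> \<not> conn E x y"
proof
  assume *: "forest (insert {x, y} E)"
  have "insert {x, y} E - {{x, y}} = E" using assms by auto
  then show "forest E \<and> \<not> conn E x y"
    using forest_mono[OF *, of E] forestD[OF *, of x y] by auto
next
  assume *: "forest E \<and> \<not> conn E x y"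
  show "forest (insert {x, y} E)"
    unfolding forest_def
  proof (intro allI impI notI)
    fix u w assume uw: "{u, w} \<in> insert {x, y} E" and c: "conn (insert {x, y} E - {{u, w}}) u w"
    show False
    proof (cases "{u, w} = {x, y}")
      case True
      then have "insert {x, y} E - {{u, w}} = E" using assms by auto
      then have "conn E u w" using c by simp
      then have "conn E x y" using True conn_sym by (metis doubleton_eq_iff)
      then show False using * by simp
    next
      case False
      then have e: "insert {x, y} E - {{u, w}} = insert {x, y} (E - {{u, w}})" by auto
      have uwE: "{u, w} \<in> E" using uw False by auto
      have m: "conn (E - {{u, w}}) a b \<Longrightarrow> conn E a b" for a b by (erule conn_mono) auto
      have "conn E u w" using uwE by (rule conn_edge)
      moreover have "\<not> conn (E - {{u, w}}) u w" using forestD[OF conjunct1[OF *] uwE] .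
      ultimately show False
        using c[unfolded e conn_insert] m * by (metis conn_sym conn_trans)
    qed
  qed
qed

text \<open>A walk that visits v enters and leaves it through members of \<open>T\<close>. Only the
  first entry p and the last exit q are recorded.\<close>

lemma conn_star:
  assumes "conn (F \<union> (\<lambda>t. {v, t}) ` T) u w" "u \<noteq> v" "v \<notin> \<Union>F"
  shows "w \<noteq> v \<and> conn F u w \<or> (\<exists>p\<in>T. conn F u p \<and> (w = v \<or> (\<exists>q\<in>T. conn F q w)))"
  using assms(1)
proof (induction rule: conn_induct)
  case (step a b)
  consider "{a, b} \<in> F" | "a = v" "b \<in> T" | "b = v" "a \<in> T" using step(2) by (auto simp: doubleton_eq_iff)
  then show ?case
  proof cases
    case 1
    then have "a \<noteq> v" "b \<noteq> v" using assms(3) by auto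
    then show ?thesis using step(3) 1 conn_step[of F _ a b] by blast
  next
    case 2
    then show ?thesis using step(3) by auto
  next
    case 3
    then show ?thesis using step(3) by auto
  qed
qed (use assms in auto)

text \<open>A cycle through v consists of two edges at v and an \<open>F\<close>-path between their
  other ends. This splits validity on V into validity off v and a condition on the tokens.\<close>

lemma forest_star:
  assumes "v \<notin> \<Union>F" "v \<notin> T"
  shows "forest (F \<union> (\<lambda>t. {v, t}) ` T) \<longleftrightarrow>
    forest F \<and> (\<forall>p\<in>T. \<forall>q\<in>T. p \<noteq> q \<longrightarrow> \<not> conn F p q)" (is "forest ?E \<longleftrightarrow> _")
proof
  assume *: "forest ?E"
  have "\<not> conn F p q" if "p \<in> T" "q \<in> T" "p \<noteq> q" for p q
  proof
    assume "conn F p q"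
    then have "conn (?E - {{v, p}}) p q"
      by (rule conn_mono) (use assms in auto)
    moreover have "{q, v} \<in> ?E - {{v, p}}" using that assms by (auto simp: doubleton_eq_iff insert_commute)
    ultimately have "conn (?E - {{v, p}}) p v" using conn_step by metis
    then show False using forestD[OF *, of v p] that conn_sym by (metis UnI2 imageI)
  qed
  then show "forest F \<and> (\<forall>p\<in>T. \<forall>q\<in>T. p \<noteq> q \<longrightarrow> \<not> conn F p q)"
    using forest_mono[OF *, of F] by auto
next
  assume *: "forest F \<and> (\<forall>p\<in>T. \<forall>q\<in>T. p \<noteq> q \<longrightarrow> \<not> conn F p q)"
  show "forest ?E"
    unfolding forest_def
  proof (intro allI impI notI)
    fix x y assume xy: "{x, y} \<in> ?E" and c: "conn (?E - {{x, y}}) x y"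
    have star: False if "t \<in> T" "conn (?E - {{v, t}}) t v" for t
    proof -
      have "?E - {{v, t}} = F \<union> (\<lambda>t. {v, t}) ` (T - {t})"
        using assms by (auto simp: doubleton_eq_iff)
      then have "\<exists>p\<in>T - {t}. conn F t p"
        using conn_star[of F v "T - {t}" t v] that(2) assms \<open>t \<in> T\<close> by metis
      then obtain p where "p \<in> T" "p \<noteq> t" "conn F t p" by blast
      then show False using \<open>t \<in> T\<close> * by metis
    qed
    show False
    proof (cases "{x, y} \<in> F")
      case True
      then have e: "?E - {{x, y}} = (F - {{x, y}}) \<union> (\<lambda>t. {v, t}) ` T"
        using assms by (auto simp: doubleton_eq_iff)
      have xv: "x \<noteq> v" "y \<noteq> v" using True assms by auto
      have m: "conn (F - {{x, y}}) a b \<Longrightarrow> conn F a b" for a b by (erule conn_mono) auto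
      have "\<not> conn (F - {{x, y}}) x y" using forestD[OF conjunct1[OF *] True] .
      moreover have "conn F x y" using True by (rule conn_edge)
      moreover have "v \<notin> \<Union>(F - {{x, y}})" using assms by auto
      ultimately obtain p q where pq: "p \<in> T" "q \<in> T" "conn (F - {{x, y}}) x p" "conn (F - {{x, y}}) q y"
        using conn_star[OF c[unfolded e]] xv by blast
      then have "p \<noteq> q" using \<open>\<not> conn (F - {{x, y}}) x y\<close> conn_trans by metis
      moreover have "conn F p q" using pq(3,4) \<open>conn F x y\<close> m conn_sym conn_trans by metis
      ultimately show False using * pq(1,2) by metis
    next
      case False
      then obtain t where "t \<in> T" "{x, y} = {v, t}" using xy by auto
      then have "conn (?E - {{v, t}}) t v"
        using c by (auto simp: doubleton_eq_iff insert_commute conn_commute)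
      then show False using star \<open>t \<in> T\<close> by blast
    qed
  qed
qed

text \<open>The flags are meant to be instantiated by "this edge has colour c", which gives one
  criterion for every recolouring of a triangle. Two added edges link the ends of the third one,
  hence the clauses for pairs.\<close>

lemma forest_tri:
  assumes "x \<noteq> y" "x \<noteq> z" "y \<noteq> z" "forest H" "{x, y} \<notin> H" "{x, z} \<notin> H" "{y, z} \<notin> H"
  shows "forest (H \<union> ((if p then {{x, y}} else {}) \<union> (if q then {{x, z}} else {}) \<union> (if r then {{y, z}} else {})))
    \<longleftrightarrow> (p \<longrightarrow> \<not> conn H x y) \<and> (q \<longrightarrow> \<not> conn H x z) \<and> (r \<longrightarrow> \<not> conn H y z) \<and>
      (p \<and> q \<longrightarrow> \<not> conn H y z) \<and> (p \<and> r \<longrightarrow> \<not> conn H x z) \<and> (q \<and> r \<longrightarrow> \<not> conn H x y) \<and> \<not> (p \<and> q \<and> r)"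
proof -
  have d: "{x, y} \<noteq> {x, z}" "{x, y} \<noteq> {y, z}" "{x, z} \<noteq> {y, z}"
    using assms by (auto simp: doubleton_eq_iff)
  have s: "conn H y x = conn H x y" "conn H z x = conn H x z" "conn H z y = conn H y z"
    by (auto intro: conn_sym)
  have c: "conn (insert {x, y} H) x z \<longleftrightarrow> conn H x z \<or> conn H y z"
     "conn (insert {x, y} H) y z \<longleftrightarrow> conn H y z \<or> conn H x z"
     "conn (insert {x, z} H) y z \<longleftrightarrow> conn H y z \<or> conn H x y"
    using s by (auto simp: conn_insert)
  have c3: "conn (insert {x, z} (insert {x, y} H)) y z"
    by (rule conn_trans[of _ y x]) (auto intro: conn_edge simp: insert_commute)
  have f1: "forest (insert {x, y} H) \<longleftrightarrow> \<not> conn H x y" "forest (insert {x, z} H) \<longleftrightarrow> \<not> conn H x z"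
    "forest (insert {y, z} H) \<longleftrightarrow> \<not> conn H y z"
    using assms by (simp_all add: forest_insert)
  have "forest (insert {x, z} (insert {x, y} H)) \<longleftrightarrow> forest (insert {x, y} H) \<and> \<not> conn (insert {x, y} H) x z"
    "forest (insert {y, z} (insert {x, y} H)) \<longleftrightarrow> forest (insert {x, y} H) \<and> \<not> conn (insert {x, y} H) y z"
    "forest (insert {y, z} (insert {x, z} H)) \<longleftrightarrow> forest (insert {x, z} H) \<and> \<not> conn (insert {x, z} H) y z"
    "forest (insert {y, z} (insert {x, z} (insert {x, y} H))) \<longleftrightarrow>
      forest (insert {x, z} (insert {x, y} H)) \<and> \<not> conn (insert {x, z} (insert {x, y} H)) y z"
    by (rule forest_insert; use assms d in auto)+
  note f = this[unfolded f1 c]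
  show ?thesis
    by (cases p; cases q; cases r; simp only: if_True if_False Un_empty_left Un_empty_right
        Un_insert_left Un_insert_right f1 f c3 assms(4) simp_thms; blast?)
qed

section \<open>Edge counts of forests\<close>

definition edges :: "'a set \<Rightarrow> 'a set set" where
  "edges V = {{x, y} | x y. x \<in> V \<and> y \<in> V \<and> x \<noteq> y}"

lemma edges_iff [simp]: "{x, y} \<in> edges V \<longleftrightarrow> x \<in> V \<and> y \<in> V \<and> x \<noteq> y"
  by (auto simp: edges_def doubleton_eq_iff)

lemma edgesE: assumes "e \<in> edges V" obtains x y where "e = {x, y}" "x \<in> V" "y \<in> V" "x \<noteq> y"
  using assms by (auto simp: edges_def)

lemma edges_mono: "V \<subseteq> V' \<Longrightarrow> edges V \<subseteq> edges V'"
  unfolding edges_def by blast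

lemma finite_edges [simp]: "finite V \<Longrightarrow> finite (edges V)"
  by (rule finite_subset[of _ "Pow V"]) (auto simp: edges_def)

lemma Union_edges: "\<Union>(edges V) \<subseteq> V"
  by (auto simp: edges_def)

text \<open>Each inserted edge merges two different components into one, so the sum stays
  constant.\<close>

lemma card_forest_comps:
  assumes "finite V" "E \<subseteq> edges V" "forest E"
  shows "card E + card ((\<lambda>x. {y \<in> V. conn E x y}) ` V) = card V"
proof -
  have "finite E" using finite_subset[OF assms(2)] assms(1) by simp
  then show ?thesis using assms(2,3)
  proof (induction E rule: finite_induct)
    case empty
    have "{y \<in> V. conn {} x y} = {x}" if "x \<in> V" for x
    proof -
      have "conn {} x y \<Longrightarrow> y = x" for y by (induction rule: conn_induct) auto
      then show ?thesis using that by auto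
    qed
    then have "(\<lambda>x. {y \<in> V. conn {} x y}) ` V = (\<lambda>x. {x}) ` V" by auto
    then show ?case by (simp add: card_image)
  next
    case (insert e E)
    obtain a b where e: "e = {a, b}" "a \<in> V" "b \<in> V" "a \<noteq> b"
      using edgesE[of e V] insert.prems(1) by blast
    have f: "forest E" "\<not> conn E a b" using insert.prems(2) insert.hyps(2) forest_insert[of a b E] e by simp_all
    let ?c = "\<lambda>E x. {y \<in> V. conn E x y}"
    let ?R = "?c E ` V - {?c E a, ?c E b}"
    have s: "conn E x y \<Longrightarrow> conn E y x" for x y by (rule conn_sym)
    have t: "conn E x y \<Longrightarrow> conn E y z \<Longrightarrow> conn E x z" for x y z by (rule conn_trans)
    have eq: "?c E x = ?c E y \<longleftrightarrow> conn E x y" if "x \<in> V" "y \<in> V" for x y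
    proof
      assume "?c E x = ?c E y"
      then have "y \<in> ?c E x" using that(2) by simp
      then show "conn E x y" by simp
    next
      assume *: "conn E x y"
      show "?c E x = ?c E y" using t[OF *] t[OF s[OF *]] by blast
    qed
    have c1: "?c (insert e E) x = ?c E a \<union> ?c E b" if "conn E x a \<or> conn E x b" for x
    proof -
      have "conn (insert {a, b} E) x y \<longleftrightarrow> conn E a y \<or> conn E b y" for y
        using that unfolding conn_insert by (metis s t)
      then show ?thesis unfolding e(1) by blast
    qed
    have c2: "?c (insert e E) x = ?c E x" if "\<not> (conn E x a \<or> conn E x b)" for x
      using that unfolding e conn_insert by blast
    have "?c (insert e E) ` V = insert (?c E a \<union> ?c E b) ?R"
    proof (intro equalityI subsetI)
      fix X assume "X \<in> ?c (insert e E) ` V"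
      then obtain x where x: "x \<in> V" "X = ?c (insert e E) x" by auto
      show "X \<in> insert (?c E a \<union> ?c E b) ?R"
      proof (cases "conn E x a \<or> conn E x b")
        case True then show ?thesis using c1 x by simp
      next
        case False
        then have "X = ?c E x" "?c E x \<noteq> ?c E a" "?c E x \<noteq> ?c E b"
          using c2 x eq e by auto
        then show ?thesis using x by auto
      qed
    next
      fix X assume X: "X \<in> insert (?c E a \<union> ?c E b) ?R"
      then consider "X = ?c E a \<union> ?c E b" | "X \<in> ?R" by blast
      then show "X \<in> ?c (insert e E) ` V"
      proof cases
        case 1
        then have "X = ?c (insert e E) a" using c1[of a] by simp
        then show ?thesis using e(2) by (rule image_eqI)
      next
        case 2
        then have X': "X \<in> ?c E ` V" "X \<noteq> ?c E a" "X \<noteq> ?c E b" by simp_all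
        from X'(1) obtain x where x: "X = ?c E x" "x \<in> V" by (rule imageE)
        then have "\<not> (conn E x a \<or> conn E x b)" using eq[OF x(2) e(2)] eq[OF x(2) e(3)] X' x(1) by simp
        then have "X = ?c (insert e E) x" using c2 x(1) by simp
        then show ?thesis using x(2) by (rule image_eqI)
      qed
    qed
    moreover have "?c E a \<union> ?c E b \<notin> ?R"
    proof
      assume "?c E a \<union> ?c E b \<in> ?R"
      then have X: "?c E a \<union> ?c E b \<in> ?c E ` V" "?c E a \<union> ?c E b \<noteq> ?c E a" by simp_all
      from X(1) obtain x where x: "?c E a \<union> ?c E b = ?c E x" "x \<in> V" by (rule imageE)
      have "a \<in> ?c E x" unfolding x(1)[symmetric] using e(2) by simp
      then have "conn E x a" by simp
      then show False using X(2) x eq[OF x(2) e(2)] by simp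
    qed
    moreover have fin: "finite (?c E ` V)" using assms by simp
    ultimately have "card (?c (insert e E) ` V) = Suc (card ?R)" by simp
    moreover have "card ?R = card (?c E ` V) - card {?c E a, ?c E b}"
      by (rule card_Diff_subset) (use e in auto)
    moreover have "card {?c E a, ?c E b} = 2" using eq[OF e(2,3)] f by simp
    moreover have "card {?c E a, ?c E b} \<le> card (?c E ` V)"
      by (rule card_mono) (use e fin in auto)
    ultimately have "card (?c (insert e E) ` V) + 1 = card (?c E ` V)" by simp
    then show ?case using insert f by simp
  qed
qed

lemma forest_card_le:
  assumes "finite V" "E \<subseteq> edges V" "forest E" "V \<noteq> {}"
  shows "card E \<le> card V - 1"
proof -
  have "card ((\<lambda>x. {y \<in> V. conn E x y}) ` V) \<noteq> 0" using assms by simp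
  then show ?thesis using card_forest_comps[OF assms(1-3)] by linarith
qed

lemma forest_spanning:
  assumes "finite V" "E \<subseteq> edges V" "forest E" "card E = card V - 1" "x \<in> V" "y \<in> V"
  shows "conn E x y"
proof -
  have "card V > 0" using assms by (auto simp: card_gt_0_iff)
  then have "card ((\<lambda>x. {y \<in> V. conn E x y}) ` V) = 1"
    using card_forest_comps[OF assms(1-3)] assms by linarith
  then obtain X where X: "(\<lambda>x. {y \<in> V. conn E x y}) ` V = {X}" using card_1_singletonE by blast
  then have "{z \<in> V. conn E x z} = X" "{z \<in> V. conn E y z} = X"
    using assms(5,6) by (metis (mono_tags, lifting) imageI singletonD)+
  then have "y \<in> {z \<in> V. conn E x z}" using assms(6) by auto
  then show ?thesis by simp
qed

section \<open>Recolouring a triangle\<close>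

definition cls :: "'a set \<Rightarrow> ('a set \<Rightarrow> 'c) \<Rightarrow> 'c \<Rightarrow> 'a set set" where
  "cls V f c = {e \<in> edges V. f e = c}"

definition valid :: "'a set \<Rightarrow> ('a set \<Rightarrow> 'c) \<Rightarrow> bool" where
  "valid V f \<longleftrightarrow> (\<forall>c. forest (cls V f c))"

definition tri :: "'a \<Rightarrow> 'a \<Rightarrow> 'a \<Rightarrow> 'a set set" where
  "tri x y z = {{x, y}, {x, z}, {y, z}}"

text \<open>
  Only the values on \<^term>\<open>edges V\<close> matter, so colourings that agree there are also related.
\<close>
definition step :: "'a set \<Rightarrow> ('a set \<Rightarrow> 'c) \<Rightarrow> ('a set \<Rightarrow> 'c) \<Rightarrow> bool" where
  "step V f g \<longleftrightarrow> valid V f \<and> valid V g \<and> (\<forall>c. card (cls V f c) = card (cls V g c)) \<and>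
     ((\<forall>e \<in> edges V. f e = g e) \<or>
      (\<exists>x \<in> V. \<exists>y \<in> V. \<exists>z \<in> V. x \<noteq> y \<and> x \<noteq> z \<and> y \<noteq> z \<and> (\<forall>e \<in> edges V - tri x y z. f e = g e)))"

abbreviation sim :: "'a set \<Rightarrow> ('a set \<Rightarrow> 'c) \<Rightarrow> ('a set \<Rightarrow> 'c) \<Rightarrow> bool" where
  "sim V \<equiv> (step V)\<^sup>*\<^sup>*"

lemma step_sym: "step V f g \<Longrightarrow> step V g f"
  unfolding step_def by metis

lemma sim_sym: "sim V f g \<Longrightarrow> sim V g f"
proof -
  have "symp (step V)" by (rule sympI) (rule step_sym)
  then show "sim V f g \<Longrightarrow> sim V g f" by (metis sympD symp_rtranclp)
qed

lemma cls_edges: "cls V f c \<subseteq> edges V"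
  by (auto simp: cls_def)

lemma in_cls [simp]: "{x, y} \<in> cls V f c \<longleftrightarrow> x \<in> V \<and> y \<in> V \<and> x \<noteq> y \<and> f {x, y} = c"
  by (auto simp: cls_def)

lemma finite_cls [simp]: "finite V \<Longrightarrow> finite (cls V f c)"
  by (rule finite_subset[OF cls_edges]) simp

lemma Union_cls: "\<Union>(cls V f c) \<subseteq> V"
  by (rule order_trans[OF Union_mono[OF cls_edges] Union_edges])

lemma cls_mono: "U \<subseteq> V \<Longrightarrow> cls U f c \<subseteq> cls V f c"
  using edges_mono unfolding cls_def by blast

lemma cls_cong: "(\<And>e. e \<in> edges V \<Longrightarrow> f e = g e) \<Longrightarrow> cls V f c = cls V g c"
  unfolding cls_def by auto

lemma conn_cls_in: "conn (cls V f c) x y \<Longrightarrow> x \<in> V \<Longrightarrow> y \<in> V"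
  using conn_in[OF _ Union_cls] by metis

lemma validD: "valid V f \<Longrightarrow> forest (cls V f c)"
  by (simp add: valid_def)

lemma tri_commute: "tri x y z = tri y x z" "tri x y z = tri x z y"
  by (auto simp: tri_def insert_commute)

lemma Collect_change3:
  assumes "e1 \<in> E" "e2 \<in> E" "e3 \<in> E" "\<forall>e \<in> E - {e1, e2, e3}. g e = f e"
  shows "{e \<in> E. g e = c} = ({e \<in> E. f e = c} - {e1, e2, e3}) \<union>
    ((if g e1 = c then {e1} else {}) \<union> (if g e2 = c then {e2} else {}) \<union> (if g e3 = c then {e3} else {}))"
proof (intro set_eqI)
  fix e
  have "e = e1 \<or> e = e2 \<or> e = e3 \<or> (e \<in> E \<longrightarrow> g e = f e) \<and> e \<noteq> e1 \<and> e \<noteq> e2 \<and> e \<noteq> e3"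
    using assms(4) by blast
  then show "e \<in> {e \<in> E. g e = c} \<longleftrightarrow> e \<in> ({e \<in> E. f e = c} - {e1, e2, e3}) \<union>
    ((if g e1 = c then {e1} else {}) \<union> (if g e2 = c then {e2} else {}) \<union> (if g e3 = c then {e3} else {}))"
    using assms(1-3) by (elim disjE) auto
qed

lemma cls_tri:
  assumes "x \<in> V" "y \<in> V" "z \<in> V" "x \<noteq> y" "x \<noteq> z" "y \<noteq> z"
    and "\<forall>e \<in> edges V - tri x y z. g e = f e"
  shows "cls V g c = (cls V f c - tri x y z) \<union> ((if g {x, y} = c then {{x, y}} else {}) \<union>
     (if g {x, z} = c then {{x, z}} else {}) \<union> (if g {y, z} = c then {{y, z}} else {}))"
  unfolding cls_def tri_def by (rule Collect_change3) (use assms in \<open>auto simp: tri_def\<close>)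

lemma tri_edges_distinct:
  "x \<noteq> y \<Longrightarrow> x \<noteq> z \<Longrightarrow> y \<noteq> z \<Longrightarrow> {x, y} \<noteq> {x, z} \<and> {x, y} \<noteq> {y, z} \<and> {x, z} \<noteq> {y, z}"
  by (auto simp: doubleton_eq_iff)

lemma card_cls_tri:
  assumes "finite V" "x \<in> V" "y \<in> V" "z \<in> V" "x \<noteq> y" "x \<noteq> z" "y \<noteq> z"
    and "\<forall>e \<in> edges V - tri x y z. g e = f e"
  shows "card (cls V g c) = card (cls V f c - tri x y z) + (of_bool (g {x, y} = c) +
     of_bool (g {x, z} = c) + of_bool (g {y, z} = c))"
proof -
  have d: "{x, y} \<noteq> {x, z}" "{x, y} \<noteq> {y, z}" "{x, z} \<noteq> {y, z}"
    using tri_edges_distinct assms by metis+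
  let ?P = "(if g {x, y} = c then {{x, y}} else {}) \<union>
     (if g {x, z} = c then {{x, z}} else {}) \<union> (if g {y, z} = c then {{y, z}} else {})"
  have "card (cls V g c) = card (cls V f c - tri x y z) + card ?P"
    unfolding cls_tri[OF assms(2-8)]
    by (rule card_Un_disjoint) (use assms in \<open>auto simp: tri_def\<close>)
  moreover have "card ?P = of_bool (g {x, y} = c) + of_bool (g {x, z} = c) + of_bool (g {y, z} = c)"
    using d by (auto simp: card_insert_if)
  ultimately show ?thesis by simp
qed

lemma forest_cls_tri:
  assumes "valid V f" "x \<in> V" "y \<in> V" "z \<in> V" "x \<noteq> y" "x \<noteq> z" "y \<noteq> z"
    and "\<forall>e \<in> edges V - tri x y z. g e = f e"
  defines "H \<equiv> \<lambda>c. cls V f c - tri x y z"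
  shows "forest (cls V g c) \<longleftrightarrow>
    (g {x, y} = c \<longrightarrow> \<not> conn (H c) x y) \<and> (g {x, z} = c \<longrightarrow> \<not> conn (H c) x z) \<and>
    (g {y, z} = c \<longrightarrow> \<not> conn (H c) y z) \<and>
    (g {x, y} = c \<and> g {x, z} = c \<longrightarrow> \<not> conn (H c) y z) \<and> (g {x, y} = c \<and> g {y, z} = c \<longrightarrow> \<not> conn (H c) x z) \<and>
    (g {x, z} = c \<and> g {y, z} = c \<longrightarrow> \<not> conn (H c) x y) \<and> \<not> (g {x, y} = c \<and> g {x, z} = c \<and> g {y, z} = c)"
  unfolding cls_tri[OF assms(2-8)] H_def
  by (rule forest_tri) (use assms in \<open>auto simp: tri_def intro: forest_mono[OF validD[OF assms(1)]]\<close>)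

lemma stepI_tri:
  assumes "finite V" "valid V f" "x \<in> V" "y \<in> V" "z \<in> V" "x \<noteq> y" "x \<noteq> z" "y \<noteq> z"
    and "\<forall>e \<in> edges V - tri x y z. g e = f e"
    and "\<And>c. forest (cls V g c)"
    and "\<And>c. of_bool (g {x, y} = c) + of_bool (g {x, z} = c) + of_bool (g {y, z} = c) =
      (of_bool (f {x, y} = c) + of_bool (f {x, z} = c) + of_bool (f {y, z} = c) :: nat)"
  shows "step V f g"
proof -
  have "card (cls V g c) = card (cls V f c)" for c
    using card_cls_tri[OF assms(1,3-9), where c = c] card_cls_tri[OF assms(1,3-8), where g = f and f = f and c = c]
      assms(11)[of c] by simp
  then show ?thesis
    unfolding step_def valid_def using assms by (metis valid_def)
qed

lemma conn_avoid:
  assumes "conn H y z" "\<not> conn H y x" "\<And>e. e \<in> H \<Longrightarrow> x \<notin> e \<Longrightarrow> e \<in> H'"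
  shows "conn H' y z"
proof -
  have "conn H y z \<and> conn H' y z"
    using assms(1)
  proof (induction rule: conn_induct)
    case (step u w)
    then have "conn H y w" using conn_step by metis
    have "x \<noteq> u" "x \<noteq> w" using step \<open>conn H y w\<close> assms(2) by auto
    then show ?case using step \<open>conn H y w\<close> assms(3)[of "{u, w}"] conn_step[of H' y u w] by auto
  qed simp
  then show ?thesis by simp
qed

text \<open>Under this condition y and z lie in the same component of either colour once x is
  removed, so exchanging the colours of \<open>{x, y}\<close> and \<open>{x, z}\<close> attaches x
  to the same components as before and creates no cycle.\<close>

definition swappable :: "'a set \<Rightarrow> ('a set \<Rightarrow> 'c) \<Rightarrow> 'a \<Rightarrow> 'a \<Rightarrow> 'a \<Rightarrow> bool" where
  "swappable V f x y z \<longleftrightarrow> f {x, y} \<noteq> f {x, z} \<and> conn (cls (V - {x}) f (f {x, y})) y z \<and>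
     conn (cls (V - {x}) f (f {x, z})) y z"

lemma swappable_commute: "swappable V f x y z \<longleftrightarrow> swappable V f x z y"
  unfolding swappable_def by (metis conn_sym)

text \<open>With A placed on \<open>{x, y}\<close>, the colours a and b of \<open>{x, y}\<close> and
  \<open>{x, z}\<close> can go to \<open>{x, z}\<close> and \<open>{y, z}\<close> in two orders.
  Leaving b on \<open>{x, z}\<close> fails only if a joins y to z outside the triangle. In that case
  a does not join x to z, and putting a on \<open>{x, z}\<close> fails only if b joins y to z as
  well. Both failures together would make y and z swappable.\<close>

lemma shift_color:
  assumes fin: "finite V" and val: "valid V f" and mem: "x \<in> V" "y \<in> V" "z \<in> V"
    and ne: "x \<noteq> y" "x \<noteq> z" "y \<noteq> z"
    and fA: "f {y, z} = A" "f {x, y} \<noteq> A" "f {x, z} \<noteq> A"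
    and nsw: "\<not> swappable V f x y z" and A: "\<not> conn (cls V f A - {{y, z}}) x y"
  shows "\<exists>g. step V f g \<and> g {x, y} = A \<and> g {x, z} \<noteq> A \<and> g {y, z} \<noteq> A \<and>
    {g {x, z}, g {y, z}} \<subseteq> {f {x, y}, f {x, z}} \<and> (\<forall>e. e \<notin> tri x y z \<longrightarrow> g e = f e)"
proof -
  define H where "H c = cls V f c - tri x y z" for c
  define a b where "a = f {x, y}" and "b = f {x, z}"
  have d: "{x, y} \<noteq> {x, z}" "{x, y} \<noteq> {y, z}" "{x, z} \<noteq> {y, z}"
    using tri_edges_distinct ne by metis+
  note ft = forest_cls_tri[OF val mem ne, folded H_def]

  have ff: "\<not> conn (H (f {x, y})) x y" "\<not> conn (H (f {x, z})) x z" "\<not> conn (H (f {y, z})) y z"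
    "f {x, y} = f {x, z} \<Longrightarrow> \<not> conn (H (f {x, y})) y z"
    using ft[of f "f {x, y}"] ft[of f "f {x, z}"] ft[of f "f {y, z}"] validD[OF val] by simp_all
  have s: "conn (H c) u w \<Longrightarrow> conn (H c) w u" for c u w by (rule conn_sym)
  have t: "conn (H c) u w \<Longrightarrow> conn (H c) w t \<Longrightarrow> conn (H c) u t" for c u w t by (rule conn_trans)
  have HA: "H A = cls V f A - {{y, z}}" using fA by (auto simp: H_def tri_def cls_def)
  have fa: "\<not> conn (H a) x y" and fb: "\<not> conn (H b) x z" and fAA: "\<not> conn (H A) y z"
    using ff(1-3) fA(1) by (simp_all add: a_def b_def)
  have Axy: "\<not> conn (H A) x y" using A HA by simp
  have ab: "a = b \<Longrightarrow> \<not> conn (H a) y z" using ff(4) by (simp add: a_def b_def)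
  \<comment> \<open>A path from y to z in a component without x survives the removal of x.\<close>
  have res: "conn (cls (V - {x}) f c) y z" if "conn (H c) y z" "\<not> conn (H c) y x" for c
    by (rule conn_avoid[OF that]) (auto simp: H_def cls_def edges_def)
  have nn: "\<not> conn (H a) y z \<or> \<not> conn (H b) y z"
  proof (rule ccontr)
    assume "\<not> ?thesis"
    then have "conn (H a) y z" "conn (H b) y z" by auto
    moreover have "\<not> conn (H a) y x" using fa s by metis
    moreover have "\<not> conn (H b) y x" using fb s t \<open>conn (H b) y z\<close> by metis
    moreover have "a \<noteq> b" using ab \<open>conn (H a) y z\<close> by metis
    ultimately show False using nsw res[of a] res[of b] by (simp add: swappable_def a_def b_def)
  qed
  have main: "\<exists>g. step V f g \<and> g {x, y} = A \<and> g {x, z} \<noteq> A \<and> g {y, z} \<noteq> A \<and>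
      {g {x, z}, g {y, z}} \<subseteq> {f {x, y}, f {x, z}} \<and> (\<forall>e. e \<notin> tri x y z \<longrightarrow> g e = f e)"
    if pq: "p = a \<and> q = b \<or> p = b \<and> q = a" and P: "\<not> conn (H p) x z" and Q: "\<not> conn (H q) y z"
      and PQ: "p = q \<Longrightarrow> \<not> conn (H p) x y" for p q
  proof -
    define g where "g = f({x, y} := A, {x, z} := p, {y, z} := q)"
    have gv: "g {x, y} = A" "g {x, z} = p" "g {y, z} = q" using d by (auto simp: g_def)
    have off: "e \<notin> tri x y z \<Longrightarrow> g e = f e" for e by (auto simp: g_def tri_def)
    have off': "\<forall>e \<in> edges V - tri x y z. g e = f e" using off by simp
    have Aq: "p \<noteq> A" "q \<noteq> A" using pq fA a_def b_def by auto
    have "forest (cls V g c)" for c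
    proof -
      have *: "p \<noteq> A \<Longrightarrow> q \<noteq> A \<Longrightarrow> \<not> K1 A \<Longrightarrow> \<not> K2 p \<Longrightarrow> \<not> K3 q \<Longrightarrow> (p = q \<Longrightarrow> \<not> K1 p) \<Longrightarrow>
        (A = c \<longrightarrow> \<not> K1 c) \<and> (p = c \<longrightarrow> \<not> K2 c) \<and> (q = c \<longrightarrow> \<not> K3 c) \<and> (A = c \<and> p = c \<longrightarrow> \<not> K3 c) \<and>
        (A = c \<and> q = c \<longrightarrow> \<not> K2 c) \<and> (p = c \<and> q = c \<longrightarrow> \<not> K1 c) \<and> \<not> (A = c \<and> p = c \<and> q = c)"
        for K1 K2 K3 by auto
      show ?thesis
        by (simp only: ft[OF off'] gv) (rule *[of "\<lambda>c. conn (H c) x y" "\<lambda>c. conn (H c) x z" "\<lambda>c. conn (H c) y z", OF Aq Axy P Q PQ])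
    qed
    moreover have "of_bool (g {x, y} = c) + of_bool (g {x, z} = c) + of_bool (g {y, z} = c) =
      (of_bool (f {x, y} = c) + of_bool (f {x, z} = c) + of_bool (f {y, z} = c) :: nat)" for c
      unfolding gv fA(1) a_def[symmetric] b_def[symmetric] using pq by (elim disjE conjE) simp_all
    ultimately have "step V f g" by (intro stepI_tri[OF fin val mem ne off'])
    moreover have "{p, q} \<subseteq> {f {x, y}, f {x, z}}" using pq a_def b_def by auto
    ultimately show ?thesis using gv Aq off by metis
  qed
  show ?thesis
  proof (cases "conn (H a) y z")
    case False
    then show ?thesis using main[of b a] fb fa by metis
  next
    case True
    then have "\<not> conn (H b) y z" "a \<noteq> b" "\<not> conn (H a) x z" using nn ab fa s t by metis+
    then show ?thesis using main[of a b] by metis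
  qed
qed

section \<open>Colourings seen from one vertex\<close>

text \<open>Fixing the class sizes makes each colour of \<open>S\<close> a spanning tree of V. The
  parameter r records how many edges A has left after earlier removals.\<close>

definition state :: "'a set \<Rightarrow> 'c set \<Rightarrow> 'c \<Rightarrow> nat \<Rightarrow> ('a set \<Rightarrow> 'c) \<Rightarrow> bool" where
  "state V S A r f \<longleftrightarrow> valid V f \<and> f ` edges V \<subseteq> insert A S \<and>
     (\<forall>c \<in> S. card (cls V f c) = card V - 1) \<and> card (cls V f A) = r"

text \<open>Steps keep class sizes. A colour used by g therefore has a nonempty class in f too, so
  the palette cannot grow.\<close>

lemma state_step:
  assumes "finite V" "state V S A r f" "step V f g"
  shows "state V S A r g"
proof -
  have c: "card (cls V f c) = card (cls V g c)" for c using assms(3) by (simp add: step_def)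
  have "g e \<in> insert A S" if "e \<in> edges V" for e
  proof -
    have "e \<in> cls V g (g e)" using that by (simp add: cls_def)
    then have "card (cls V g (g e)) \<noteq> 0" using assms(1) by auto
    then have "cls V f (g e) \<noteq> {}" using c by (metis card.empty)
    then obtain e' where "e' \<in> edges V" "f e' = g e" by (auto simp: cls_def)
    then show ?thesis using assms(2) unfolding state_def by (metis image_subset_iff)
  qed
  then show ?thesis using assms(2,3) c unfolding state_def step_def by auto
qed

lemma state_sim:
  assumes "finite V" "state V S A r f" "sim V f g"
  shows "state V S A r g"
  using assms(3,2) by (induction rule: rtranclp_induct) (auto intro: state_step[OF assms(1)])

lemma state_conn:
  assumes "finite V" "state V S A r f" "c \<in> S" "x \<in> V" "y \<in> V"
  shows "conn (cls V f c) x y"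
  by (rule forest_spanning[OF assms(1) cls_edges _ _ assms(4,5)])
    (use assms(2,3) in \<open>simp_all add: state_def valid_def\<close>)

definition tok :: "'a set \<Rightarrow> 'a \<Rightarrow> ('a set \<Rightarrow> 'c) \<Rightarrow> 'c \<Rightarrow> 'a set" where
  "tok V v f c = {t \<in> V - {v}. f {v, t} = c}"

lemma in_tok [simp]: "t \<in> tok V v f c \<longleftrightarrow> t \<in> V \<and> t \<noteq> v \<and> f {v, t} = c"
  by (auto simp: tok_def)

lemma finite_tok [simp]: "finite V \<Longrightarrow> finite (tok V v f c)"
  by (simp add: tok_def)

lemma cls_star:
  assumes "v \<in> V"
  shows "cls V f c = cls (V - {v}) f c \<union> (\<lambda>t. {v, t}) ` tok V v f c"
proof (intro equalityI subsetI)
  fix e assume "e \<in> cls V f c"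
  then obtain x y where e: "e = {x, y}" "x \<in> V" "y \<in> V" "x \<noteq> y" "f e = c"
    unfolding cls_def by (auto elim: edgesE)
  consider "x \<noteq> v" "y \<noteq> v" | "x = v" | "y = v" by blast
  then show "e \<in> cls (V - {v}) f c \<union> (\<lambda>t. {v, t}) ` tok V v f c"
  proof cases
    case 1 then show ?thesis using e by auto
  next
    case 2 then have "e = {v, y}" "y \<in> tok V v f c" using e by auto
    then show ?thesis by blast
  next
    case 3 then have "e = {v, x}" "x \<in> tok V v f c" using e by (auto simp: insert_commute)
    then show ?thesis by blast
  qed
next
  fix e assume "e \<in> cls (V - {v}) f c \<union> (\<lambda>t. {v, t}) ` tok V v f c"
  then show "e \<in> cls V f c"
  proof
    assume "e \<in> cls (V - {v}) f c" then show ?thesis using cls_mono[of "V - {v}" V f c] by blast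
  next
    assume "e \<in> (\<lambda>t. {v, t}) ` tok V v f c"
    then obtain t where "e = {v, t}" "t \<in> tok V v f c" by blast
    then show ?thesis using assms by auto
  qed
qed

lemma notin_Union_cls: "v \<notin> \<Union>(cls (V - {v}) f c)"
  using Union_cls[of "V - {v}" f c] by blast

lemma valid_star:
  assumes "v \<in> V"
  shows "valid V f \<longleftrightarrow> valid (V - {v}) f \<and>
    (\<forall>c. \<forall>p \<in> tok V v f c. \<forall>q \<in> tok V v f c. p \<noteq> q \<longrightarrow> \<not> conn (cls (V - {v}) f c) p q)"
proof -
  have "v \<notin> tok V v f c" for c by simp
  then have "forest (cls V f c) \<longleftrightarrow> forest (cls (V - {v}) f c) \<and>
    (\<forall>p \<in> tok V v f c. \<forall>q \<in> tok V v f c. p \<noteq> q \<longrightarrow> \<not> conn (cls (V - {v}) f c) p q)" for c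
    unfolding cls_star[OF assms] by (rule forest_star[OF notin_Union_cls])
  then show ?thesis unfolding valid_def by blast
qed

lemma conn_cls_star:
  assumes "v \<in> V" "conn (cls V f c) u w" "u \<noteq> v"
  shows "w \<noteq> v \<and> conn (cls (V - {v}) f c) u w \<or> (\<exists>p \<in> tok V v f c. conn (cls (V - {v}) f c) u p \<and>
    (w = v \<or> (\<exists>q \<in> tok V v f c. conn (cls (V - {v}) f c) q w)))"
  by (rule conn_star[OF assms(2)[unfolded cls_star[OF assms(1)]] assms(3) notin_Union_cls])

lemma card_cls_star:
  assumes "finite V" "v \<in> V"
  shows "card (cls V f c) = card (cls (V - {v}) f c) + card (tok V v f c)"
proof -
  have "inj_on (\<lambda>t. {v, t}) (tok V v f c)" by (rule inj_onI) (auto simp: doubleton_eq_iff)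
  moreover have "cls (V - {v}) f c \<inter> (\<lambda>t. {v, t}) ` tok V v f c = {}"
    using notin_Union_cls[of v V f c] by blast
  ultimately show ?thesis
    unfolding cls_star[OF assms(2)] using assms by (simp add: card_Un_disjoint card_image)
qed

definition swap_tok :: "'a \<Rightarrow> 'a \<Rightarrow> 'a \<Rightarrow> ('a set \<Rightarrow> 'c) \<Rightarrow> 'a set \<Rightarrow> 'c" where
  "swap_tok v y z f = f({v, y} := f {v, z}, {v, z} := f {v, y})"

lemma swap_tok_simps:
  assumes "v \<noteq> y" "v \<noteq> z" "y \<noteq> z"
  shows "swap_tok v y z f {v, y} = f {v, z}" "swap_tok v y z f {v, z} = f {v, y}"
    "e \<noteq> {v, y} \<Longrightarrow> e \<noteq> {v, z} \<Longrightarrow> swap_tok v y z f e = f e"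
  using assms by (auto simp: swap_tok_def doubleton_eq_iff)

lemma swap_tok_edges:
  "e \<in> edges (V - {v}) \<Longrightarrow> swap_tok v y z f e = f e"
  unfolding swap_tok_def edges_def by (auto simp: doubleton_eq_iff)

text \<open>
  The colours in \<open>S\<close> span \<open>V\<close>; the class of \<open>A\<close> is a forest with \<open>r\<close> edges that need not be spanning. The vertex
  \<open>v\<close> is the one to be removed: \<open>F f c\<close> is the part of class \<open>c\<close> avoiding \<open>v\<close>, and \<open>T f c\<close> is the set of vertices
  carrying a token of colour \<open>c\<close>.
\<close>
locale peel =
  fixes V :: "'a set" and S :: "'c set" and A :: 'c and r :: nat and v :: 'a
  assumes finV: "finite V" and vV: "v \<in> V" and AS: "A \<notin> S" and finS: "finite S"
begin

abbreviation W where "W \<equiv> V - {v}"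
abbreviation F where "F f c \<equiv> cls W f c"
abbreviation T where "T f c \<equiv> tok V v f c"
abbreviation st where "st \<equiv> state V S A r"

lemma st_valid: "st f \<Longrightarrow> valid V f" by (simp add: state_def)

lemma token_unique:
  assumes "st f" "p \<in> T f c" "q \<in> T f c" "conn (F f c) p q" shows "p = q"
  using assms(2-4) conjunct2[OF valid_star[OF vV, THEN iffD1, OF st_valid[OF assms(1)]]] by metis

text \<open>A colour of \<open>S\<close> joins u to v, and the last vertex before v on the way
  carries a token. With \<open>token_unique\<close>, each component of such a colour off v carries
  exactly one token.\<close>

lemma token_ex:
  assumes "st f" "c \<in> S" "u \<in> W" shows "\<exists>p \<in> T f c. conn (F f c) p u"
  using conn_cls_star[OF vV state_conn[OF finV assms(1,2), of u v]] assms vV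
  by (metis Diff_iff conn_sym singletonI)

lemma token_color: "st f \<Longrightarrow> u \<in> W \<Longrightarrow> f {v, u} \<in> insert A S"
  unfolding state_def using vV by (metis Diff_iff edges_iff imageI singletonI subsetD)

lemma edge_color: "st f \<Longrightarrow> x \<in> V \<Longrightarrow> y \<in> V \<Longrightarrow> x \<noteq> y \<Longrightarrow> f {x, y} \<in> insert A S"
  unfolding state_def by (metis edges_iff imageI subsetD)

text \<open>Each of the two tokens must land in a component of its colour that holds no other token
  of that colour: either it stays in its own component or the target component is free. By
  \<open>token_ex\<close> the second alternative can only occur for A.\<close>

lemma swap_step:
  assumes st: "st f" and yz: "y \<in> W" "z \<in> W" "y \<noteq> z" and ne: "f {v, y} \<noteq> f {v, z}"
    and a: "conn (F f (f {v, y})) y z \<or> (\<forall>t \<in> T f (f {v, y}). \<not> conn (F f (f {v, y})) t z)"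
    and b: "conn (F f (f {v, z})) y z \<or> (\<forall>t \<in> T f (f {v, z}). \<not> conn (F f (f {v, z})) t y)"
  shows "step V f (swap_tok v y z f)"
proof -
  define g where "g = swap_tok v y z f"
  have neq: "v \<noteq> y" "v \<noteq> z" "y \<noteq> z" using yz by auto
  have gs: "g {v, y} = f {v, z}" "g {v, z} = f {v, y}" "\<And>e. e \<noteq> {v, y} \<Longrightarrow> e \<noteq> {v, z} \<Longrightarrow> g e = f e"
    unfolding g_def by (rule swap_tok_simps[OF neq]; assumption?)+
  have gt: "g {v, t} = (if t = y then f {v, z} else if t = z then f {v, y} else f {v, t})" for t
    using gs neq by (cases "t = v"; auto simp: doubleton_eq_iff)
  have gF: "F g c = F f c" for c
    by (rule cls_cong) (use swap_tok_edges g_def in metis)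
  have "valid W f" and u: "\<And>c p q. p \<in> T f c \<Longrightarrow> q \<in> T f c \<Longrightarrow> conn (F f c) p q \<Longrightarrow> p = q"
    using valid_star[OF vV, THEN iffD1, OF st_valid[OF st]] token_unique[OF st] by metis+
  have vg: "valid W g" using \<open>valid W f\<close> gF by (simp add: valid_def)
  have A1: "t = y" if t: "t \<in> T f (f {v, y})" "conn (F f (f {v, y})) t z" for t
  proof -
    have "conn (F f (f {v, y})) y z" using a t by blast
    then have "conn (F f (f {v, y})) t y" using t(2) conn_sym conn_trans by metis
    then show ?thesis using u[OF t(1), of y] yz by auto
  qed
  have B1: "t = z" if t: "t \<in> T f (f {v, z})" "conn (F f (f {v, z})) t y" for t
  proof -
    have "conn (F f (f {v, z})) y z" using b t by blast
    then have "conn (F f (f {v, z})) t z" using t(2) conn_trans by metis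
    then show ?thesis using u[OF t(1), of z] yz by auto
  qed
  have key: "p = q" if "p \<in> T g c" "q \<in> T g c" "conn (F f c) p q" for p q c
  proof (rule ccontr)
    assume "p \<noteq> q"
    have s: "conn (F f c) q p" using that(3) by (rule conn_sym)
    have pq: "p \<in> W" "q \<in> W" "g {v, p} = c" "g {v, q} = c" using that by auto
    consider "p = y" | "p = z" | "p \<noteq> y" "p \<noteq> z" by blast
    then show False
    proof cases
      case 1
      then have "c = f {v, z}" "q \<noteq> z" "q \<in> T f (f {v, z})"
        using pq gt[of p] gt[of q] ne \<open>p \<noteq> q\<close> by (auto split: if_splits)
      then show False using B1[of q] s 1 by auto
    next
      case 2
      then have "c = f {v, y}" "q \<noteq> y" "q \<in> T f (f {v, y})"
        using pq gt[of p] gt[of q] ne \<open>p \<noteq> q\<close> neq by (auto split: if_splits)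
      then show False using A1[of q] s 2 by auto
    next
      case 3
      then have pc: "p \<in> T f c" using pq gt[of p] by auto
      consider "q = y" | "q = z" | "q \<noteq> y" "q \<noteq> z" by blast
      then show False
      proof cases
        case 1
        then have "c = f {v, z}" using pq gt[of q] by auto
        then show False using B1[of p] pc that(3) 1 3 by auto
      next
        case 2
        then have "c = f {v, y}" using pq gt[of q] neq by auto
        then show False using A1[of p] pc that(3) 2 3 by auto
      next
        case c: 3
        then have "q \<in> T f c" using pq gt[of q] by auto
        then show False using u[OF pc] that(3) \<open>p \<noteq> q\<close> by auto
      qed
    qed
  qed
  then have "valid V g" using valid_star[OF vV, of g] vg gF by auto
  then have fg: "forest (cls V g c)" for c by (rule validD)
  have off: "\<forall>e \<in> edges V - tri v y z. g e = f e" using gs(3) by (auto simp: tri_def)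
  have yz': "g {y, z} = f {y, z}" using gs(3)[of "{y, z}"] neq by (auto simp: doubleton_eq_iff)
  have "step V f g"
    by (rule stepI_tri[OF finV st_valid[OF st] vV _ _ neq off fg]) (use yz gs yz' in auto)
  then show ?thesis by (simp add: g_def)
qed

end

text \<open>The A-path z, y, x is replaced by the A-path y, x, z. Only the colour that moves from
  \<open>{x, z}\<close> to \<open>{y, z}\<close> could create a cycle.\<close>

lemma shift_color_end:
  assumes fin: "finite V" and val: "valid V f" and mem: "x \<in> V" "y \<in> V" "z \<in> V"
    and ne: "x \<noteq> y" "x \<noteq> z" "y \<noteq> z"
    and fA: "f {y, z} = A" "f {x, y} = A" "f {x, z} \<noteq> A"
    and nc: "\<not> conn (cls (V - {x}) f (f {x, z})) y z"
  shows "\<exists>g. step V f g \<and> g {x, y} = A \<and> g {x, z} = A \<and> (\<forall>e. e \<notin> tri x y z \<longrightarrow> g e = f e)"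
proof -
  define H where "H c = cls V f c - tri x y z" for c
  define b where "b = f {x, z}"
  have d: "{x, y} \<noteq> {x, z}" "{x, y} \<noteq> {y, z}" "{x, z} \<noteq> {y, z}"
    using tri_edges_distinct ne by metis+
  note ft = forest_cls_tri[OF val mem ne, folded H_def]
  have ff: "\<not> conn (H A) x y" "\<not> conn (H A) x z" "\<not> conn (H A) y z" "\<not> conn (H b) x z"
    using ft[of f A] ft[of f b] validD[OF val] fA by (simp_all add: b_def)
  have fb: "\<not> conn (H b) y z"
  proof
    assume *: "conn (H b) y z"
    have "\<not> conn (H b) y x" using ff(4) * conn_sym conn_trans by metis
    then have "conn (cls (V - {x}) f b) y z"
      by (rule conn_avoid[OF *]) (auto simp: H_def cls_def edges_def)
    then show False using nc by (simp add: b_def)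
  qed
  define g where "g = f({x, z} := A, {y, z} := b)"
  have gv: "g {x, y} = A" "g {x, z} = A" "g {y, z} = b" using d fA by (auto simp: g_def)
  have off: "e \<notin> tri x y z \<Longrightarrow> g e = f e" for e by (auto simp: g_def tri_def)
  have off': "\<forall>e \<in> edges V - tri x y z. g e = f e" using off by simp
  have bA: "b \<noteq> A" using fA by (simp add: b_def)
  have fo: "forest (cls V g c)" for c
  proof -
    have *: "b \<noteq> A \<Longrightarrow> \<not> K1 A \<Longrightarrow> \<not> K2 A \<Longrightarrow> \<not> K3 A \<Longrightarrow> \<not> K3 b \<Longrightarrow>
      (A = c \<longrightarrow> \<not> K1 c) \<and> (A = c \<longrightarrow> \<not> K2 c) \<and> (b = c \<longrightarrow> \<not> K3 c) \<and> (A = c \<and> A = c \<longrightarrow> \<not> K3 c) \<and>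
      (A = c \<and> b = c \<longrightarrow> \<not> K2 c) \<and> (A = c \<and> b = c \<longrightarrow> \<not> K1 c) \<and> \<not> (A = c \<and> A = c \<and> b = c)"
      for K1 K2 K3 by auto
    show ?thesis
      by (simp only: ft[OF off'] gv) (rule *[of "\<lambda>c. conn (H c) x y" "\<lambda>c. conn (H c) x z" "\<lambda>c. conn (H c) y z",
          OF bA ff(1-3) fb])
  qed
  have "step V f g"
    by (rule stepI_tri[OF fin val mem ne off' fo]) (simp add: gv fA b_def)
  then show ?thesis using gv off by metis
qed

text \<open>If neither edge from x to y or z has colour A, then deleting \<open>{y, z}\<close> from
  A separates y from z. So A without this edge fails to join x to one of them, and
  \<open>shift_color\<close> puts A there. If exactly one of the two edges has colour A,
  \<open>shift_color_end\<close> applies; both together would close a triangle of colour A.\<close>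

lemma gain:
  assumes fin: "finite V" and val: "valid V f" and mem: "x \<in> V" "y \<in> V" "z \<in> V"
    and ne: "x \<noteq> y" "x \<noteq> z" "y \<noteq> z" and A: "f {y, z} = A" and nsw: "\<not> swappable V f x y z"
  shows "\<exists>g. step V f g \<and> tok V x f A \<subset> tok V x g A"
proof -
  have zy: "f {z, y} = A" using A by (simp add: insert_commute)
  have tr: "{x, t} \<in> tri x y z \<Longrightarrow> t = y \<or> t = z \<or> t = x" for t
    using ne by (auto simp: tri_def doubleton_eq_iff)
  have fin': ?thesis if g: "step V f g" "\<forall>e. e \<notin> tri x y z \<longrightarrow> g e = f e"
      and up: "f {x, y} = A \<Longrightarrow> g {x, y} = A" "f {x, z} = A \<Longrightarrow> g {x, z} = A"
        "f {x, y} \<noteq> A \<and> g {x, y} = A \<or> f {x, z} \<noteq> A \<and> g {x, z} = A" for g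
  proof -
    have "t \<in> tok V x g A" if "t \<in> tok V x f A" for t
      using that g(2) up(1,2) tr[of t] by (cases "t = y \<or> t = z") auto
    moreover have "y \<in> tok V x g A - tok V x f A \<or> z \<in> tok V x g A - tok V x f A"
      using up(3) mem ne by auto
    ultimately have "tok V x f A \<subset> tok V x g A" by blast
    then show ?thesis using g(1) by blast
  qed
  have single: ?thesis if "f {x, y} \<noteq> A" "f {x, z} \<noteq> A"
  proof -
    have "\<not> conn (cls V f A - {{y, z}}) y z"
      using forestD[OF validD[OF val], of y z A] A mem ne by simp
    then have "\<not> (conn (cls V f A - {{y, z}}) x y \<and> conn (cls V f A - {{y, z}}) x z)"
      by (meson conn_sym conn_trans)
    moreover have "{z, y} = {y, z}" by auto
    ultimately consider "\<not> conn (cls V f A - {{y, z}}) x y" | "\<not> conn (cls V f A - {{z, y}}) x z"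
      by metis
    then show ?thesis
    proof cases
      case 1
      show ?thesis using shift_color[OF fin val mem ne A that nsw 1] fin' that by metis
    next
      case 2
      have "\<not> swappable V f x z y" using nsw swappable_commute by metis
      from shift_color[OF fin val mem(1,3,2) ne(2,1) ne(3)[symmetric] zy that(2,1) this 2]
      show ?thesis using fin' that tri_commute(2) by metis
    qed
  qed
  have "\<not> (f {x, y} = A \<and> f {x, z} = A)"
  proof
    assume *: "f {x, y} = A \<and> f {x, z} = A"
    have "conn (cls (V - {x}) f A) y z" by (rule conn_edge) (use A mem ne in auto)
    then show False
      using valid_star[OF mem(1), THEN iffD1, OF val] * mem ne by (metis in_tok)
  qed
  moreover have ?thesis if "f {x, y} = A" "f {x, z} \<noteq> A"
  proof -
    have "conn (cls (V - {x}) f A) y z" by (rule conn_edge) (use A mem ne in auto)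
    then have "\<not> conn (cls (V - {x}) f (f {x, z})) y z"
      using nsw that unfolding swappable_def by metis
    from shift_color_end[OF fin val mem ne A that this]
    show ?thesis using fin' that by metis
  qed
  moreover have ?thesis if "f {x, z} = A" "f {x, y} \<noteq> A"
  proof -
    have "conn (cls (V - {x}) f A) y z" by (rule conn_edge) (use A mem ne in auto)
    then have "\<not> conn (cls (V - {x}) f (f {x, y})) z y"
      using nsw that unfolding swappable_def by (metis conn_sym)
    from shift_color_end[OF fin val mem(1,3,2) ne(2,1) ne(3)[symmetric] zy that this]
    show ?thesis using fin' that tri_commute(2) by metis
  qed
  ultimately show ?thesis using single by blast
qed

section \<open>Stuck colourings: the A-degree of v cannot grow\<close>

context peel
begin

text \<open>Maximality ranges over everything reachable, so every step that keeps the A-degree keeps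
  stuckness (\<open>stuck_step\<close>). Tokens may therefore be rearranged first and stuckness used
  afterwards.\<close>

definition stuck :: "('a set \<Rightarrow> 'c) \<Rightarrow> bool" where
  "stuck f \<longleftrightarrow> st f \<and> (\<forall>g. sim V f g \<longrightarrow> card (T g A) \<le> card (T f A))"

lemma stuck_st: "stuck f \<Longrightarrow> st f" by (simp add: stuck_def)

lemma stuck_step:
  assumes "stuck f" "step V f g" "card (T g A) = card (T f A)" shows "stuck g"
  using assms state_step[OF finV, of S A r f g] unfolding stuck_def
  by (metis converse_rtranclp_into_rtranclp)

lemma stuck_swappable:
  assumes "stuck f" "y \<in> W" "z \<in> W" "y \<noteq> z" "f {y, z} = A"
  shows "swappable V f v y z"
proof (rule ccontr)
  assume "\<not> ?thesis"
  moreover have "y \<in> V" "z \<in> V" "v \<noteq> y" "v \<noteq> z" using assms by auto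
  ultimately obtain g where g: "step V f g" "T f A \<subset> T g A"
    using gain[OF finV st_valid[OF stuck_st[OF assms(1)]] vV, of y z] assms(4,5) by metis
  then have "card (T f A) < card (T g A)" using finV by (intro psubset_card_mono) auto
  then show False using assms(1) g(1) unfolding stuck_def by (metis not_less r_into_rtranclp)
qed

lemma F_cong: "(\<And>e. e \<in> edges W \<Longrightarrow> g e = f e) \<Longrightarrow> F g c = F f c"
  by (rule cls_cong) simp

lemma F_swap: "F (swap_tok v y z f) c = F f c"
  by (rule F_cong) (rule swap_tok_edges)

lemma swap_stuck:
  assumes "stuck f" "y \<in> W" "z \<in> W" "y \<noteq> z" and ne: "f {v, y} \<noteq> f {v, z}"
    and a: "conn (F f (f {v, y})) y z \<or> (\<forall>t \<in> T f (f {v, y}). \<not> conn (F f (f {v, y})) t z)"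
    and b: "conn (F f (f {v, z})) y z \<or> (\<forall>t \<in> T f (f {v, z}). \<not> conn (F f (f {v, z})) t y)"
  shows "stuck (swap_tok v y z f)" and "card (T (swap_tok v y z f) c) = card (T f c)"
proof -
  have s: "step V f (swap_tok v y z f)"
    using swap_step[OF stuck_st] assms by blast
  then have "card (cls V f c) = card (cls V (swap_tok v y z f) c)" for c by (simp add: step_def)
  then have c: "card (T (swap_tok v y z f) c) = card (T f c)" for c
    using card_cls_star[OF finV vV] F_swap by (metis add_left_cancel)
  show "stuck (swap_tok v y z f)" by (rule stuck_step[OF assms(1) s c])
  show "card (T (swap_tok v y z f) c) = card (T f c)" by (rule c)
qed

lemma stuck_swap_edge:
  assumes "stuck f" "y \<in> W" "z \<in> W" "y \<noteq> z" "f {y, z} = A"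
  shows "stuck (swap_tok v y z f)"
  using stuck_swappable[OF assms] swap_stuck(1)[OF assms(1-4)] unfolding swappable_def by blast

text \<open>The token moves along the path.\<close>
lemma stuck_conn:
  assumes "stuck f" "y \<in> W" "conn (F f A) y z"
  shows "conn (F f (f {v, y})) y z"
proof -
  \<comment> \<open>Generalised to all stuck g with the same classes off v: the induction along the
    A-path hands the token of y to the next vertex and continues with the colouring obtained by this
    swap.\<close>
  have "\<forall>g. stuck g \<and> (\<forall>c. F g c = F f c) \<longrightarrow> conn (F f (g {v, y})) y z"
    using assms(3) unfolding conn_def[of "F f A"]
  proof (induction rule: converse_rtranclp_induct)
    case base
    then show ?case by simp
  next
    case (step y u)
    show ?case
    proof (intro allI impI)
      fix g assume g: "stuck g \<and> (\<forall>c. F g c = F f c)"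
      have "{y, u} \<in> F g A" using step(1) g by simp
      then have yu: "y \<in> W" "u \<in> W" "y \<noteq> u" "g {y, u} = A" by auto
      let ?h = "swap_tok v y u g"
      have "stuck ?h" using stuck_swap_edge[of g] g yu by blast
      moreover have "\<forall>c. F ?h c = F f c" using g F_swap by metis
      moreover have "?h {v, u} = g {v, y}" using swap_tok_simps(2)[of v y u g] yu by auto
      ultimately have "conn (F f (g {v, y})) u z" using step(3) by metis
      moreover have "conn (F f (g {v, y})) y u"
        using stuck_swappable[of g y u] g yu unfolding swappable_def by metis
      ultimately show "conn (F f (g {v, y})) y z" using conn_trans by metis
    qed
  qed
  then show ?thesis using assms(1) by blast
qed

lemma stuck_token_inj:
  assumes "stuck f" "y \<in> W" "z \<in> W" "conn (F f A) y z" "f {v, y} = f {v, z}"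
  shows "y = z"
  using token_unique[OF stuck_st[OF assms(1)], of y "f {v, y}" z] stuck_conn[OF assms(1,2,4)] assms by auto

text \<open>Tokens on one A-component have pairwise different colours
  (\<open>stuck_token_inj\<close>), so the number of available colours bounds its size.\<close>

lemma comp_card:
  assumes "stuck f" "y \<in> W" "K \<subseteq> {u. conn (F f A) y u}"
  shows "card K \<le> card S + 1" and "T f A = {} \<Longrightarrow> card K \<le> card S"
proof -
  have K: "u \<in> W" if "u \<in> K" for u using assms that conn_cls_in by (metis mem_Collect_eq subsetD)
  have inj: "inj_on (\<lambda>u. f {v, u}) K"
  proof (rule inj_onI)
    fix a b assume ab: "a \<in> K" "b \<in> K" "f {v, a} = f {v, b}"
    have "conn (F f A) a b" using ab assms(3) conn_sym conn_trans by (metis mem_Collect_eq subsetD)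
    then show "a = b" using stuck_token_inj[OF assms(1) K K] ab by metis
  qed
  have im: "(\<lambda>u. f {v, u}) ` K \<subseteq> insert A S"
    using token_color[OF stuck_st[OF assms(1)] K] by (auto simp del: insert_iff)
  show "card K \<le> card S + 1"
    using card_inj_on_le[OF inj im] finS AS by simp
  assume "T f A = {}"
  then have "A \<notin> (\<lambda>u. f {v, u}) ` K" using K by (auto simp: tok_def)
  then have "(\<lambda>u. f {v, u}) ` K \<subseteq> S" using im by blast
  then show "card K \<le> card S" by (rule card_inj_on_le[OF inj _ finS])
qed

section \<open>Colours with a single token\<close>

lemma conn_single_token:
  assumes "st f" "E \<in> S" "T f E = {y}" "u \<in> W" shows "conn (F f E) y u"
  using token_ex[OF assms(1,2,4)] assms(3) by auto

text \<open>The only token of E can be exchanged with the B-token lying in the B-component of y: E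
  is connected off v, and the B-token stays in its component. Afterwards y carries B, and stuckness
  along \<open>{y, z}\<close> shows that B joins y to z.\<close>

lemma stuck_single_token:
  assumes f: "stuck f" and yz: "y \<in> W" "z \<in> W" "y \<noteq> z" "f {y, z} = A"
    and E: "E \<in> S" "T f E = {y}" and B: "B \<in> S"
  shows "conn (F f B) y z"
proof -
  have "y \<in> T f E" using E(2) by simp
  then have fy: "f {v, y} = E" by simp
  obtain t where t: "t \<in> T f B" "conn (F f B) t y" using token_ex[OF stuck_st[OF f] B yz(1)] by blast
  show ?thesis
  proof (cases "t = y")
    case True
    then have "B = E" using t fy by auto
    then show ?thesis using stuck_swappable[OF f yz] fy unfolding swappable_def by simp
  next
    case False
    have tW: "t \<in> W" "f {v, t} = B" using t by auto
    have BE: "B \<noteq> E" using False t(1) E(2) by (metis singletonD)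
    have "conn (F f E) y t" using conn_single_token[OF stuck_st[OF f] E tW(1)] .
    then have "stuck (swap_tok v y t f)"
      using swap_stuck(1)[OF f yz(1) tW(1) False[symmetric]] fy tW BE t conn_sym by metis
    then have "swappable V (swap_tok v y t f) v y z"
      by (rule stuck_swappable) (use yz swap_tok_edges[of "{y, z}" V v y t f] in auto)
    moreover have "swap_tok v y t f {v, y} = B"
      using swap_tok_simps(1)[of v y t f] yz tW False by auto
    ultimately show ?thesis unfolding swappable_def using F_swap by metis
  qed
qed

text \<open>
  Under this hypothesis no \<open>A\<close>-edge of a stuck colouring joins two components of the colour \<open>B\<close>. The colours \<open>C\<close>
  and \<open>E\<close> may coincide.
\<close>
definition tame :: "('a set \<Rightarrow> 'c) \<Rightarrow> 'c \<Rightarrow> bool" where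
  "tame f B \<longleftrightarrow> (\<exists>C E. S = {B, C, E} \<and> card (T f E) = 1 \<and> (card (T f C) = 1 \<or> card (T f A) = 1))"

text \<open>If y or z carries B, swappability along \<open>{y, z}\<close> suffices; if one of them
  carries a colour of \<open>S\<close> with a single token, \<open>stuck_single_token\<close> does.
  The tokens A and C remain. If it is A that has a single token, it is first traded for the token of
  E.\<close>

lemma stuck_tame_conn:
  assumes f: "stuck f" and B: "tame f B" and yz: "y \<in> W" "z \<in> W" "y \<noteq> z" "f {y, z} = A"
  shows "conn (F f B) y z"
proof -
  obtain C E where S: "S = {B, C, E}" and E: "card (T f E) = 1" and C: "card (T f C) = 1 \<or> card (T f A) = 1"
    using B unfolding tame_def by blast
  note stf = stuck_st[OF f]
  have zy: "f {z, y} = A" using yz by (simp add: insert_commute)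
  have one: "T f c = {u}" if h: "card (T f c) = 1" "u \<in> W" "f {v, u} = c" for c u
  proof -
    obtain w where w: "T f c = {w}" by (rule card_1_singletonE[OF h(1)])
    have "u \<in> T f c" using h by simp
    then show ?thesis using w by simp
  qed
  have single: "conn (F f B) y z" if "c \<in> S" "card (T f c) = 1" "f {v, y} = c \<or> f {v, z} = c" for c
    using that(3)
  proof
    assume "f {v, y} = c"
    then show ?thesis using stuck_single_token[OF f yz that(1) one[OF that(2) yz(1)]] S by simp
  next
    assume "f {v, z} = c"
    then have "conn (F f B) z y"
      using stuck_single_token[OF f yz(2,1) yz(3)[symmetric] zy that(1) one[OF that(2) yz(2)]] S by simp
    then show ?thesis by (rule conn_sym)
  qed
  \<comment> \<open>The A-token is the only one, so it may jump to the bearer e of the E-token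
    whether or not A joins y to e. Then y carries the single token of E.\<close>
  have aux: "conn (F f B) y z" if yz: "y \<in> W" "z \<in> W" "y \<noteq> z" "f {y, z} = A"
    and A: "card (T f A) = 1" "f {v, y} = A" for y z
  proof -
    obtain e where e: "T f E = {e}" by (rule card_1_singletonE[OF E])
    then have "e \<in> T f E" by simp
    then have eW: "e \<in> W" "f {v, e} = E" by simp_all
    have "E \<noteq> A" using AS S by auto
    then have ye: "y \<noteq> e" using eW A by auto
    have TA: "T f A = {y}" using one[OF A(1) yz(1) A(2)] .
    have ce: "conn (F f E) e y" using conn_single_token[OF stf _ e yz(1)] S by simp
    let ?g = "swap_tok v y e f"
    have g: "stuck ?g" "card (T ?g E) = card (T f E)"
      using swap_stuck[OF f yz(1) eW(1) ye] A(2) eW(2) \<open>E \<noteq> A\<close> TA conn_sym[OF ce] by auto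
    have gy: "?g {v, y} = E" using swap_tok_simps(1)[of v y e f] yz eW ye by auto
    obtain w where w: "T ?g E = {w}" using g(2) E card_1_singletonE by metis
    have "y \<in> T ?g E" using gy yz by simp
    then have "T ?g E = {y}" using w by simp
    then have "conn (F ?g B) y z"
      by (intro stuck_single_token[OF g(1) yz(1-3) _ _ ]) (use yz swap_tok_edges[of "{y, z}" V v y e f] S in auto)
    then show ?thesis using F_swap by metis
  qed
  have sw: "f {v, y} \<noteq> f {v, z}" "conn (F f (f {v, y})) y z" "conn (F f (f {v, z})) y z"
    using stuck_swappable[OF f yz] unfolding swappable_def by auto
  have cy: "f {v, y} \<in> {A, B, C, E}" "f {v, z} \<in> {A, B, C, E}"
    using token_color[OF stf yz(1)] token_color[OF stf yz(2)] S by auto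
  consider "f {v, y} = B \<or> f {v, z} = B" | "f {v, y} = E \<or> f {v, z} = E"
    | "f {v, y} = A \<and> f {v, z} = C" | "f {v, y} = C \<and> f {v, z} = A"
    using cy sw(1) by auto
  then show ?thesis
  proof cases
    case 1 then show ?thesis using sw(2,3) by auto
  next
    case 2 then show ?thesis using single[of E] E S by auto
  next
    case 3 then show ?thesis using single[of C] C S aux[OF yz] by auto
  next
    case 4 then show ?thesis using single[of C] C S aux[OF yz(2,1) yz(3)[symmetric] zy] conn_sym by auto
  qed
qed

section \<open>A-edges do not cross between components of B\<close>

lemma T_cong: "(\<And>t. t \<in> W \<Longrightarrow> g {v, t} = f {v, t}) \<Longrightarrow> T g c = T f c"
  by (auto simp: tok_def)

lemma tame_cong: "(\<And>c. card (T g c) = card (T f c)) \<Longrightarrow> tame g B \<longleftrightarrow> tame f B"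
  by (simp add: tame_def)

lemma stuck_tri:
  assumes "stuck f" "step V f g" "\<forall>e. e \<notin> tri x y z \<longrightarrow> g e = f e" "v \<notin> {x, y, z}"
  shows "stuck g" "T g c = T f c"
proof -
  have "{v, t} \<notin> tri x y z" for t using assms(4) by (auto simp: tri_def doubleton_eq_iff)
  then have *: "T g c = T f c" for c by (intro T_cong) (use assms(3) in simp)
  then show "T g c = T f c" by simp
  show "stuck g" by (rule stuck_step[OF assms(1,2)]) (simp add: *)
qed

text \<open>Otherwise \<open>shift_color\<close> moves A from \<open>{y, z}\<close> to an edge from
  x to y or z. No edge of the triangle has colour B before or after, so the B-components are
  unchanged, and the new A-edge crosses between two of them although the colouring is still stuck
  and tame.\<close>

lemma no_crossing_gain:
  assumes f: "stuck f" and B: "tame f B" and yz: "y \<in> W" "z \<in> W" "y \<noteq> z" "f {y, z} = A"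
    and x: "x \<in> W" "\<not> conn (F f B) x y" and nsw: "\<not> swappable V f x y z"
  shows False
proof -
  have BA: "B \<in> S" "B \<noteq> A" using B AS unfolding tame_def by auto
  note stf = stuck_st[OF f]
  have c: "conn (F f B) y z" using stuck_tame_conn[OF f B yz] .
  have xz: "\<not> conn (F f B) x z" using c x(2) conn_sym conn_trans by metis
  have ne: "x \<noteq> y" "x \<noteq> z" using x(2) xz by auto
  have nb: "f {x, y} \<noteq> B" "f {x, z} \<noteq> B"
    using x xz yz ne conn_edge[of x y "F f B"] conn_edge[of x z "F f B"] by auto
  have nA: "f {x, y} \<noteq> A" "f {x, z} \<noteq> A"
    using stuck_tame_conn[OF f B x(1) yz(1) ne(1)] stuck_tame_conn[OF f B x(1) yz(2) ne(2)] x(2) xz by auto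
  have main: False if t: "t \<in> {y, z}" and g: "step V f g" "\<forall>e. e \<notin> tri x y z \<longrightarrow> g e = f e" "g {x, t} = A"
    and gB: "g {x, y} \<noteq> B" "g {x, z} \<noteq> B" "g {y, z} \<noteq> B" for g t
  proof -
    have vn: "v \<notin> {x, y, z}" using x yz by auto
    have sg: "stuck g" "tame g B"
      using stuck_tri[OF f g(1,2) vn] B tame_cong[of g f] by auto
    have "F g B = F f B"
    proof -
      have "g e = B \<longleftrightarrow> f e = B" for e
        using g(2) gB nb yz(4) BA by (cases "e \<in> tri x y z") (auto simp: tri_def)
      then show ?thesis by (simp add: cls_def)
    qed
    moreover have "conn (F g B) x t" using stuck_tame_conn[OF sg x(1), of t] t g(3) yz ne by auto
    ultimately show False using t x xz by auto
  qed
  have val: "valid V f" using stf st_valid by blast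
  have V: "x \<in> V" "y \<in> V" "z \<in> V" using x yz by auto
  have zy: "f {z, y} = A" using yz by (simp add: insert_commute)
  have "\<not> conn (cls V f A - {{y, z}}) y z"
    using forestD[OF validD[OF val], of y z A] V yz by simp
  then have "\<not> (conn (cls V f A - {{y, z}}) x y \<and> conn (cls V f A - {{y, z}}) x z)"
    by (meson conn_sym conn_trans)
  moreover have "{z, y} = {y, z}" by auto
  ultimately consider "\<not> conn (cls V f A - {{y, z}}) x y" | "\<not> conn (cls V f A - {{z, y}}) x z"
    by metis
  then show False
  proof cases
    case 1
    obtain g where "step V f g" "g {x, y} = A" "{g {x, z}, g {y, z}} \<subseteq> {f {x, y}, f {x, z}}" "\<forall>e. e \<notin> tri x y z \<longrightarrow> g e = f e"
      using shift_color[OF finV val V ne yz(3,4) nA nsw 1] by blast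
    then show False using main[of y g] nb BA by auto
  next
    case 2
    have nsw': "\<not> swappable V f x z y" using nsw swappable_commute by metis
    obtain g where "step V f g" "g {x, z} = A" "{g {x, y}, g {z, y}} \<subseteq> {f {x, z}, f {x, y}}" "\<forall>e. e \<notin> tri x z y \<longrightarrow> g e = f e"
      using shift_color[OF finV val V(1,3,2) ne(2,1) yz(3)[symmetric] zy nA(2,1) nsw' 2] by blast
    then show False using main[of z g] nb BA tri_commute(2)[of x y z] by (auto simp: insert_commute)
  qed
qed

end

text \<open>On three vertices each colour would need two of the three edges; on two vertices there
  is only one edge.\<close>

lemma two_colors_small:
  assumes "card K = 2 \<or> card K = 3" "a \<noteq> c"
    and "\<And>u. u \<in> K \<Longrightarrow> \<exists>w \<in> K. w \<noteq> u \<and> f {u, w} = a" "\<And>u. u \<in> K \<Longrightarrow> \<exists>w \<in> K. w \<noteq> u \<and> f {u, w} = c"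
  shows False
  using assms(1)
proof
  assume "card K = 2"
  then obtain p q where K: "K = {p, q}" by (auto simp: card_2_iff)
  show False using assms(3)[of p] assms(4)[of p] assms(2) K by auto
next
  assume "card K = 3"
  then obtain p q s where K: "K = {p, q, s}" by (auto simp: card_3_iff)
  have e: "{q, p} = {p, q}" "{s, p} = {p, s}" "{s, q} = {q, s}" by auto
  have "f {p, q} = a \<or> f {p, s} = a" "f {p, q} = c \<or> f {p, s} = c" using assms(3)[of p] assms(4)[of p] K by auto
  moreover have "f {p, q} = a \<or> f {q, s} = a" "f {p, q} = c \<or> f {q, s} = c"
    using assms(3)[of q] assms(4)[of q] K e by auto
  moreover have "f {p, s} = a \<or> f {q, s} = a" "f {p, s} = c \<or> f {q, s} = c"
    using assms(3)[of s] assms(4)[of s] K e by auto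
  ultimately show False using assms(2) by metis
qed

text \<open>Pairwise disjoint edges would cover \<open>2 * card E\<close> vertices.\<close>

lemma edges_share_vertex:
  assumes "finite U" "E \<subseteq> edges U" "card U < 2 * card E"
  shows "\<exists>a b c. {a, b} \<in> E \<and> {b, c} \<in> E \<and> a \<noteq> c"
proof (rule ccontr)
  assume no: "\<not> ?thesis"
  have fE: "finite E" using finite_subset[OF assms(2)] assms(1) by simp
  have c2: "card e = 2" if "e \<in> E" for e
    using that assms(2) by (auto simp: edges_def)
  have "pairwise disjnt E"
  proof (rule pairwiseI)
    fix e d assume ed: "e \<in> E" "d \<in> E" "e \<noteq> d"
    show "disjnt e d"
    proof (rule ccontr)
      assume "\<not> disjnt e d"
      then obtain b where b: "b \<in> e" "b \<in> d" by (auto simp: disjnt_def)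
      obtain a where a: "e = {a, b}" using c2[OF ed(1)] b(1) by (auto simp: card_2_iff)
      obtain c where c: "d = {b, c}" using c2[OF ed(2)] b(2) by (auto simp: card_2_iff)
      have "a \<noteq> c" using ed(3) a c by auto
      then show False using no a c ed by blast
    qed
  qed
  then have "card (\<Union>E) = (\<Sum>e\<in>E. card e)"
    by (rule card_Union_disjoint) (metis c2 card.infinite zero_neq_numeral)
  then have "card (\<Union>E) = 2 * card E" using c2 by simp
  moreover have "\<Union>E \<subseteq> U" using assms(2) by (auto simp: edges_def)
  then have "card (\<Union>E) \<le> card U" by (rule card_mono[OF assms(1)])
  ultimately show False using assms(3) by simp
qed

section \<open>Components of A against components of another colour\<close>

context peel
begin

lemma F_nbr:
  assumes "conn (F f c) y u" "conn (F f c) y w" "u \<noteq> w"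
  shows "\<exists>t. conn (F f c) y t \<and> t \<noteq> u \<and> f {u, t} = c"
proof -
  have "conn (F f c) u w" using assms conn_sym conn_trans by metis
  then obtain t where t: "{u, t} \<in> F f c" using conn_first_edge assms(3) by metis
  then have "conn (F f c) y t" using assms(1) conn_step by metis
  then show ?thesis using t by auto
qed

text \<open>Every vertex of K would have an edge of either colour inside K, and two or three
  vertices have too few edges for that. Several of the later cases are reduced to this
  contradiction.\<close>

lemma same_comp:
  assumes "{u. conn (F f A) y u} = K" "{u. conn (F f c) y u} = K" "c \<noteq> A" "card K = 2 \<or> card K = 3"
  shows False
proof (rule two_colors_small[OF assms(4) assms(3)])
  have big: "\<exists>w \<in> K. w \<noteq> u" for u
  proof (rule ccontr)
    assume "\<not> ?thesis"
    then have "K \<subseteq> {u}" by blast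
    then have "card K \<le> 1" by (metis card.empty card_insert_le_m1 card_mono finite.emptyI finite.insertI is_singletonI is_singleton_altdef order_refl)
    then show False using assms(4) by auto
  qed
  show "\<exists>w\<in>K. w \<noteq> u \<and> f {u, w} = A" if "u \<in> K" for u
    using that big[of u] F_nbr[of f A y u] assms(1) by blast
  show "\<exists>w\<in>K. w \<noteq> u \<and> f {u, w} = c" if "u \<in> K" for u
    using that big[of u] F_nbr[of f c y u] assms(2) by blast
qed

text \<open>By \<open>stuck_conn\<close> the A-component of y1 lies inside its c-component, and
  \<open>token_unique\<close> separates the c-components of y1 and y2.\<close>

lemma comp_disjoint:
  assumes "stuck f" "y1 \<in> W" "y2 \<in> W" "y1 \<noteq> y2" "f {v, y1} = c" "f {v, y2} = c" "conn (F f A) y1 w"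
  shows "\<not> conn (F f c) y2 w"
proof
  assume "conn (F f c) y2 w"
  moreover have "conn (F f c) y1 w" using stuck_conn[OF assms(1,2,7)] assms(5) by simp
  ultimately have "conn (F f c) y1 y2" using conn_sym conn_trans by metis
  then show False using token_unique[OF stuck_st[OF assms(1)], of y1 c y2] assms by auto
qed

lemma F_in: "conn (F f c) y u \<Longrightarrow> y \<in> W \<Longrightarrow> u \<in> W"
  by (rule conn_cls_in)

lemma comp_sub: "y \<in> W \<Longrightarrow> {u. conn (F f c) y u} \<subseteq> W"
  using F_in by (metis mem_Collect_eq subsetI)

section \<open>One or two A-tokens when A spans V\<close>

lemma token_ex_A:
  assumes "st f" "r = card V - 1" "u \<in> W" shows "\<exists>p \<in> T f A. conn (F f A) p u"
proof -
  have "conn (cls V f A) u v"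
    by (rule forest_spanning[OF finV cls_edges]) (use assms vV in \<open>auto simp: state_def valid_def\<close>)
  then show ?thesis using conn_cls_star[OF vV] assms(3) by (metis Diff_iff conn_sym singletonI)
qed

lemma one_A_token_card:
  assumes f: "stuck f" and r: "r = card V - 1" and T: "T f A = {p}"
  shows "card W \<le> card S + 1"
proof -
  have "p \<in> T f A" using T by simp
  then have p: "p \<in> W" by simp
  have "W \<subseteq> {u. conn (F f A) p u}" using token_ex_A[OF stuck_st[OF f] r] T by auto
  then show ?thesis by (rule comp_card(1)[OF f p])
qed

text \<open>The larger A-component shows all token colours, so a token colour c other than A on the
  smaller one recurs there. The c-component of its bearer in the smaller A-component contains that
  A-component by \<open>stuck_conn\<close> and misses the larger one by
  \<open>comp_disjoint\<close>. It therefore equals the smaller A-component, against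
  \<open>same_comp\<close>.\<close>

lemma two_A_tokens_aux:
  assumes f: "stuck f" and p: "p1 \<in> T f A" "p2 \<in> T f A" "p1 \<noteq> p2"
    and cov: "\<And>u. u \<in> W \<Longrightarrow> conn (F f A) p1 u \<or> conn (F f A) p2 u"
    and c1: "card {u. conn (F f A) p1 u} = card S + 1" and c2: "card {u. conn (F f A) p2 u} = card S"
    and S: "card S = 2 \<or> card S = 3"
  shows False
proof -
  define K1 K2 where "K1 = {u. conn (F f A) p1 u}" and "K2 = {u. conn (F f A) p2 u}"
  have pW: "p1 \<in> W" "p2 \<in> W" "f {v, p1} = A" "f {v, p2} = A" using p by auto
  have KW: "K1 \<subseteq> W" "K2 \<subseteq> W" unfolding K1_def K2_def by (rule comp_sub[OF pW(1)], rule comp_sub[OF pW(2)])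
  have inj: "inj_on (\<lambda>u. f {v, u}) K1"
  proof (rule inj_onI)
    fix a b assume ab: "a \<in> K1" "b \<in> K1" "f {v, a} = f {v, b}"
    have "conn (F f A) a b" using ab(1,2) K1_def conn_sym conn_trans by (metis mem_Collect_eq)
    then show "a = b" using stuck_token_inj[OF f] ab KW by blast
  qed
  have "(\<lambda>u. f {v, u}) ` K1 \<subseteq> insert A S"
    using token_color[OF stuck_st[OF f]] KW by (auto simp del: insert_iff)
  then have im: "(\<lambda>u. f {v, u}) ` K1 = insert A S"
    by (rule card_subset_eq[rotated]) (use finS AS c1 K1_def card_image[OF inj] in auto)
  have "\<exists>u \<in> K2. u \<noteq> p2"
  proof (rule ccontr)
    assume "\<not> ?thesis"
    then have "K2 \<subseteq> {p2}" by blast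
    then have "card K2 \<le> card {p2}" by (rule card_mono[rotated]) simp
    then show False using S c2 K2_def by auto
  qed
  then obtain u where u: "u \<in> K2" "u \<noteq> p2" by blast
  define c where "c = f {v, u}"
  have uW: "u \<in> W" using u KW by blast
  have pu: "conn (F f A) p2 u" using u K2_def by simp
  have cA: "c \<noteq> A" using stuck_token_inj[OF f pW(2) uW pu] u(2) pW c_def by auto
  have "c \<in> insert A S" using token_color[OF stuck_st[OF f] uW] c_def by simp
  then obtain y where y: "y \<in> K1" "f {v, y} = c" using im by (metis (no_types, lifting) imageE)
  have yW: "y \<in> W" using y KW by blast
  have disj: "w \<notin> K2" if "w \<in> K1" for w
  proof
    assume "w \<in> K2"
    then have "conn (F f A) p1 p2" using that K1_def K2_def conn_sym conn_trans by (metis mem_Collect_eq)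
    then show False using token_unique[OF stuck_st[OF f] p(1,2)] p(3) by blast
  qed
  have yu: "y \<noteq> u" using disj y u by blast
  have A2: "{w. conn (F f A) u w} = K2"
    using pu conn_trans[of "F f A"] conn_sym[of "F f A"] unfolding K2_def by blast
  have "{w. conn (F f c) u w} = K2"
  proof (intro equalityI subsetI)
    fix w assume "w \<in> {w. conn (F f c) u w}"
    then have w: "conn (F f c) u w" by simp
    have wW: "w \<in> W" by (rule F_in[OF w uW])
    show "w \<in> K2"
    proof (rule ccontr)
      assume "w \<notin> K2"
      then have "w \<in> K1" using cov[OF wW] K1_def K2_def by blast
      then have "conn (F f A) y w" using y(1) K1_def conn_sym conn_trans by (metis mem_Collect_eq)
      from comp_disjoint[OF f yW uW yu y(2) c_def[symmetric] this] w show False by contradiction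
    qed
  next
    fix w assume "w \<in> K2"
    then have "conn (F f A) u w" using A2 by blast
    then show "w \<in> {w. conn (F f c) u w}" using stuck_conn[OF f uW, of w] c_def by simp
  qed
  then show False using same_comp[OF A2 _ cA] S c2 K2_def by auto
qed

text \<open>The two A-components partition \<open>W\<close>. Each has at most
  \<open>card S + 1\<close> vertices and together they have \<open>2 * card S + 1\<close>, which
  fixes both sizes.\<close>

lemma two_A_tokens_impossible:
  assumes f: "stuck f" and r: "r = card V - 1" and T: "T f A = {p1, p2}" "p1 \<noteq> p2"
    and S: "card S = 2 \<or> card S = 3" and W: "card W = 2 * card S + 1"
  shows False
proof -
  define K1 K2 where "K1 = {u. conn (F f A) p1 u}" and "K2 = {u. conn (F f A) p2 u}"
  have p: "p1 \<in> T f A" "p2 \<in> T f A" using T by auto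
  have pW: "p1 \<in> W" "p2 \<in> W" using p by auto
  have cov: "conn (F f A) p1 u \<or> conn (F f A) p2 u" if u: "u \<in> W" for u
  proof -
    obtain p where "p \<in> T f A" "conn (F f A) p u" using token_ex_A[OF stuck_st[OF f] r u] by blast
    then show ?thesis using T(1) by (metis insertE singletonD)
  qed
  have KW: "K1 \<subseteq> W" "K2 \<subseteq> W" unfolding K1_def K2_def by (rule comp_sub[OF pW(1)], rule comp_sub[OF pW(2)])
  have "K1 \<union> K2 = W"
  proof
    show "W \<subseteq> K1 \<union> K2" unfolding K1_def K2_def using cov by auto
  qed (use KW in auto)
  moreover have "K1 \<inter> K2 = {}"
  proof (rule ccontr)
    assume "K1 \<inter> K2 \<noteq> {}"
    then obtain w where "conn (F f A) p1 w" "conn (F f A) p2 w" unfolding K1_def K2_def by auto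
    then have "conn (F f A) p1 p2" using conn_sym conn_trans by metis
    then show False using token_unique[OF stuck_st[OF f] p] T(2) by simp
  qed
  moreover have "finite K1" "finite K2" using KW finV by (meson finite_Diff finite_subset)+
  ultimately have "card K1 + card K2 = 2 * card S + 1" using W card_Un_disjoint by metis
  moreover have "card K1 \<le> card S + 1" "card K2 \<le> card S + 1"
    using comp_card(1)[OF f pW(1)] comp_card(1)[OF f pW(2)] K1_def K2_def by auto
  ultimately consider "card K1 = card S + 1" "card K2 = card S" | "card K2 = card S + 1" "card K1 = card S"
    by linarith
  then show False
  proof cases
    case 1
    then show ?thesis using two_A_tokens_aux[OF f p T(2) cov _ _ S] K1_def K2_def by blast
  next
    case 2
    then show ?thesis using two_A_tokens_aux[OF f p(2,1) T(2)[symmetric] _ _ _ S] cov K1_def K2_def by blast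
  qed
qed

section \<open>Contradictions from a B with several components\<close>

lemma crossing_colors:
  assumes "stuck f" "tame f B" "x \<in> W" "y \<in> W" "\<not> conn (F f B) x y"
  shows "f {x, y} \<noteq> A" "f {x, y} \<noteq> B" "x \<noteq> y"
proof -
  show "x \<noteq> y" using assms by auto
  then show "f {x, y} \<noteq> A" using stuck_tame_conn[OF assms(1-4)] assms(5) by blast
  show "f {x, y} \<noteq> B" using assms \<open>x \<noteq> y\<close> conn_edge[of x y "F f B"] by auto
qed

text \<open>The edges from x to y1, y2, y3 only use the colours C and E, and swappability at x makes
  them alternate. Hence \<open>{x, y1}\<close> and \<open>{x, y3}\<close> share a colour that also
  joins y1 to y3 without x, which is a cycle through x.\<close>

lemma no_path:
  assumes f: "stuck f" and B: "tame f B" and y: "y1 \<in> W" "y2 \<in> W" "y3 \<in> W" "y1 \<noteq> y2" "y2 \<noteq> y3" "y1 \<noteq> y3"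
    and A: "f {y1, y2} = A" "f {y2, y3} = A" and x: "x \<in> W" "\<not> conn (F f B) x y2"
  shows False
proof -
  have c: "conn (F f B) y1 y2" "conn (F f B) y2 y3"
    using stuck_tame_conn[OF f B y(1,2,4) A(1)] stuck_tame_conn[OF f B y(2,3,5) A(2)] by blast+
  have x1: "\<not> conn (F f B) x y1" and x3: "\<not> conn (F f B) x y3"
    using c x(2) conn_sym conn_trans by metis+
  note cc = crossing_colors[OF f B x(1) y(1) x1] crossing_colors[OF f B x(1) y(2) x(2)]
    crossing_colors[OF f B x(1) y(3) x3]
  have sw: "swappable V f x y1 y2" "swappable V f x y2 y3"
    using no_crossing_gain[OF f B y(1,2,4) A(1) x(1) x1] no_crossing_gain[OF f B y(2,3,5) A(2) x(1,2)] by blast+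
  obtain C E where S: "S = {B, C, E}" using B unfolding tame_def by blast
  have xV: "x \<in> V" "y1 \<in> V" "y2 \<in> V" "y3 \<in> V" using x y by auto
  have "f {x, y1} \<in> {C, E}" "f {x, y2} \<in> {C, E}" "f {x, y3} \<in> {C, E}"
    using edge_color[OF stuck_st[OF f], of x y1] edge_color[OF stuck_st[OF f], of x y2]
      edge_color[OF stuck_st[OF f], of x y3] cc S xV by auto
  then have eq: "f {x, y1} = f {x, y3}" using sw unfolding swappable_def by auto
  have "conn (cls (V - {x}) f (f {x, y1})) y1 y2" "conn (cls (V - {x}) f (f {x, y1})) y2 y3"
    using sw eq unfolding swappable_def by auto
  then have "conn (cls (V - {x}) f (f {x, y1})) y1 y3" by (rule conn_trans)
  moreover have "y1 \<in> tok V x f (f {x, y1})" "y3 \<in> tok V x f (f {x, y1})" using xV cc eq by auto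
  ultimately show False
    using conjunct2[OF valid_star[OF xV(1), THEN iffD1, OF st_valid[OF stuck_st[OF f]]]] y(6) by blast
qed

lemma other_comp:
  assumes "st f" "2 \<le> card (T f B)"
  shows "\<exists>x \<in> W. \<not> conn (F f B) x y"
proof -
  have "\<exists>p \<in> T f B. \<exists>q \<in> T f B. p \<noteq> q"
  proof (rule ccontr)
    assume no: "\<not> ?thesis"
    then have "T f B = {} \<or> (\<exists>p. T f B = {p})" by blast
    then have "card (T f B) \<le> 1" by auto
    then show False using assms(2) by simp
  qed
  then obtain p q where pq: "p \<in> T f B" "q \<in> T f B" "p \<noteq> q" by blast
  then have "\<not> conn (F f B) p q" using token_unique[OF assms(1)] by blast
  then have "\<not> conn (F f B) p y \<or> \<not> conn (F f B) q y" using conn_sym conn_trans by metis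
  moreover have "p \<in> W" "q \<in> W" using pq by auto
  ultimately show ?thesis by blast
qed

lemma spanning_A_crossing:
  assumes f: "stuck f" and B: "tame f B" "2 \<le> card (T f B)"
    and c: "card W < 2 * card (F f A)"
  shows False
proof -
  obtain y1 y2 y3 where y: "{y1, y2} \<in> F f A" "{y2, y3} \<in> F f A" "y1 \<noteq> y3"
    using edges_share_vertex[OF _ cls_edges c] finV by auto
  obtain x where "x \<in> W" "\<not> conn (F f B) x y2" using other_comp[OF stuck_st[OF f] B(2)] by blast
  then show False using no_path[OF f B(1), of y1 y2 y3 x] y by auto
qed

text \<open>A is moved from \<open>{y, z}\<close> to \<open>{w, t}\<close> inside one B-component.
  The triangle is not swappable at w: a B-path from y to z avoiding w, followed by the given B-path
  between z and w, would close a cycle with \<open>{y, w}\<close>. After the move x sees equal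
  colours at both ends of the A-edge \<open>{w, t}\<close>, so \<open>no_crossing_gain\<close>
  applies.\<close>

lemma crossing_shift_impossible:
  assumes f: "stuck f" and B: "tame f B" and yz: "y \<in> W" "z \<in> W" "y \<noteq> z" "f {y, z} = A"
    and x: "x \<in> W" "\<not> conn (F f B) x y"
    and w: "{y, w} \<in> F f B" "conn (F f B - {{y, w}}) w z"
    and t: "t = y \<or> t = z" "f {x, w} = f {x, t}" "\<not> conn (cls V f A - {{y, z}}) w t"
  shows False
proof -
  note stf = stuck_st[OF f]
  note val = st_valid[OF stf]
  have BA: "B \<noteq> A" using B AS unfolding tame_def by auto
  have wW: "w \<in> W" "w \<noteq> y" and fwy: "f {w, y} = B" using w(1) by (auto simp: insert_commute)
  have wz: "w \<noteq> z" using fwy yz(4) BA by (auto simp: insert_commute)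
  have zy: "f {z, y} = A" using yz by (simp add: insert_commute)
  have V: "w \<in> V" "y \<in> V" "z \<in> V" using wW yz by auto
  have cyw: "conn (F f B) y w" using w(1) by (rule conn_edge)
  have cyz: "conn (F f B) y z" using stuck_tame_conn[OF f B yz] .
  have xz: "\<not> conn (F f B) x z" and xw: "\<not> conn (F f B) x w" using x(2) cyw cyz conn_sym conn_trans by metis+
  have fwz: "f {w, z} \<noteq> A"
  proof
    assume "f {w, z} = A"
    then show False using no_path[OF f B wW(1) yz(2,1) wz yz(3)[symmetric] wW(2) _ zy x(1) xz] by blast
  qed
  have nsw: "\<not> swappable V f w y z"
  proof
    assume "swappable V f w y z"
    then have "conn (cls (V - {w}) f B) y z" unfolding swappable_def using fwy by simp
    moreover have "cls (V - {w}) f B \<subseteq> cls V f B - {{y, w}}"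
      using cls_mono[of "V - {w}" V f B] notin_Union_cls[of w V f B] by auto
    ultimately have 1: "conn (cls V f B - {{y, w}}) y z" by (rule conn_mono)
    have "F f B \<subseteq> cls V f B" by (rule cls_mono) auto
    then have "conn (cls V f B - {{y, w}}) w z" by (intro conn_mono[OF w(2)]) auto
    then have c: "conn (cls V f B - {{y, w}}) y w" using 1 by (meson conn_sym conn_trans)
    have "{y, w} \<in> cls V f B" using fwy wW V by (auto simp: insert_commute)
    from forestD[OF validD[OF val] this] c show False by contradiction
  qed
  have fwyA: "f {w, y} \<noteq> A" using fwy BA by simp
  have "\<exists>g. step V f g \<and> g {w, t} = A \<and> (\<forall>e. e \<notin> tri w y z \<longrightarrow> g e = f e)"
    using t(1)
  proof
    assume ty: "t = y"
    show ?thesis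
      using shift_color[OF finV val V wW(2) wz yz(3,4) fwyA fwz nsw] t(3) ty by blast
  next
    assume tz: "t = z"
    have "{z, y} = {y, z}" by auto
    then have nc: "\<not> conn (cls V f A - {{z, y}}) w z" using t(3) tz by simp
    have "\<not> swappable V f w z y" using nsw swappable_commute by metis
    from shift_color[OF finV val V(1,3,2) wz wW(2) yz(3)[symmetric] zy fwz fwyA this nc]
    show ?thesis unfolding tri_commute(2)[of w z y] using tz by blast
  qed
  then obtain g where g: "step V f g" "g {w, t} = A" "\<forall>e. e \<notin> tri w y z \<longrightarrow> g e = f e" by blast
  have sg: "stuck g" "tame g B"
    using stuck_tri[OF f g(1,3)] wW yz B tame_cong[of g f] by auto
  have tW: "t \<in> W" "w \<noteq> t" using t(1) yz wW wz by auto
  have xne: "x \<noteq> w" "x \<noteq> y" "x \<noteq> z" using x xz xw by auto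
  have "{x, s} \<notin> tri w y z" for s using xne by (auto simp: tri_def doubleton_eq_iff)
  then have gx: "g {x, s} = f {x, s}" for s using g(3) by simp
  have into: "conn (F f B) a b" if "conn (F g B) a b" for a b
  proof (rule conn_into[OF that])
    fix a b assume ab: "{a, b} \<in> F g B"
    show "conn (F f B) a b"
    proof (cases "{a, b} \<in> tri w y z")
      case True
      then have "a \<in> {w, y, z}" "b \<in> {w, y, z}" by (auto simp: tri_def doubleton_eq_iff)
      then have "conn (F f B) y a" "conn (F f B) y b" using cyw cyz by auto
      then show ?thesis using conn_sym conn_trans by metis
    next
      case False
      then have "g {a, b} = f {a, b}" using g(3) by blast
      then have "{a, b} \<in> F f B" using ab by simp
      then show ?thesis by (rule conn_edge)
    qed
  qed
  have "\<not> conn (F g B) x w" using into xw by blast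
  moreover have "\<not> swappable V g x w t" unfolding swappable_def gx using t(2) by simp
  ultimately show False using no_crossing_gain[OF sg wW(1) tW(1,2) g(2) x(1)] by blast
qed

text \<open>The edges from x to y, z and w only use C and E, and those to y and z differ by
  \<open>no_crossing_gain\<close>. So \<open>{x, w}\<close> repeats one of these two colours, which
  determines t.\<close>

lemma crossing_shift_exists:
  assumes f: "stuck f" and B: "tame f B" "2 \<le> card (T f B)" and yz: "{y, z} \<in> F f A"
  obtains x w t where "x \<in> W" "\<not> conn (F f B) x y" "{y, w} \<in> F f B" "conn (F f B - {{y, w}}) w z"
    "t = y \<or> t = z" "f {x, w} = f {x, t}" "w \<noteq> y" "w \<noteq> z"
proof -
  have BA: "B \<noteq> A" using B AS unfolding tame_def by auto
  have y: "y \<in> W" "z \<in> W" "y \<noteq> z" "f {y, z} = A" using yz by auto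
  obtain x where x: "x \<in> W" "\<not> conn (F f B) x y" using other_comp[OF stuck_st[OF f] B(2)] by blast
  have cyz: "conn (F f B) y z" using stuck_tame_conn[OF f B(1) y] .
  obtain w where w: "{y, w} \<in> F f B" "conn (F f B - {{y, w}}) w z" using conn_first_edge[OF cyz y(3)] by blast
  have wW: "w \<in> W" "w \<noteq> y" "f {y, w} = B" using w by auto
  have wz: "w \<noteq> z" using wW y(4) BA by auto
  have cyw: "conn (F f B) y w" using w(1) by (rule conn_edge)
  have xz: "\<not> conn (F f B) x z" and xw: "\<not> conn (F f B) x w" using x(2) cyw cyz conn_sym conn_trans by metis+
  obtain C E where S: "S = {B, C, E}" using B unfolding tame_def by blast
  note cc = crossing_colors[OF f B(1) x(1) y(1) x(2)] crossing_colors[OF f B(1) x(1) y(2) xz]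
    crossing_colors[OF f B(1) x(1) wW(1) xw]
  have "f {x, y} \<in> {C, E}" "f {x, z} \<in> {C, E}" "f {x, w} \<in> {C, E}"
    using edge_color[OF stuck_st[OF f], of x y] edge_color[OF stuck_st[OF f], of x z]
      edge_color[OF stuck_st[OF f], of x w] cc S x y wW by auto
  moreover have "f {x, y} \<noteq> f {x, z}"
    using no_crossing_gain[OF f B(1) y x] unfolding swappable_def by blast
  ultimately consider "f {x, w} = f {x, y}" | "f {x, w} = f {x, z}" by auto
  then show ?thesis using that[OF x w _ _ wW(2) wz] by cases blast+
qed

text \<open>A single A-edge at v creates no A-connection between other vertices. If A joined w to t,
  it would do so off v, and two consecutive A-edges starting at w would lie inside the B-component,
  against \<open>no_path\<close>. So the separation condition of
  \<open>crossing_shift_impossible\<close> holds.\<close>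

lemma crossing_one_A_token:
  assumes f: "stuck f" and B: "tame f B" "2 \<le> card (T f B)" and yz: "{y, z} \<in> F f A" and T: "T f A = {p}"
  shows False
proof -
  obtain x w t where x: "x \<in> W" "\<not> conn (F f B) x y" and w: "{y, w} \<in> F f B" "conn (F f B - {{y, w}}) w z"
    and t: "t = y \<or> t = z" "f {x, w} = f {x, t}" and ne: "w \<noteq> y" "w \<noteq> z"
    using crossing_shift_exists[OF f B yz] by blast
  have y: "y \<in> W" "z \<in> W" "y \<noteq> z" "f {y, z} = A" using yz by auto
  have wW: "w \<in> W" using w by auto
  define t' where "t' = (if t = y then z else y)"
  have tt: "t \<in> W" "t' \<in> W" "t \<noteq> t'" "f {t, t'} = A" "w \<noteq> t" "w \<noteq> t'"
    using t(1) y ne by (auto simp: t'_def insert_commute)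
  have cyz: "conn (F f B) y z" using stuck_tame_conn[OF f B(1) y] .
  have cyw: "conn (F f B) y w" using w(1) by (rule conn_edge)
  have xt: "\<not> conn (F f B) x t" and xw: "\<not> conn (F f B) x w"
    using x(2) cyw cyz t(1) conn_sym conn_trans by metis+
  show False
  proof (rule crossing_shift_impossible[OF f B(1) y x w t], rule notI)
    assume "conn (cls V f A - {{y, z}}) w t"
    then have "conn (cls V f A) w t" by (rule conn_mono) auto
    then have "conn (F f A) w t"
      using conn_cls_star[OF vV, of f A w t] wW T conn_trans[of "F f A" w p t] tt by auto
    then obtain u where u: "{w, u} \<in> F f A" "conn (F f A - {{w, u}}) u t"
      using conn_first_edge tt(5) by metis
    then have uW: "u \<in> W" "u \<noteq> w" "f {w, u} = A" by auto
    show False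
    proof (cases "u = t")
      case True
      then show False
        using no_path[OF f B(1) wW tt(1,2) tt(5) tt(3) tt(6) _ tt(4) x(1) xt] uW by blast
    next
      case False
      then obtain s where "{u, s} \<in> F f A - {{w, u}}" using conn_first_edge[OF u(2)] by blast
      then have s: "s \<in> W" "u \<noteq> s" "f {u, s} = A" "w \<noteq> s" by (auto simp: insert_commute)
      have "conn (F f B) w u" using stuck_tame_conn[OF f B(1) wW uW(1) uW(2)[symmetric] uW(3)] .
      then have "\<not> conn (F f B) x u" using xw conn_sym conn_trans by metis
      then show False
        using no_path[OF f B(1) wW uW(1) s(1) uW(2)[symmetric] s(2) s(4) uW(3) s(3) x(1)] by blast
    qed
  qed
qed

text \<open>Without \<open>{y, z}\<close> all A-edges are at v, so A can join w to t only if these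
  two are exactly the bearers of the A-tokens. Exchanging the token of t with the only E-token then
  destroys this connection.\<close>

lemma crossing_two_A_tokens:
  assumes f: "stuck f" and B: "tame f B" "2 \<le> card (T f B)" and yz: "F f A = {{y, z}}" and T: "card (T f A) = 2"
  shows False
proof -
  have yz': "{y, z} \<in> F f A" using yz by simp
  obtain x w t where x: "x \<in> W" "\<not> conn (F f B) x y" and w: "{y, w} \<in> F f B" "conn (F f B - {{y, w}}) w z"
    and t: "t = y \<or> t = z" "f {x, w} = f {x, t}" and ne: "w \<noteq> y" "w \<noteq> z"
    using crossing_shift_exists[OF f B yz'] by blast
  have y: "y \<in> W" "z \<in> W" "y \<noteq> z" "f {y, z} = A" using yz' by auto
  have wW: "w \<in> W" using w by auto
  have tW: "t \<in> W" "w \<noteq> t" using t y ne by auto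
  have star: "w \<in> T g A \<and> t \<in> T g A" if g: "F g A = {{y, z}}" and c: "conn (cls V g A - {{y, z}}) w t" for g
  proof -
    have "y \<noteq> v" "z \<noteq> v" using y(1,2) by simp_all
    then have vn: "v \<notin> {y, z}" by simp
    have "v \<in> e" if "e \<in> (\<lambda>t. {v, t}) ` T g A" for e using that by auto
    with vn have "{y, z} \<notin> (\<lambda>t. {v, t}) ` T g A" by metis
    moreover have "cls V g A = {{y, z}} \<union> (\<lambda>t. {v, t}) ` T g A"
      using cls_star[OF vV, of g A] g by simp
    ultimately have "cls V g A - {{y, z}} = {} \<union> (\<lambda>t. {v, t}) ` T g A" by simp
    then have *: "conn ({} \<union> (\<lambda>t. {v, t}) ` T g A) w t" using c by simp
    have triv: "conn {} a b \<Longrightarrow> a = b" for a b :: 'a by (induction rule: conn_induct) auto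
    have "t \<noteq> v \<and> conn {} w t \<or> (\<exists>p\<in>T g A. conn {} w p \<and> (t = v \<or> (\<exists>q\<in>T g A. conn {} q t)))"
      by (rule conn_star[OF *]) (use wW in auto)
    then show ?thesis using triv tW by blast
  qed
  show False
  proof (cases "conn (cls V f A - {{y, z}}) w t")
    case False
    then show False using crossing_shift_impossible[OF f B(1) y x w t] by blast
  next
    case True
    then have wt: "w \<in> T f A" "t \<in> T f A" using star[OF yz] by auto
    have "{w, t} \<subseteq> T f A" using wt by blast
    moreover have "card {w, t} = card (T f A)" using T tW by simp
    ultimately have TA: "{w, t} = T f A" using finV by (intro card_subset_eq) auto
    obtain C E where S: "S = {B, C, E}" and cE: "card (T f E) = 1" using B unfolding tame_def by blast
    have EA: "E \<noteq> A" using S AS by auto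
    obtain e where e: "T f E = {e}" by (rule card_1_singletonE[OF cE])
    then have "e \<in> T f E" by simp
    then have eW: "e \<in> W" "f {v, e} = E" by simp_all
    have ft: "f {v, t} = A" "f {v, w} = A" using wt by auto
    have ne2: "t \<noteq> e" "w \<noteq> e" using ft eW EA by auto
    let ?g = "swap_tok v t e f"
    have ce: "conn (F f E) e t" using conn_single_token[OF stuck_st[OF f] _ e tW(1)] S by simp
    \<comment> \<open>Either e is the other end of the only A-edge off v, or e is isolated in A
      there and, carrying E, has no A-token in its component.\<close>
    have cA: "conn (F f A) t e \<or> (\<forall>p \<in> T f A. \<not> conn (F f A) p e)"
    proof (cases "e = y \<or> e = z")
      case True
      then have "{t, e} = {y, z}" using t(1) ne2 by auto
      then have "{t, e} \<in> F f A" using yz' by simp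
      then show ?thesis using conn_edge by metis
    next
      case False
      have "\<not> conn (F f A) p e" if "p \<in> T f A" for p
      proof
        assume "conn (F f A) p e"
        then have c: "conn (F f A) e p" by (rule conn_sym)
        have "e \<noteq> p" using that TA ne2 by auto
        then obtain s where "{e, s} \<in> F f A" using conn_first_edge[OF c] by blast
        then have "{e, s} = {y, z}" using yz by simp
        then show False using False by (auto simp: doubleton_eq_iff)
      qed
      then show ?thesis by metis
    qed
    have g: "stuck ?g" "card (T ?g c) = card (T f c)" for c
      using swap_stuck[OF f tW(1) eW(1) ne2(1)] ft eW EA cA conn_sym[OF ce] by auto
    have gt: "?g {v, t} = E" using swap_tok_simps(1)[of v t e f] tW eW ne2 by auto
    have gW: "?g {a, b} = f {a, b}" if "a \<in> W" "b \<in> W" "a \<noteq> b" for a b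
      by (rule swap_tok_edges) (use that in auto)
    have tg: "tame ?g B" using tame_cong[of ?g f] g(2) B(1) by simp
    have h1: "\<not> conn (cls V ?g A - {{y, z}}) w t"
    proof
      assume "conn (cls V ?g A - {{y, z}}) w t"
      then have "t \<in> T ?g A" using star[of ?g] F_swap[of t e f A] yz by simp
      then show False using gt EA by simp
    qed
    have "conn (F f B) w y" "conn (F f B) t y"
      using conn_sym[OF conn_edge[OF w(1)]] conn_sym[OF stuck_tame_conn[OF f B(1) y]] t(1) by auto
    then have "x \<noteq> w" "x \<noteq> t" using x(2) by metis+
    then have h2: "?g {x, w} = ?g {x, t}" using gW[OF x(1) wW] gW[OF x(1) tW(1)] t(2) by simp
    have h3: "?g {y, z} = A" using gW[OF y(1-3)] y(4) by simp
    have "\<not> conn (F ?g B) x y" "{y, w} \<in> F ?g B" "conn (F ?g B - {{y, w}}) w z"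
      using x(2) w by (simp_all only: F_swap not_False_eq_True)
    from crossing_shift_impossible[OF g(1) tg y(1-3) h3 x(1) this t(1) h2 h1] show False .
  qed
qed

end

section \<open>Stuck colourings without an A-edge at v\<close>

lemma conn_closed:
  assumes "conn E x y" "x \<in> K" "\<And>u w. {u, w} \<in> E \<Longrightarrow> u \<in> K \<Longrightarrow> w \<in> K"
  shows "y \<in> K"
  using assms(1) by (induction rule: conn_induct) (use assms in auto)

lemma edges_disjoint:
  assumes np: "\<forall>a b c. {a, b} \<in> E \<longrightarrow> {b, c} \<in> E \<longrightarrow> a = c"
    and "E \<subseteq> edges U" "e \<in> E" "d \<in> E" "e \<noteq> d"
  shows "e \<inter> d = {}"
proof (rule ccontr)
  assume "e \<inter> d \<noteq> {}"
  then obtain b where b: "b \<in> e" "b \<in> d" by blast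
  have ed: "e \<in> edges U" "d \<in> edges U" using assms by blast+
  obtain a where a: "e = {a, b}" using edgesE[OF ed(1)] b(1) by (metis insert_commute insertE singletonD)
  obtain c where c: "d = {b, c}" using edgesE[OF ed(2)] b(2) by (metis insert_commute insertE singletonD)
  have "a = c" using np assms(3,4) a c by metis
  then show False using a c assms(5) by (simp add: insert_commute)
qed

lemma edges_subset: "e \<in> edges U \<Longrightarrow> e \<subseteq> U"
  by (auto elim: edgesE)

context peel
begin

lemma token_S: "st f \<Longrightarrow> T f A = {} \<Longrightarrow> u \<in> W \<Longrightarrow> f {v, u} \<in> S"
  using token_color[of f u] by (auto simp: tok_def)

lemma comp_token_inj:
  assumes "stuck f" "y \<in> W" "K \<subseteq> {u. conn (F f A) y u}"
  shows "inj_on (\<lambda>u. f {v, u}) K"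
proof (rule inj_onI)
  fix a b assume ab: "a \<in> K" "b \<in> K" "f {v, a} = f {v, b}"
  have c: "conn (F f A) y a" "conn (F f A) y b" using ab assms(3) by auto
  have "a \<in> W" "b \<in> W" using F_in[OF c(1) assms(2)] F_in[OF c(2) assms(2)] .
  moreover have "conn (F f A) a b" using c by (meson conn_sym conn_trans)
  ultimately show "a = b" using stuck_token_inj[OF assms(1)] ab(3) by blast
qed

lemma no_A_token_path:
  assumes f: "stuck f" and T: "T f A = {}" and y: "{y1, y2} \<in> F f A" "{y2, y3} \<in> F f A" "y1 \<noteq> y3"
  shows "3 \<le> card S"
proof -
  have "y1 \<noteq> y2" "y2 \<noteq> y3" "y2 \<in> W" using y by auto
  then have "card {y1, y2, y3} = 3" using y(3) by simp
  moreover have "conn (F f A) y2 y1" "conn (F f A) y2 y3" using conn_edge y conn_sym by metis+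
  then have "{y1, y2, y3} \<subseteq> {u. conn (F f A) y2 u}" by simp
  ultimately show ?thesis using comp_card(2)[OF f \<open>y2 \<in> W\<close> _ T] by metis
qed

text \<open>The component of p in its token colour contains p' by \<open>stuck_conn\<close> and
  misses q and q' by \<open>comp_disjoint\<close>, so it coincides with the A-component of
  p.\<close>

lemma no_A_token_two_aux:
  assumes f: "stuck f" and W: "W = {p, p', q, q'}" and ne: "p \<noteq> p'" "p \<noteq> q"
    and K: "{u. conn (F f A) p u} = {p, p'}" and cq: "conn (F f A) q q'"
    and c: "f {v, p} = f {v, q}" "f {v, p} \<noteq> A"
  shows False
proof (rule same_comp[OF K _ c(2)])
  have pq: "p \<in> W" "q \<in> W" using W by auto
  show "{u. conn (F f (f {v, p})) p u} = {p, p'}"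
  proof (intro equalityI subsetI)
    fix u assume "u \<in> {u. conn (F f (f {v, p})) p u}"
    then have u: "conn (F f (f {v, p})) p u" by simp
    have uW: "u \<in> W" by (rule F_in[OF u pq(1)])
    have "\<not> conn (F f A) q u"
      using comp_disjoint[OF f pq(2,1) ne(2)[symmetric] c(1)[symmetric] refl] u by blast
    then have "u \<noteq> q" "u \<noteq> q'" using cq by auto
    then show "u \<in> {p, p'}" using uW W by blast
  next
    fix u assume "u \<in> {p, p'}"
    then have "conn (F f A) p u" using K by blast
    then show "u \<in> {u. conn (F f (f {v, p})) p u}" using stuck_conn[OF f pq(1), of u] by simp
  qed
  show "card {p, p'} = 2 \<or> card {p, p'} = 3" using ne by simp
qed

text \<open>Two adjacent A-edges would need three token colours, so the A-edges form a perfect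
  matching of the four vertices. The ends of one edge show both token colours, and a token on the
  other edge repeats one of them.\<close>

lemma no_A_token_two:
  assumes f: "stuck f" and T: "T f A = {}" and S: "card S = 2" and W: "card W = 4" and c: "card (F f A) = 2"
  shows False
proof -
  have np: "\<forall>a b c. {a, b} \<in> F f A \<longrightarrow> {b, c} \<in> F f A \<longrightarrow> a = c"
  proof (intro allI impI, rule ccontr)
    fix a b c assume "{a, b} \<in> F f A" "{b, c} \<in> F f A" "a \<noteq> c"
    from no_A_token_path[OF f T this] S show False by simp
  qed
  obtain e1 e2 where FA: "F f A = {e1, e2}" "e1 \<noteq> e2" using c by (auto simp: card_2_iff)
  have "e1 \<in> edges W" "e2 \<in> edges W" using FA(1) cls_edges[of W f A] by blast+
  then obtain p p' q q' where e: "e1 = {p, p'}" "e2 = {q, q'}" "p \<noteq> p'" "q \<noteq> q'"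
    "p \<in> W" "p' \<in> W" "q \<in> W" "q' \<in> W" by (metis edgesE)
  have mem: "{p, p'} \<in> F f A" "{p', p} \<in> F f A" "{q, q'} \<in> F f A" "{q', q} \<in> F f A"
    using FA e by (auto simp: insert_commute)
  have d: "p \<noteq> q" "p \<noteq> q'" "p' \<noteq> q" "p' \<noteq> q'"
  proof -
    have "e1 \<inter> e2 = {}" by (rule edges_disjoint[OF np cls_edges]) (simp_all add: FA)
    then show "p \<noteq> q" "p \<noteq> q'" "p' \<noteq> q" "p' \<noteq> q'" unfolding e(1,2) by auto
  qed
  have "card {p, p', q, q'} = 4" using d e(3,4) by simp
  then have WW: "W = {p, p', q, q'}" using W e finV by (intro card_subset_eq[symmetric]) auto
  have cp: "conn (F f A) p p'" "conn (F f A) q q'" "conn (F f A) p' p" using mem by (auto intro: conn_edge)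
  have K: "{u. conn (F f A) p u} = {p, p'}"
  proof (intro equalityI subsetI)
    fix u assume "u \<in> {u. conn (F f A) p u}"
    then have "conn (F f A) p u" by simp
    then show "u \<in> {p, p'}"
      by (rule conn_closed) (use FA e d in \<open>auto simp: doubleton_eq_iff\<close>)
  qed (use cp in auto)
  have K': "{u. conn (F f A) p' u} = {p', p}"
  proof -
    have "conn (F f A) p' u \<longleftrightarrow> conn (F f A) p u" for u using cp(1,3) by (meson conn_trans)
    then show ?thesis using K by (simp add: insert_commute)
  qed
  note stf = stuck_st[OF f]
  have tS: "f {v, p} \<in> S" "f {v, p'} \<in> S" "f {v, q} \<in> S" using token_S[OF stf T] e by blast+
  have "f {v, p} \<noteq> f {v, p'}" using stuck_token_inj[OF f e(5,6) cp(1)] e(3) by blast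
  then have "card {f {v, p}, f {v, p'}} = card S" using S by simp
  then have "{f {v, p}, f {v, p'}} = S" using tS finS by (intro card_subset_eq) auto
  then have "f {v, q} \<in> {f {v, p}, f {v, p'}}" using tS(3) by simp
  then consider "f {v, p} = f {v, q}" | "f {v, p'} = f {v, q}" by (metis insertE singletonD)
  then show False
  proof cases
    case 1
    show ?thesis by (rule no_A_token_two_aux[OF f WW e(3) d(1) K cp(2) 1]) (use tS AS in auto)
  next
    case 2
    have WW': "W = {p', p, q, q'}" using WW by auto
    show ?thesis by (rule no_A_token_two_aux[OF f WW' e(3)[symmetric] d(3) K' cp(2) 2]) (use tS AS in auto)
  qed
qed

text \<open>The c-components of a and b contain K1 and K2 respectively and are disjoint. By
  \<open>same_comp\<close> each has a further vertex, which must be one of the two in K3. So the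
  component of b is K2 plus one vertex t, and since the edge inside K2 has colour A, both vertices
  of K2 need a c-edge to t.\<close>

lemma matching_common_neighbour:
  assumes f: "stuck f" and c: "c \<noteq> A"
    and A1: "\<And>a. a \<in> K1 \<Longrightarrow> {u. conn (F f A) a u} = K1" and A2: "\<And>a. a \<in> K2 \<Longrightarrow> {u. conn (F f A) a u} = K2"
    and card: "card K1 = 2" "card K2 = 2" "card K3 = 2"
    and disj: "K1 \<inter> K2 = {}" "K2 \<inter> K3 = {}" and W: "W = K1 \<union> K2 \<union> K3"
    and ab: "a \<in> K1" "b \<in> K2" "f {v, a} = c" "f {v, b} = c"
  shows "\<exists>t \<in> K3. \<forall>q \<in> K2. f {q, t} = c"
proof -
  have abW: "a \<in> W" "b \<in> W" "a \<noteq> b" using ab disj W by auto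
  have KA: "u \<in> K1 \<Longrightarrow> conn (F f A) a u" "u \<in> K2 \<Longrightarrow> conn (F f A) b u" for u
    using A1[OF ab(1)] A2[OF ab(2)] by blast+
  have sub: "conn (F f c) a u" if "u \<in> K1" for u
    using stuck_conn[OF f abW(1) KA(1)[OF that]] ab(3) by simp
  have sub2: "conn (F f c) b u" if "u \<in> K2" for u
    using stuck_conn[OF f abW(2) KA(2)[OF that]] ab(4) by simp
  have n1: "\<not> conn (F f c) b u" if "u \<in> K1" for u
    by (rule comp_disjoint[OF f abW ab(3,4) KA(1)[OF that]])
  have n2: "\<not> conn (F f c) a u" if "u \<in> K2" for u
    by (rule comp_disjoint[OF f abW(2,1) abW(3)[symmetric] ab(4,3) KA(2)[OF that]])
  have "\<exists>t. conn (F f c) a t \<and> t \<notin> K1"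
  proof (rule ccontr)
    assume "\<not> ?thesis"
    then have "{u. conn (F f c) a u} = K1" using sub by blast
    then show False using same_comp[OF A1[OF ab(1)] _ c] card by blast
  qed
  then obtain t1 where t1: "conn (F f c) a t1" "t1 \<notin> K1" by blast
  have "\<exists>t. conn (F f c) b t \<and> t \<notin> K2"
  proof (rule ccontr)
    assume "\<not> ?thesis"
    then have "{u. conn (F f c) b u} = K2" using sub2 by blast
    then show False using same_comp[OF A2[OF ab(2)] _ c] card by blast
  qed
  then obtain t2 where t2: "conn (F f c) b t2" "t2 \<notin> K2" by blast
  have t13: "t1 \<in> K3" using F_in[OF t1(1) abW(1)] t1 n2 W by blast
  have t23: "t2 \<in> K3" using F_in[OF t2(1) abW(2)] t2 n1 W by blast
  have ncab: "\<not> conn (F f c) b t1"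
  proof
    assume "conn (F f c) b t1"
    then have "conn (F f c) a b" using t1(1) by (meson conn_sym conn_trans)
    then show False using n2[OF ab(2)] by blast
  qed
  then have "t1 \<noteq> t2" using t2 by blast
  then have K3: "K3 = {t1, t2}" using card(3) t13 t23 by (auto simp: card_2_iff)
  have "f {q, t2} = c" if q: "q \<in> K2" for q
  proof -
    have "q \<noteq> t2" using q t2 by blast
    then obtain t where t: "conn (F f c) b t" "t \<noteq> q" "f {q, t} = c" using F_nbr[OF sub2[OF q] t2(1)] by blast
    have tW: "t \<in> W" by (rule F_in[OF t(1) abW(2)])
    have "t \<notin> K2"
    proof
      assume tK: "t \<in> K2"
      then have "conn (F f A) q t" using A2[OF q] by blast
      then obtain s where s: "conn (F f A) q s" "s \<noteq> q" "f {q, s} = A" using F_nbr[of f A q q t] t(2) by auto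
      then have "s \<in> K2" using A2[OF q] by blast
      then have "s = t" using card(2) tK q s(2) t(2) by (auto simp: card_2_iff)
      then show False using s t c by simp
    qed
    moreover have "t \<notin> K1" using n1 t by blast
    ultimately have "t \<in> K3" using tW W by blast
    then show ?thesis using K3 t ncab by auto
  qed
  then show ?thesis using t23 by blast
qed

lemma card_two_meet:
  assumes "finite U" "card U = 3" "P \<subseteq> U" "Q \<subseteq> U" "card P = 2" "card Q = 2"
  shows "\<exists>b. b \<in> P \<and> b \<in> Q"
proof (rule ccontr)
  assume "\<not> ?thesis"
  then have "P \<inter> Q = {}" by blast
  then have "card (P \<union> Q) = 4"
    using card_Un_disjoint[of P Q] finite_subset[OF assms(3,1)] finite_subset[OF assms(4,1)] assms(5,6) by simp
  moreover have "card (P \<union> Q) \<le> card U" by (rule card_mono) (use assms in auto)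
  ultimately show False using assms by simp
qed

text \<open>Each pair shows two of three token colours, so any two pairs share one.
  \<open>matching_common_neighbour\<close> for K1, K2 and for K1, K3 produces an edge between K2 and
  K3 that has both shared colours, so these are equal. The bearers of this colour in K2 and K3 then
  contradict \<open>comp_disjoint\<close>.\<close>

lemma no_A_token_three_matching:
  assumes f: "stuck f" and T: "T f A = {}" and S: "card S = 3"
    and A1: "\<And>a. a \<in> K1 \<Longrightarrow> {u. conn (F f A) a u} = K1" and A2: "\<And>a. a \<in> K2 \<Longrightarrow> {u. conn (F f A) a u} = K2"
    and A3: "\<And>a. a \<in> K3 \<Longrightarrow> {u. conn (F f A) a u} = K3"
    and card: "card K1 = 2" "card K2 = 2" "card K3 = 2"
    and disj: "K1 \<inter> K2 = {}" "K2 \<inter> K3 = {}" "K1 \<inter> K3 = {}" and W: "W = K1 \<union> K2 \<union> K3"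
  shows False
proof -
  define \<tau> where "\<tau> u = f {v, u}" for u
  have P: "\<tau> ` K \<subseteq> S \<and> card (\<tau> ` K) = 2"
    if KK: "K \<subseteq> W" "card K = 2" "\<And>a. a \<in> K \<Longrightarrow> {u. conn (F f A) a u} = K" for K
  proof
    show "\<tau> ` K \<subseteq> S"
    proof (rule image_subsetI)
      fix u assume "u \<in> K"
      then have "u \<in> W" using KK(1) by (rule set_mp[rotated])
      then show "\<tau> u \<in> S" unfolding \<tau>_def by (rule token_S[OF stuck_st[OF f] T])
    qed
    have "K \<noteq> {}" using KK(2) by auto
    then obtain a where a: "a \<in> K" by blast
    have aW: "a \<in> W" using a KK(1) by (rule set_mp[rotated])
    have "inj_on \<tau> K" unfolding \<tau>_def
      by (rule comp_token_inj[OF f aW]) (simp add: KK(3)[OF a])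
    then show "card (\<tau> ` K) = 2" using KK(2) by (simp add: card_image)
  qed
  have sub: "K1 \<subseteq> W" "K2 \<subseteq> W" "K3 \<subseteq> W" unfolding W by auto
  note P1 = conjunct1[OF P[OF sub(1) card(1) A1]] conjunct2[OF P[OF sub(1) card(1) A1]]
  note P2 = conjunct1[OF P[OF sub(2) card(2) A2]] conjunct2[OF P[OF sub(2) card(2) A2]]
  note P3 = conjunct1[OF P[OF sub(3) card(3) A3]] conjunct2[OF P[OF sub(3) card(3) A3]]
  obtain b where b: "b \<in> \<tau> ` K1" "b \<in> \<tau> ` K2" using card_two_meet[OF finS S P1(1) P2(1) P1(2) P2(2)] by blast
  obtain c where c: "c \<in> \<tau> ` K1" "c \<in> \<tau> ` K3" using card_two_meet[OF finS S P1(1) P3(1) P1(2) P3(2)] by blast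
  obtain a1 a2 where a: "a1 \<in> K1" "a2 \<in> K2" "f {v, a1} = b" "f {v, a2} = b"
    using b \<tau>_def by (metis imageE)
  obtain d1 d3 where d: "d1 \<in> K1" "d3 \<in> K3" "f {v, d1} = c" "f {v, d3} = c"
    using c \<tau>_def by (metis imageE)
  have bA: "b \<noteq> A" "c \<noteq> A" using b c P1 AS by auto
  have W': "W = K1 \<union> K3 \<union> K2" "K3 \<inter> K2 = {}" using W disj by auto
  obtain t where t: "t \<in> K3" "\<forall>q \<in> K2. f {q, t} = b"
    using matching_common_neighbour[OF f bA(1) A1 A2 card disj(1,2) W a] by blast
  obtain q where q: "q \<in> K2" "\<forall>t \<in> K3. f {t, q} = c"
    using matching_common_neighbour[OF f bA(2) A1 A3 card(1,3,2) disj(3) W'(2,1) d] by blast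
  have "b = c" using t q by (metis insert_commute)
  have ad: "a2 \<in> W" "d3 \<in> W" "a2 \<noteq> d3" "t \<in> W" "a2 \<noteq> t" using a d W disj t by auto
  have "{a2, t} \<in> F f b" using t a ad by auto
  then have "conn (F f b) a2 t" by (rule conn_edge)
  moreover have "conn (F f A) d3 t" using A3[OF d(2)] t by blast
  ultimately show False
    using comp_disjoint[OF f ad(2,1) ad(3)[symmetric]] a d \<open>b = c\<close> by blast
qed

text \<open>The A-component K of the path has exactly three vertices and shows all token colours.
  The third A-edge lies outside K, and one vertex s is left over. The token colour of u1 recurs on
  K, so this colour has two different components, one containing K and one containing that edge. As
  s lies in at most one of them, the other equals an A-component, against
  \<open>same_comp\<close>.\<close>

lemma no_A_token_three_path:
  assumes f: "stuck f" and T: "T f A = {}" and S: "card S = 3" and W: "card W = 6" and c: "card (F f A) = 3"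
    and y: "{y1, y2} \<in> F f A" "{y2, y3} \<in> F f A" "y1 \<noteq> y3"
  shows False
proof -
  note stf = stuck_st[OF f]
  define K where "K = {y1, y2, y3}"
  have yW: "y1 \<in> W" "y2 \<in> W" "y3 \<in> W" "y1 \<noteq> y2" "y2 \<noteq> y3" using y by auto
  have cK: "card K = 3" using yW y(3) by (simp add: K_def)
  have "conn (F f A) y2 y1" "conn (F f A) y2 y3" using conn_edge y conn_sym by metis+
  then have Ksub: "K \<subseteq> {u. conn (F f A) y2 u}" by (simp add: K_def)
  have fin: "finite {u. conn (F f A) y2 u}" using finite_subset[OF comp_sub[OF yW(2)]] finV by simp
  have K2: "K = {u. conn (F f A) y2 u}"
    using card_seteq[OF fin Ksub] comp_card(2)[OF f yW(2) order_refl T] S cK by simp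
  have comp: "{u. conn (F f A) y u} = K" if "y \<in> K" for y
  proof -
    have "conn (F f A) y2 y" using that K2 by simp
    then have "conn (F f A) y u \<longleftrightarrow> conn (F f A) y2 u" for u by (meson conn_sym conn_trans)
    then show ?thesis using K2 by simp
  qed
  have e12: "{y1, y2} \<noteq> {y2, y3}" using y(3) by (auto simp: doubleton_eq_iff)
  have finF: "finite (F f A)" using finV by simp
  have "\<exists>e3 \<in> F f A. e3 \<noteq> {y1, y2} \<and> e3 \<noteq> {y2, y3}"
  proof (rule ccontr)
    assume "\<not> ?thesis"
    then have "F f A \<subseteq> {{y1, y2}, {y2, y3}}" by blast
    then have "card (F f A) \<le> card {{y1, y2}, {y2, y3}}" by (rule card_mono[rotated]) simp
    then show False using c e12 by simp
  qed
  then obtain e3 where e3: "e3 \<in> F f A" "e3 \<noteq> {y1, y2}" "e3 \<noteq> {y2, y3}" by blast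
  have "{{y1, y2}, {y2, y3}, e3} = F f A"
    by (rule card_subset_eq[OF finF]) (use e3 y e12 c in auto)
  note FA = this[symmetric]
  have "e3 \<in> edges W" by (rule set_mp[OF cls_edges e3(1)])
  then obtain u1 u2 where u: "e3 = {u1, u2}" "u1 \<in> W" "u2 \<in> W" "u1 \<noteq> u2" by (rule edgesE)
  have c12: "conn (F f A) u1 u2" "conn (F f A) u2 u1" using e3 u by (auto intro: conn_edge simp: insert_commute)
  \<comment> \<open>The third edge would be \<open>{y1, y3}\<close> and close a triangle of colour
    A.\<close>
  have notboth: "\<not> (u1 \<in> K \<and> u2 \<in> K)"
  proof
    assume "u1 \<in> K \<and> u2 \<in> K"
    then have e: "e3 = {y1, y3}" using u e3 unfolding K_def by (auto simp: insert_commute)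
    have m: "{y1, y2} \<in> F f A - {{y1, y3}}" "{y2, y3} \<in> F f A - {{y1, y3}}" using y yW by (auto simp: doubleton_eq_iff)
    have "conn (F f A - {{y1, y3}}) y1 y3" using conn_trans[OF conn_edge[OF m(1)] conn_edge[OF m(2)]] .
    moreover have "{y1, y3} \<in> F f A" using e e3 by simp
    moreover have "forest (F f A)"
      by (rule validD[OF conjunct1[OF valid_star[OF vV, THEN iffD1, OF st_valid[OF stf]]]])
    ultimately show False using forestD[of "F f A" y1 y3] by simp
  qed
  have uK: "u1 \<notin> K" "u2 \<notin> K"
  proof -
    have "u1 \<in> K \<Longrightarrow> u2 \<in> K" "u2 \<in> K \<Longrightarrow> u1 \<in> K"
      using comp[of u1] comp[of u2] c12 by auto
    then show "u1 \<notin> K" "u2 \<notin> K" using notboth by auto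
  qed
  have "card (K \<union> {u1, u2}) = 5" using cK uK u(4) by (simp add: K_def)
  then have "K \<union> {u1, u2} \<noteq> W" using W by (intro notI) simp
  moreover have KuW: "K \<union> {u1, u2} \<subseteq> W" using yW u(2,3) by (simp add: K_def)
  ultimately obtain s where "s \<in> W" "s \<notin> K \<union> {u1, u2}" by (meson subsetI subset_antisym)
  then have s: "s \<in> W" "s \<notin> K" "s \<noteq> u1" "s \<noteq> u2" by simp_all
  have "insert s (K \<union> {u1, u2}) = W"
  proof (rule card_subset_eq)
    show "card (insert s (K \<union> {u1, u2})) = card W"
      using s \<open>card (K \<union> {u1, u2}) = 5\<close> W by (simp add: K_def)
    show "insert s (K \<union> {u1, u2}) \<subseteq> W" using KuW s(1) by simp
  qed (use finV in simp)
  note WW = this[symmetric]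
  have A2: "{u. conn (F f A) u1 u} = {u1, u2}"
  proof (intro equalityI subsetI)
    fix w assume "w \<in> {u. conn (F f A) u1 u}"
    then have "conn (F f A) u1 w" by simp
    then show "w \<in> {u1, u2}"
    proof (rule conn_closed)
      fix a b assume ab: "{a, b} \<in> F f A" "a \<in> {u1, u2}"
      then have "{a, b} = e3" using FA uK K_def by (auto simp: doubleton_eq_iff)
      then show "b \<in> {u1, u2}" using u by (auto simp: doubleton_eq_iff)
    qed simp
  qed (use c12 in auto)
  define c where "c = f {v, u1}"
  have cS: "c \<in> S" using token_S[OF stf T u(2)] c_def by simp
  have inj: "inj_on (\<lambda>u. f {v, u}) K" by (rule comp_token_inj[OF f yW(2) Ksub])
  have KW: "K \<subseteq> W" using yW K_def by simp
  have "(\<lambda>u. f {v, u}) ` K = S"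
    by (rule card_subset_eq[OF finS]) (use token_S[OF stf T] KW card_image[OF inj] cK S in auto)
  then obtain y where y: "y \<in> K" "f {v, y} = c" using cS by (metis (no_types, lifting) imageE)
  have yy: "y \<in> W" "y \<noteq> u1" using y KW uK by auto
  have cA: "c \<noteq> A" using cS AS by auto
  have KA: "w \<in> K \<Longrightarrow> conn (F f A) y w" "w \<in> {u1, u2} \<Longrightarrow> conn (F f A) u1 w" for w
    using comp[OF y(1)] A2 by blast+
  have Ky: "conn (F f c) y w" if "w \<in> K" for w
    using stuck_conn[OF f yy(1) KA(1)[OF that]] y(2) by simp
  have Kn: "\<not> conn (F f c) u1 w" if "w \<in> K" for w
    by (rule comp_disjoint[OF f yy(1) u(2) yy(2) y(2) c_def[symmetric] KA(1)[OF that]])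
  have Un: "\<not> conn (F f c) y w" if "w \<in> {u1, u2}" for w
    by (rule comp_disjoint[OF f u(2) yy(1) yy(2)[symmetric] c_def[symmetric] y(2) KA(2)[OF that]])
  show False
  proof (cases "conn (F f c) y s")
    case True
    have s1: "\<not> conn (F f c) u1 s"
    proof
      assume "conn (F f c) u1 s"
      then have "conn (F f c) y u1" using True by (meson conn_sym conn_trans)
      then show False using Un by blast
    qed
    have "{w. conn (F f c) u1 w} \<subseteq> {u1, u2}"
    proof (intro subsetI)
      fix w assume "w \<in> {w. conn (F f c) u1 w}"
      then have w: "conn (F f c) u1 w" by simp
      have "w \<in> insert s (K \<union> {u1, u2})" using F_in[OF w u(2)] WW by simp
      then show "w \<in> {u1, u2}" using Kn w s1 by blast
    qed
    moreover have "{u1, u2} \<subseteq> {w. conn (F f c) u1 w}"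
      using stuck_conn[OF f u(2) c12(1)] c_def by simp
    ultimately have "{w. conn (F f c) u1 w} = {u1, u2}" by (rule equalityI)
    then show False using same_comp[OF A2 _ cA] u(4) by simp
  next
    case False
    have "{w. conn (F f c) y w} \<subseteq> K"
    proof (intro subsetI)
      fix w assume "w \<in> {w. conn (F f c) y w}"
      then have w: "conn (F f c) y w" by simp
      have "w \<in> insert s (K \<union> {u1, u2})" using F_in[OF w yy(1)] WW by simp
      then show "w \<in> K" using Un w False by blast
    qed
    then have "{w. conn (F f c) y w} = K" using Ky by blast
    then show False using same_comp[OF comp[OF y(1)] _ cA] cK by simp
  qed
qed

lemma no_A_token_three:
  assumes f: "stuck f" and T: "T f A = {}" and S: "card S = 3" and W: "card W = 6" and c: "card (F f A) = 3"
  shows False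
proof -
  have np: "\<forall>a b c. {a, b} \<in> F f A \<longrightarrow> {b, c} \<in> F f A \<longrightarrow> a = c"
  proof (intro allI impI, rule ccontr)
    fix a b c assume "{a, b} \<in> F f A" "{b, c} \<in> F f A" "a \<noteq> c"
    from no_A_token_three_path[OF assms this] show False .
  qed
  obtain e1 e2 e3 where FA: "F f A = {e1, e2, e3}" "e1 \<noteq> e2" "e1 \<noteq> e3" "e2 \<noteq> e3" using c by (auto simp: card_3_iff)
  have E: "e1 \<in> edges W" "e2 \<in> edges W" "e3 \<in> edges W" using FA(1) cls_edges[of W f A] by blast+
  have disj: "e \<inter> d = {}" if "e \<in> F f A" "d \<in> F f A" "e \<noteq> d" for e d
    by (rule edges_disjoint[OF np cls_edges that])
  have card2: "card e = 2" if "e \<in> edges W" for e using that by (auto simp: edges_def)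
  have comp: "{u. conn (F f A) a u} = e" if e: "e \<in> F f A" and a: "a \<in> e" for a e
  proof (intro equalityI subsetI)
    fix w assume "w \<in> {u. conn (F f A) a u}"
    then have "conn (F f A) a w" by simp
    then show "w \<in> e"
    proof (rule conn_closed[OF _ a])
      fix u w assume "{u, w} \<in> F f A" "u \<in> e"
      then have "{u, w} = e" using disj[OF e, of "{u, w}"] by blast
      then show "w \<in> e" by blast
    qed
  next
    fix w assume w: "w \<in> e"
    have "e \<in> edges W" using e cls_edges[of W f A] by blast
    then obtain p q where "e = {p, q}" by (rule edgesE)
    then have "w = a \<or> {a, w} = e" using w a by auto
    then have "conn (F f A) a w" using e conn_edge[of a w "F f A"] by auto
    then show "w \<in> {u. conn (F f A) a u}" by simp
  qed
  have m: "e1 \<in> F f A" "e2 \<in> F f A" "e3 \<in> F f A" using FA by auto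
  have d: "e1 \<inter> e2 = {}" "e2 \<inter> e3 = {}" "e1 \<inter> e3 = {}" using disj m FA by blast+
  have fin: "finite e1" "finite e2" "finite e3" using card2 E by (metis card.infinite zero_neq_numeral)+
  have "card (e1 \<union> e2 \<union> e3) = 6"
    using d fin card2 E by (simp add: card_Un_disjoint Int_Un_distrib2)
  moreover have "e1 \<union> e2 \<union> e3 \<subseteq> W"
    by (intro Un_least edges_subset E)
  ultimately have WW: "W = e1 \<union> e2 \<union> e3" using W finV by (intro card_subset_eq[symmetric]) auto
  show False
    by (rule no_A_token_three_matching[OF f T S _ _ _ card2[OF E(1)] card2[OF E(2)] card2[OF E(3)] d(1,2,3) WW])
      (rule comp[OF m(1)] comp[OF m(2)] comp[OF m(3)], assumption)+
qed

section \<open>Token counts force degree one\<close>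

lemma token_sum:
  assumes "st f"
  shows "card (T f A) + (\<Sum>c\<in>S. card (T f c)) = card W"
proof -
  have "W = (\<Union>c\<in>insert A S. T f c)" using token_color[OF assms] by (auto simp: tok_def)
  moreover have "card (\<Union>c\<in>insert A S. T f c) = (\<Sum>c\<in>insert A S. card (T f c))"
    by (rule card_UN_disjoint) (use finS finV in auto)
  ultimately show ?thesis using finS AS by simp
qed

lemma token_pos:
  assumes "st f" "W \<noteq> {}" "c \<in> S"
  shows "1 \<le> card (T f c)"
proof -
  obtain u where "u \<in> W" using assms(2) by blast
  then have "T f c \<noteq> {}" using token_ex[OF assms(1,3)] by blast
  then have "card (T f c) \<noteq> 0" using finV by simp
  then show ?thesis by simp
qed

text \<open>If B had two tokens, each other colour of \<open>S\<close> still takes at least one of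
  the \<open>2 * card S + 1\<close> tokens, so A has at most \<open>card S\<close>. Component sizes
  exclude one or two A-tokens. Three of them require \<open>card S = 3\<close>; then A has four
  edges on the seven vertices off v, and \<open>spanning_A_crossing\<close> applies.\<close>

lemma even_peeled:
  assumes f: "stuck f" and r: "r = card V - 1" and W: "card W = 2 * card S + 1"
    and S: "card S \<in> {1, 2, 3}" and B: "B \<in> S"
  shows "card (T f B) = 1"
proof (rule ccontr)
  assume neq: "card (T f B) \<noteq> 1"
  note stf = stuck_st[OF f]
  have Wne: "W \<noteq> {}"
  proof
    assume "W = {}"
    then have "card W = 0" by (simp only: card.empty)
    then show False using W S by auto
  qed
  have B2: "2 \<le> card (T f B)" using token_pos[OF stf Wne B] neq by linarith
  have sum: "card (T f A) + (card (T f B) + (\<Sum>c\<in>S - {B}. card (T f c))) = card W"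
    using token_sum[OF stf] sum.remove[OF finS B, of "\<lambda>c. card (T f c)"] by simp
  have "card (S - {B}) \<le> (\<Sum>c\<in>S - {B}. card (T f c))"
    using sum_mono[of "S - {B}" "\<lambda>_. 1" "\<lambda>c. card (T f c)"] token_pos[OF stf Wne] by simp
  then have le: "card (T f A) \<le> card S" using sum W B2 finS B by simp
  obtain u where "u \<in> W" using Wne by blast
  then have "T f A \<noteq> {}" using token_ex_A[OF stf r] by blast
  then have pos: "card (T f A) \<noteq> 0" using finV by simp
  have S': "card S = 1 \<or> card S = 2 \<or> card S = 3" using S by auto
  consider "card (T f A) = 1" | "card (T f A) = 2" "card S = 2 \<or> card S = 3" | "card (T f A) = 3" "card S = 3"
    using le pos S' by linarith
  then show False
  proof cases
    case 1
    obtain p where "T f A = {p}" by (rule card_1_singletonE[OF 1])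
    then show False using one_A_token_card[OF f r] W S by auto
  next
    case 2
    then obtain p q where "T f A = {p, q}" "p \<noteq> q" by (auto simp: card_2_iff)
    then show False using two_A_tokens_impossible[OF f r _ _ 2(2) W] by blast
  next
    case 3
    have "card (S - {B}) = 2" using 3(2) finS B by simp
    then obtain C E where CE: "S - {B} = {C, E}" "C \<noteq> E" by (auto simp: card_2_iff)
    have SS: "S = {B, C, E}" using CE(1) B by blast
    have "card (T f C) + card (T f E) + card (T f B) = 4" using sum CE W 3 by simp
    moreover have "1 \<le> card (T f C)" "1 \<le> card (T f E)" using token_pos[OF stf Wne] SS by simp_all
    ultimately have "card (T f C) = 1" "card (T f E) = 1" using B2 by linarith+
    then have tame: "tame f B" unfolding tame_def using SS by blast
    have "card V = 8" using W 3(2) vV finV by simp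
    moreover have "card (cls V f A) = r" using stf by (simp add: state_def)
    ultimately have "card (F f A) = 4" using card_cls_star[OF finV vV, of f A] r 3(1) by simp
    then show False using spanning_A_crossing[OF f tame B2] W 3(2) by simp
  qed
qed

text \<open>The same count gives A fewer than \<open>card S\<close> tokens, so some A-edge avoids v.
  With no A-token the matching and path arguments apply; otherwise so few tokens are left for the
  other colours that B is tame, and the crossing lemmas finish.\<close>

lemma odd_peeled:
  assumes f: "stuck f" and r: "r = card S" and W: "card W = 2 * card S"
    and S: "card S \<in> {1, 2, 3}" and B: "B \<in> S"
  shows "card (T f B) = 1"
proof (rule ccontr)
  assume neq: "card (T f B) \<noteq> 1"
  note stf = stuck_st[OF f]
  have Wne: "W \<noteq> {}"
  proof
    assume "W = {}"
    then have "card W = 0" by (simp only: card.empty)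
    then show False using W S by auto
  qed
  have B2: "2 \<le> card (T f B)" using token_pos[OF stf Wne B] neq by linarith
  have sum: "card (T f A) + (card (T f B) + (\<Sum>c\<in>S - {B}. card (T f c))) = card W"
    using token_sum[OF stf] sum.remove[OF finS B, of "\<lambda>c. card (T f c)"] by simp
  have "card (S - {B}) \<le> (\<Sum>c\<in>S - {B}. card (T f c))"
    using sum_mono[of "S - {B}" "\<lambda>_. 1" "\<lambda>c. card (T f c)"] token_pos[OF stf Wne] by simp
  then have le: "card (T f A) < card S" using sum W B2 finS B S by auto
  have FA: "card (F f A) + card (T f A) = card S"
    using card_cls_star[OF finV vV, of f A] stf r by (simp add: state_def)
  then have "F f A \<noteq> {}" using le by auto
  then obtain e where e: "e \<in> F f A" by blast
  then obtain y z where yz: "{y, z} \<in> F f A" using set_mp[OF cls_edges e] by (metis edgesE)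
  show False
  proof (cases "card (T f A) = 0")
    case True
    then have T: "T f A = {}" using finV by simp
    have "y \<noteq> z" "y \<in> W" using yz by auto
    then have "card {y, z} = 2" "{y, z} \<subseteq> {u. conn (F f A) y u}" using conn_edge[OF yz] by auto
    then have "2 \<le> card S" using comp_card(2)[OF f \<open>y \<in> W\<close> _ T] by metis
    then consider "card S = 2" | "card S = 3" using S by auto
    then show False using no_A_token_two[OF f T] no_A_token_three[OF f T] W FA True by cases simp_all
  next
    case False
    have S': "card S = 1 \<or> card S = 2 \<or> card S = 3" using S by auto
    consider "card S = 2" "card (T f A) = 1" | "card S = 3" "card (T f A) = 1" | "card S = 3" "card (T f A) = 2"
      using le S' False by linarith
    then show False
    proof cases
      case 1
      have "card (S - {B}) = 1" using 1 finS B by simp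
      then obtain E where E: "S - {B} = {E}" by (rule card_1_singletonE)
      \<comment> \<open>With only two colours in \<open>S\<close>, the roles of C and E in
        \<open>tame\<close> fall together.\<close>
      have SS: "S = {B, E, E}" using E B by blast
      have "card (T f E) + card (T f B) = 3" using sum E W 1 by simp
      moreover have "1 \<le> card (T f E)" using token_pos[OF stf Wne] SS by simp
      ultimately have "card (T f E) = 1" using B2 by linarith
      then have tame: "tame f B" unfolding tame_def using SS by blast
      obtain p where "T f A = {p}" by (rule card_1_singletonE[OF 1(2)])
      then show False using crossing_one_A_token[OF f tame B2 yz] by blast
    next
      case 2
      have "card (S - {B}) = 2" using 2(1) finS B by simp
      then obtain C E where CE: "S - {B} = {C, E}" "C \<noteq> E" by (auto simp: card_2_iff)
      have SS: "S = {B, C, E}" "S = {B, E, C}" using CE(1) B by blast+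
      have "card (T f C) + card (T f E) + card (T f B) = 5" using sum CE W 2 by simp
      moreover have "1 \<le> card (T f C)" "1 \<le> card (T f E)" using token_pos[OF stf Wne] SS by simp_all
      ultimately have "card (T f C) = 1 \<or> card (T f E) = 1" using B2 by linarith
      then have tame: "tame f B" unfolding tame_def using SS 2(2) by blast
      obtain p where "T f A = {p}" by (rule card_1_singletonE[OF 2(2)])
      then show False using crossing_one_A_token[OF f tame B2 yz] by blast
    next
      case 3
      have "card (S - {B}) = 2" using 3(1) finS B by simp
      then obtain C E where CE: "S - {B} = {C, E}" "C \<noteq> E" by (auto simp: card_2_iff)
      have SS: "S = {B, C, E}" using CE(1) B by blast
      have "card (T f C) + card (T f E) + card (T f B) = 4" using sum CE W 3 by simp
      moreover have "1 \<le> card (T f C)" "1 \<le> card (T f E)" using token_pos[OF stf Wne] SS by simp_all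
      ultimately have "card (T f C) = 1" "card (T f E) = 1" using B2 by linarith+
      then have tame: "tame f B" unfolding tame_def using SS by blast
      have "card (F f A) = 1" using FA 3 by simp
      then obtain e where "F f A = {e}" by (rule card_1_singletonE)
      then have "F f A = {{y, z}}" using yz by simp
      then show False using crossing_two_A_tokens[OF f tame B2 _ 3(2)] by blast
    qed
  qed
qed

end

section \<open>Removing a vertex\<close>

lemma step_agree:
  assumes "valid V f" "\<forall>e \<in> edges V. f e = g e"
  shows "step V f g"
proof -
  have "cls V f c = cls V g c" for c by (rule cls_cong) (use assms(2) in auto)
  then show ?thesis using assms unfolding step_def valid_def by auto
qed

lemma step_cong_left:
  assumes "step V f h" "\<forall>e \<in> edges V. f e = g e"
  shows "step V g h"
proof -
  have c: "cls V f c = cls V g c" for c by (rule cls_cong) (use assms(2) in auto)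
  have "valid V g" "\<forall>c. card (cls V g c) = card (cls V h c)" "valid V h"
    using assms(1) c unfolding step_def valid_def by auto
  moreover have "(\<forall>e \<in> edges V. g e = h e) \<or>
      (\<exists>x \<in> V. \<exists>y \<in> V. \<exists>z \<in> V. x \<noteq> y \<and> x \<noteq> z \<and> y \<noteq> z \<and> (\<forall>e \<in> edges V - tri x y z. g e = h e))"
    using assms unfolding step_def by (metis DiffD1)
  ultimately show ?thesis unfolding step_def by simp
qed

lemma edges_star_cases:
  assumes "e \<in> edges V" "e \<notin> edges (V - {v})"
  obtains t where "t \<in> V - {v}" "e = {v, t}"
proof -
  obtain x y where e: "e = {x, y}" "x \<in> V" "y \<in> V" "x \<noteq> y" using assms(1) by (rule edgesE)
  then consider "x = v" | "y = v" using assms(2) by auto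
  then show ?thesis using that e by cases (auto simp: insert_commute)
qed

context peel
begin

text \<open>A colour of \<open>S\<close> with one token at v remains a spanning tree of
  \<open>W\<close>, which lets the induction go on with the same \<open>S\<close>.\<close>

definition peeled :: "('a set \<Rightarrow> 'c) \<Rightarrow> bool" where
  "peeled f \<longleftrightarrow> st f \<and> (\<forall>c \<in> S. card (T f c) = 1)"

lemma reach_stuck:
  assumes "st f" shows "\<exists>g. sim V f g \<and> stuck g"
proof -
  have "card (T g A) \<le> card V" for g by (rule card_mono[OF finV]) (auto simp: tok_def)
  then have "\<forall>g. sim V f g \<longrightarrow> card (T g A) < Suc (card V)" by (simp add: less_Suc_eq_le)
  then obtain g where g: "sim V f g" "\<And>h. sim V f h \<Longrightarrow> card (T h A) \<le> card (T g A)"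
    using ex_has_greatest_nat[of "sim V f" f "\<lambda>g. card (T g A)" "Suc (card V)"] by auto
  have "stuck g"
    unfolding stuck_def using state_sim[OF finV assms g(1)] g(2) rtranclp_trans[OF g(1)] by auto
  then show ?thesis using g(1) by blast
qed

lemma card_T_cong:
  assumes "step V f g" "\<And>c. F g c = F f c" shows "card (T g c) = card (T f c)"
proof -
  have "card (cls V f c) = card (cls V g c)" using assms(1) by (simp add: step_def)
  then show ?thesis using card_cls_star[OF finV vV] assms(2) by (metis add_left_cancel)
qed

section \<open>Peeled colourings: matching tokens and lifting steps\<close>

lemma peeled_swap:
  assumes f: "peeled f" and yz: "y \<in> W" "z \<in> W" "y \<noteq> z" and ne: "f {v, y} \<noteq> f {v, z}"
    and a: "conn (F f (f {v, y})) y z \<or> (\<forall>t \<in> T f (f {v, y}). \<not> conn (F f (f {v, y})) t z)"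
    and b: "conn (F f (f {v, z})) y z \<or> (\<forall>t \<in> T f (f {v, z}). \<not> conn (F f (f {v, z})) t y)"
  shows "step V f (swap_tok v y z f)" "peeled (swap_tok v y z f)"
proof -
  have stf: "st f" using f by (simp add: peeled_def)
  show s: "step V f (swap_tok v y z f)" by (rule swap_step[OF stf yz ne a b])
  show "peeled (swap_tok v y z f)"
    using f state_step[OF finV stf s] card_T_cong[OF s F_swap] by (simp add: peeled_def)
qed

lemma peeled_conn:
  assumes "peeled f" "c \<in> S" "y \<in> W" "z \<in> W" shows "conn (F f c) y z"
proof -
  have "card (T f c) = 1" using assms by (simp add: peeled_def)
  then obtain p where p: "T f c = {p}" by (rule card_1_singletonE)
  have "st f" using assms by (simp add: peeled_def)
  then have "conn (F f c) p y" "conn (F f c) p z"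
    using conn_single_token[OF _ assms(2) p] assms(3,4) by blast+
  then show ?thesis by (meson conn_sym conn_trans)
qed

text \<open>The swap makes p agree with g, and it cannot spoil y, where f and g disagreed
  already.\<close>

lemma swap_disagree:
  assumes pq: "p \<in> W" "y \<in> W" "p \<noteq> y" and g: "f {v, y} = g {v, p}" "f {v, p} \<noteq> g {v, p}" "f {v, y} \<noteq> g {v, y}"
  shows "card {u \<in> W. swap_tok v p y f {v, u} \<noteq> g {v, u}} < card {u \<in> W. f {v, u} \<noteq> g {v, u}}"
proof (rule psubset_card_mono)
  have ne: "v \<noteq> p" "v \<noteq> y" "p \<noteq> y" using pq by auto
  have s3: "swap_tok v p y f e = f e" if "e \<noteq> {v, p}" "e \<noteq> {v, y}" for e
    by (rule swap_tok_simps(3)[OF ne that])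
  have s: "swap_tok v p y f {v, u} = (if u = p then f {v, y} else if u = y then f {v, p} else f {v, u})" if "u \<in> W" for u
    using swap_tok_simps(1,2)[OF ne, of f] s3[of "{v, u}"] that by (auto simp: doubleton_eq_iff)
  have "u \<in> {u \<in> W. f {v, u} \<noteq> g {v, u}} - {p}" if u: "u \<in> W" "swap_tok v p y f {v, u} \<noteq> g {v, u}" for u
    using s[OF u(1)] u g by (cases "u = p"; cases "u = y") auto
  then have "{u \<in> W. swap_tok v p y f {v, u} \<noteq> g {v, u}} \<subseteq> {u \<in> W. f {v, u} \<noteq> g {v, u}} - {p}" by blast
  moreover have "p \<in> {u \<in> W. f {v, u} \<noteq> g {v, u}}" using pq g by simp
  ultimately show "{u \<in> W. swap_tok v p y f {v, u} \<noteq> g {v, u}} \<subset> {u \<in> W. f {v, u} \<noteq> g {v, u}}" by blast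
qed (use finV in simp)

lemma card_T_A:
  assumes "st f" "st g" "\<forall>e \<in> edges W. f e = g e" shows "card (T f A) = card (T g A)"
proof -
  have "F f A = F g A" by (rule cls_cong) (use assms(3) in auto)
  moreover have "card (cls V f A) = card (cls V g A)" using assms by (simp add: state_def)
  ultimately show ?thesis using card_cls_star[OF finV vV] by (metis add_left_cancel)
qed

text \<open>The A-tokens are corrected first, since A may be disconnected off v. A token wanted at p
  is taken from the A-component of p if there is one, and by uniqueness g has no A-token at its old
  place. Otherwise any A-token misplaced with respect to g can be used; it exists because f and g
  have equally many. Once the A-tokens agree, the remaining colours have single tokens and are
  connected off v.\<close>

lemma retoken_swap:
  assumes f: "peeled f" and g: "peeled g" and agree: "\<forall>e \<in> edges W. f e = g e"
    and ex: "\<exists>u \<in> W. f {v, u} \<noteq> g {v, u}"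
  shows "\<exists>p \<in> W. \<exists>y \<in> W. p \<noteq> y \<and> f {v, y} = g {v, p} \<and> f {v, p} \<noteq> g {v, p} \<and> f {v, y} \<noteq> g {v, y} \<and>
    step V f (swap_tok v p y f) \<and> peeled (swap_tok v p y f)"
proof -
  have stf: "st f" and stg: "st g" using f g by (simp_all add: peeled_def)
  have FF: "F f c = F g c" for c by (rule cls_cong) (use agree in auto)
  have cA: "card (T f A) = card (T g A)" by (rule card_T_A[OF stf stg agree])
  have fin: "finite (T f A)" "finite (T g A)" using finV by auto
  show ?thesis
  proof (cases "\<exists>p \<in> W. g {v, p} = A \<and> f {v, p} \<noteq> A")
    case True
    then obtain p where p: "p \<in> W" "g {v, p} = A" "f {v, p} \<noteq> A" by blast
    have fS: "f {v, p} \<in> S" using token_color[OF stf p(1)] p(3) by simp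
    have pick: ?thesis if y: "y \<in> W" "f {v, y} = A" "g {v, y} \<noteq> A"
      and c: "conn (F f A) p y \<or> (\<forall>t \<in> T f A. \<not> conn (F f A) t p)" for y
    proof -
      have py: "p \<noteq> y" using y p by auto
      have "step V f (swap_tok v p y f)" "peeled (swap_tok v p y f)"
        using peeled_swap[OF f p(1) y(1) py] peeled_conn[OF f fS p(1) y(1)] c y(2) p(3) by auto
      then show ?thesis using p y py by (intro bexI[of _ p] bexI[of _ y]) auto
    qed
    show ?thesis
    proof (cases "\<exists>y \<in> T f A. conn (F f A) y p")
      case True
      then obtain y where y: "y \<in> T f A" "conn (F f A) y p" by blast
      have "g {v, y} \<noteq> A"
      proof
        assume "g {v, y} = A"
        then have "y = p" using token_unique[OF stg, of y A p] y p FF by auto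
        then show False using y p by auto
      qed
      then show ?thesis using pick[of y] y conn_sym[OF y(2)] by auto
    next
      case False
      have "\<not> T f A \<subseteq> T g A"
      proof
        assume "T f A \<subseteq> T g A"
        then have "T f A = T g A" using card_subset_eq[OF fin(2)] cA by blast
        moreover have "p \<in> T g A" "p \<notin> T f A" using p by auto
        ultimately show False by simp
      qed
      then obtain y where "y \<in> T f A" "y \<notin> T g A" by blast
      then show ?thesis using pick[of y] False by auto
    qed
  next
    case False
    then have "T g A \<subseteq> T f A" by auto
    then have TA: "T g A = T f A" using card_subset_eq[OF fin(1)] cA by metis
    obtain p where p: "p \<in> W" "f {v, p} \<noteq> g {v, p}" using ex by blast
    have gA: "g {v, p} \<noteq> A" using False p by metis
    have fA: "f {v, p} \<noteq> A"
    proof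
      assume "f {v, p} = A"
      then have "p \<in> T f A" using p by auto
      then have "p \<in> T g A" using TA by simp
      then show False using gA by simp
    qed
    have S: "f {v, p} \<in> S" "g {v, p} \<in> S"
      using token_color[OF stf p(1)] token_color[OF stg p(1)] gA fA by auto
    have "card (T f (g {v, p})) = 1" "card (T g (g {v, p})) = 1" using f g S by (simp_all add: peeled_def)
    then obtain y q where y: "T f (g {v, p}) = {y}" and q: "T g (g {v, p}) = {q}" by (meson card_1_singletonE)
    have "y \<in> T f (g {v, p})" using y by simp
    then have yW: "y \<in> W" "f {v, y} = g {v, p}" by simp_all
    then have py: "p \<noteq> y" using p by auto
    have "p \<in> T g (g {v, p})" using p by auto
    then have "q = p" using q by simp
    then have "y \<notin> T g (g {v, p})" using q py by simp
    then have gy: "g {v, y} \<noteq> g {v, p}" using yW by auto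
    have "step V f (swap_tok v p y f)" "peeled (swap_tok v p y f)"
      using peeled_swap[OF f p(1) yW(1) py] peeled_conn[OF f S(1) p(1) yW(1)] peeled_conn[OF f S(2) p(1) yW(1)]
        yW p(2) by auto
    then show ?thesis using p yW py gy by (intro bexI[of _ p] bexI[of _ y]) auto
  qed
qed

lemma retoken:
  assumes "peeled f" "peeled g" "\<forall>e \<in> edges W. f e = g e"
  shows "sim V f g"
  using assms(1,3)
proof (induction "card {u \<in> W. f {v, u} \<noteq> g {v, u}}" arbitrary: f rule: less_induct)
  case less
  show ?case
  proof (cases "\<exists>u \<in> W. f {v, u} \<noteq> g {v, u}")
    case True
    obtain p y where py: "p \<in> W" "y \<in> W" "p \<noteq> y" "f {v, y} = g {v, p}" "f {v, p} \<noteq> g {v, p}" "f {v, y} \<noteq> g {v, y}"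
      and s: "step V f (swap_tok v p y f)" "peeled (swap_tok v p y f)"
      using retoken_swap[OF less.prems(1) assms(2) less.prems(2) True] by blast
    have "\<forall>e \<in> edges W. swap_tok v p y f e = g e" using less.prems(2) swap_tok_edges by metis
    then have "sim V (swap_tok v p y f) g" by (rule less.hyps[OF swap_disagree[OF py] s(2)])
    then show ?thesis by (rule converse_rtranclp_into_rtranclp[where r = "step V", OF s(1)])
  next
    case False
    have "f e = g e" if "e \<in> edges V" for e
    proof (cases "e \<in> edges W")
      case True then show ?thesis using less.prems(2) by blast
    next
      case e: False
      then show ?thesis using edges_star_cases[OF that e] False by metis
    qed
    moreover have "valid V f" using less.prems(1) st_valid by (simp add: peeled_def)
    ultimately have "step V f g" by (intro step_agree) auto
    then show ?thesis by blast
  qed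
qed

text \<open>Prepares the replacement of the A-edge \<open>{s, t}\<close> by \<open>{s, u}\<close>.
  The A-component of s and t has at most one token. If it lies on the side of s, moving it to t
  leaves the \<open>H\<close>-component of s without tokens, and then no new edge at s can join two
  token-bearing components.\<close>

lemma exchange_tokens:
  assumes f: "peeled f" and H: "F f A = insert {s, t} H" "{s, t} \<notin> H"
  shows "\<exists>g. peeled g \<and> sim V f g \<and> (\<forall>e \<in> edges W. g e = f e) \<and>
    (\<forall>a \<in> T g A. \<forall>b \<in> T g A. a \<noteq> b \<longrightarrow> \<not> conn (insert {s, u} H) a b)"
proof -
  have stf: "st f" using f by (simp add: peeled_def)
  have fo: "forest (F f A)"
    by (rule validD[OF conjunct1[OF valid_star[OF vV, THEN iffD1, OF st_valid[OF stf]]]])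
  have st: "\<not> conn H s t" using fo forest_insert[OF H(2)] H(1) by simp
  have "{s, t} \<in> F f A" using H by simp
  then have W: "s \<in> W" "t \<in> W" "s \<noteq> t" by simp_all
  have HF: "conn H a b \<Longrightarrow> conn (F f A) a b" for a b by (rule conn_mono) (auto simp: H)
  have cst: "conn (F f A) s t" by (rule conn_edge) (simp add: H)
  have indep: "\<forall>a \<in> T g A. \<forall>b \<in> T g A. a \<noteq> b \<longrightarrow> \<not> conn (insert {s, u} H) a b"
    if g: "st g" "F g A = F f A" and no: "\<And>a. a \<in> T g A \<Longrightarrow> \<not> conn H a s" for g
  proof (intro ballI impI notI)
    fix a b assume ab: "a \<in> T g A" "b \<in> T g A" "a \<noteq> b" "conn (insert {s, u} H) a b"
    have "\<not> conn H a b" using token_unique[OF g(1) ab(1,2)] ab(3) HF g(2) by metis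
    then have "conn H a s \<or> conn H s b" using ab(4) unfolding conn_insert by blast
    then show False using no[OF ab(1)] no[OF ab(2)] conn_sym[of H s b] by blast
  qed
  show ?thesis
  proof (cases "\<exists>p \<in> T f A. conn H p s")
    case False
    then show ?thesis using indep[OF stf refl] f by (intro exI[of _ f]) auto
  next
    case True
    then obtain p where p: "p \<in> T f A" "conn H p s" by blast
    have pW: "p \<in> W" "f {v, p} = A" using p by auto
    have pt: "p \<noteq> t" using p(2) st conn_sym[of H p s] by auto
    have cpt: "conn (F f A) p t" using HF[OF p(2)] cst conn_trans by metis
    have ft: "f {v, t} \<noteq> A"
    proof
      assume "f {v, t} = A"
      then have "t \<in> T f A" using W by auto
      then show False using token_unique[OF stf p(1) _ cpt] pt by blast
    qed
    then have tS: "f {v, t} \<in> S" using token_color[OF stf W(2)] by simp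
    let ?g = "swap_tok v p t f"
    have g: "step V f ?g" "peeled ?g"
      using peeled_swap[OF f pW(1) W(2) pt] pW(2) ft cpt peeled_conn[OF f tS pW(1) W(2)] by auto
    have stg: "st ?g" using g by (simp add: peeled_def)
    have "?g {v, t} = A" using swap_tok_simps(2)[of v p t f] pW W pt by auto
    then have tg: "t \<in> T ?g A" using W by auto
    have "\<not> conn H a s" if a: "a \<in> T ?g A" for a
    proof
      assume *: "conn H a s"
      then have "conn (F ?g A) a t" using HF[OF *] cst conn_trans F_swap by metis
      then have "a = t" using token_unique[OF stg a tg] by blast
      then show False using * st conn_sym by metis
    qed
    then have "\<forall>a \<in> T ?g A. \<forall>b \<in> T ?g A. a \<noteq> b \<longrightarrow> \<not> conn (insert {s, u} H) a b"
      by (intro indep[OF stg F_swap])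
    moreover have "\<forall>e \<in> edges W. ?g e = f e" using swap_tok_edges by metis
    ultimately show ?thesis using g by blast
  qed
qed

text \<open>Colours of \<open>S\<close> have a single token and cannot form a cycle through v, so
  the condition on A is all that the lifted colouring has to satisfy at v.\<close>

lemma lift_indep:
  assumes f: "peeled f" and s: "step W f h"
    and xyz: "x \<in> W" "y \<in> W" "z \<in> W" "x \<noteq> y" "x \<noteq> z" "y \<noteq> z" "\<forall>e \<in> edges W - tri x y z. f e = h e"
    and ind: "\<forall>a \<in> T f A. \<forall>b \<in> T f A. a \<noteq> b \<longrightarrow> \<not> conn (F h A) a b"
  shows "\<exists>g. peeled g \<and> sim V f g \<and> (\<forall>e \<in> edges W. g e = h e)"
proof -
  have stf: "st f" using f by (simp add: peeled_def)
  define g where "g e = (if e \<in> edges W then h e else f e)" for e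
  have agree: "\<forall>e \<in> edges W. g e = h e" by (simp add: g_def)
  have Fg: "F g c = F h c" for c by (rule cls_cong) (simp add: g_def)
  have "{v, t} \<notin> edges W" for t using edges_subset by blast
  then have tg: "g {v, t} = f {v, t}" for t by (simp add: g_def)
  have Tg: "T g c = T f c" for c by (rule T_cong) (simp add: tg)
  have vh: "valid W h" using s by (simp add: step_def)
  have "valid V g"
    unfolding valid_star[OF vV]
  proof (intro conjI allI ballI impI)
    show "valid W g" using vh Fg by (simp add: valid_def)
    fix c p q assume pq: "p \<in> T g c" "q \<in> T g c" "p \<noteq> q"
    have pq': "p \<in> T f c" "q \<in> T f c" using pq Tg by simp_all
    have "c = A"
    proof (rule ccontr)
      assume "c \<noteq> A"
      moreover have "p \<in> W" "f {v, p} = c" using pq' by simp_all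
      ultimately have "c \<in> S" using token_color[OF stf] by blast
      then have "card (T f c) = 1" using f by (simp add: peeled_def)
      then obtain w where "T f c = {w}" by (rule card_1_singletonE)
      then show False using pq' pq(3) by simp
    qed
    then show "\<not> conn (F g c) p q" using ind pq' pq(3) Fg by simp
  qed
  moreover have cc: "card (cls V f c) = card (cls V g c)" for c
  proof -
    have "card (F f c) = card (F h c)" using s by (simp add: step_def)
    then show ?thesis
      using card_cls_star[OF finV vV, of f c] card_cls_star[OF finV vV, of g c] Fg[of c] Tg[of c] by simp
  qed
  moreover have "\<forall>e \<in> edges V - tri x y z. f e = g e" using xyz(7) by (auto simp: g_def)
  ultimately have "step V f g"
    unfolding step_def using st_valid[OF stf] xyz by blast
  moreover have "peeled g"
    using f state_step[OF finV stf \<open>step V f g\<close>] Tg by (simp add: peeled_def)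
  ultimately show ?thesis using agree by blast
qed

lemma F_diff:
  assumes xyz: "x \<in> W" "y \<in> W" "z \<in> W" "x \<noteq> y" "x \<noteq> z" "y \<noteq> z" "\<forall>e \<in> edges W - tri x y z. f e = h e"
  shows "F h c - tri x y z = F f c - tri x y z"
  using assms(7) unfolding cls_def by auto

lemma lift_one:
  assumes f: "peeled f" and s: "step W f h"
    and xyz: "s0 \<in> W" "t \<in> W" "u \<in> W" "s0 \<noteq> t" "s0 \<noteq> u" "t \<noteq> u"
      "\<forall>e \<in> edges W - tri s0 t u. f e = h e"
    and c: "f {s0, t} = A" "f {s0, u} \<noteq> A" "f {t, u} \<noteq> A" "h {s0, u} = A" "h {s0, t} \<noteq> A" "h {t, u} \<noteq> A"
  shows "\<exists>g. peeled g \<and> sim V f g \<and> (\<forall>e \<in> edges W. g e = h e)"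
proof -
  define H where "H = F f A - {{s0, t}}"
  have H: "F f A = insert {s0, t} H" "{s0, t} \<notin> H" using c(1) xyz by (auto simp: H_def)
  have Hf: "H = F f A - tri s0 t u" unfolding H_def tri_def using c by (auto simp: cls_def)
  have "F h A - {{s0, u}} = F h A - tri s0 t u" unfolding tri_def using c by (auto simp: cls_def)
  moreover have "F h A - tri s0 t u = F f A - tri s0 t u" by (rule F_diff[OF xyz])
  ultimately have e: "F h A - {{s0, u}} = H" using Hf by simp
  have "{s0, u} \<in> F h A" using c xyz by simp
  then have Fh: "F h A = insert {s0, u} H" unfolding e[symmetric] by (rule insert_Diff[symmetric])
  obtain g where g: "peeled g" "sim V f g" "\<forall>e \<in> edges W. g e = f e"
    "\<forall>a \<in> T g A. \<forall>b \<in> T g A. a \<noteq> b \<longrightarrow> \<not> conn (insert {s0, u} H) a b"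
    using exchange_tokens[OF f H] by blast
  have "step W g h" using step_cong_left[OF s] g(3) by simp
  moreover have "\<forall>e \<in> edges W - tri s0 t u. g e = h e" using xyz(7) g(3) by simp
  ultimately obtain g' where "peeled g'" "sim V g g'" "\<forall>e \<in> edges W. g' e = h e"
    using lift_indep[OF g(1) _ xyz(1-6)] g(4) Fh by metis
  then show ?thesis using g(2) by (meson rtranclp_trans)
qed

text \<open>If A keeps its edges in the triangle, or had at least two there, the new A-class
  connects nothing new and \<open>lift_indep\<close> applies to f itself. Otherwise one A-edge moves
  to another side of the triangle; the six possibilities are instances of
  \<open>lift_one\<close>.\<close>

lemma lift_step:
  assumes f: "peeled f" and s: "step W f h"
  shows "\<exists>g. peeled g \<and> sim V f g \<and> (\<forall>e \<in> edges W. g e = h e)"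
proof -
  consider "\<forall>e \<in> edges W. f e = h e" | x y z where "x \<in> W" "y \<in> W" "z \<in> W" "x \<noteq> y" "x \<noteq> z" "y \<noteq> z"
      "\<forall>e \<in> edges W - tri x y z. f e = h e"
    using s unfolding step_def by blast
  then show ?thesis
  proof cases
    case 1
    then show ?thesis using f by blast
  next
    case (2 x y z)
    note xyz = 2
    have stf: "st f" using f by (simp add: peeled_def)
    have vf: "valid W f" and vh: "valid W h" using s by (simp_all add: step_def)
    have finW: "finite W" using finV by simp
    have off: "\<forall>e \<in> edges W - tri x y z. h e = f e" using xyz(7) by simp
    have cnt: "of_bool (h {x, y} = A) + of_bool (h {x, z} = A) + of_bool (h {y, z} = A) =
      (of_bool (f {x, y} = A) + of_bool (f {x, z} = A) + of_bool (f {y, z} = A) :: nat)"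
    proof -
      have "card (F f A) = card (F h A)" using s by (simp add: step_def)
      then show ?thesis
        using card_cls_tri[OF finW xyz(1-6) off, where c = A]
          card_cls_tri[OF finW xyz(1-6), where g = f and f = f and c = A] by simp
    qed
    have nt: "\<not> (h {x, y} = A \<and> h {x, z} = A \<and> h {y, z} = A)"
      using forest_cls_tri[OF vf xyz(1-6) off, of A] validD[OF vh] by blast
    have indep: ?thesis if into: "\<And>a b. {a, b} \<in> F h A \<Longrightarrow> conn (F f A) a b"
    proof (rule lift_indep[OF f s xyz])
      show "\<forall>a \<in> T f A. \<forall>b \<in> T f A. a \<noteq> b \<longrightarrow> \<not> conn (F h A) a b"
        using conn_into[of "F h A" _ _ "F f A"] into token_unique[OF stf] by metis
    qed
    have off_edge: "conn (F f A) a b" if "{a, b} \<in> F h A" "{a, b} \<notin> tri x y z" for a b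
    proof -
      have m: "{a, b} \<in> edges W - tri x y z" using that by auto
      have "f {a, b} = h {a, b}" using bspec[OF off m] by (rule sym)
      then have "{a, b} \<in> F f A" using that(1) by simp
      then show ?thesis by (rule conn_edge)
    qed
    let ?fx = "f {y, z} = A" and ?fy = "f {x, z} = A" and ?fz = "f {x, y} = A"
    let ?hx = "h {y, z} = A" and ?hy = "h {x, z} = A" and ?hz = "h {x, y} = A"
    consider "?hx = ?fx \<and> ?hy = ?fy \<and> ?hz = ?fz" | "?fx \<and> ?fy \<or> ?fx \<and> ?fz \<or> ?fy \<and> ?fz"
      | "?fx \<and> \<not> ?fy \<and> \<not> ?fz \<and> \<not> ?hx \<and> ?hy \<and> \<not> ?hz" | "?fx \<and> \<not> ?fy \<and> \<not> ?fz \<and> \<not> ?hx \<and> \<not> ?hy \<and> ?hz"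
      | "\<not> ?fx \<and> ?fy \<and> \<not> ?fz \<and> ?hx \<and> \<not> ?hy \<and> \<not> ?hz" | "\<not> ?fx \<and> ?fy \<and> \<not> ?fz \<and> \<not> ?hx \<and> \<not> ?hy \<and> ?hz"
      | "\<not> ?fx \<and> \<not> ?fy \<and> ?fz \<and> ?hx \<and> \<not> ?hy \<and> \<not> ?hz" | "\<not> ?fx \<and> \<not> ?fy \<and> ?fz \<and> \<not> ?hx \<and> ?hy \<and> \<not> ?hz"
      using cnt nt by (auto split: if_splits simp: of_bool_def)
    then show ?thesis
    proof cases
      case 1
      show ?thesis
      proof (rule indep)
        fix a b assume ab: "{a, b} \<in> F h A"
        show "conn (F f A) a b"
        proof (cases "{a, b} \<in> tri x y z")
          case True
          then have t: "{a, b} = {x, y} \<or> {a, b} = {x, z} \<or> {a, b} = {y, z}" by (simp add: tri_def)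
          have "h {a, b} = A" using ab by simp
          with t 1 have "f {a, b} = A" by (elim disjE) simp_all
          then show ?thesis using ab by (intro conn_edge) simp
        qed (use ab off_edge in blast)
      qed
    next
      case 2
      have ce: "?fx \<Longrightarrow> conn (F f A) y z" "?fy \<Longrightarrow> conn (F f A) x z" "?fz \<Longrightarrow> conn (F f A) x y"
        using xyz by (auto intro: conn_edge)
      have all: "conn (F f A) x y \<and> conn (F f A) x z"
        using 2 ce by (meson conn_sym conn_trans)
      show ?thesis
      proof (rule indep)
        fix a b assume ab: "{a, b} \<in> F h A"
        show "conn (F f A) a b"
        proof (cases "{a, b} \<in> tri x y z")
          case True
          then have "a \<in> {x, y, z}" "b \<in> {x, y, z}" by (auto simp: tri_def doubleton_eq_iff)
          then have "conn (F f A) x a" "conn (F f A) x b" using all by auto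
          then show ?thesis by (meson conn_sym conn_trans)
        qed (use ab off_edge in blast)
      qed
    next
      case 3
      have tr: "tri z y x = tri x y z" by (auto simp: tri_def insert_commute)
      show ?thesis
        by (rule lift_one[OF f s xyz(3) xyz(2) xyz(1) xyz(6)[symmetric] xyz(5)[symmetric] xyz(4)[symmetric]])
          (unfold tr, use xyz(7) 3 in \<open>simp_all add: insert_commute\<close>)
    next
      case 4
      have tr: "tri y z x = tri x y z" by (auto simp: tri_def insert_commute)
      show ?thesis
        by (rule lift_one[OF f s xyz(2) xyz(3) xyz(1) xyz(6) xyz(4)[symmetric] xyz(5)[symmetric]])
          (unfold tr, use xyz(7) 4 in \<open>simp_all add: insert_commute\<close>)
    next
      case 5
      have tr: "tri z x y = tri x y z" by (auto simp: tri_def insert_commute)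
      show ?thesis
        by (rule lift_one[OF f s xyz(3) xyz(1) xyz(2) xyz(5)[symmetric] xyz(6)[symmetric] xyz(4)])
          (unfold tr, use xyz(7) 5 in \<open>simp_all add: insert_commute\<close>)
    next
      case 6
      have tr: "tri x z y = tri x y z" by (auto simp: tri_def insert_commute)
      show ?thesis
        by (rule lift_one[OF f s xyz(1) xyz(3) xyz(2) xyz(5) xyz(4) xyz(6)[symmetric]])
          (unfold tr, use xyz(7) 6 in \<open>simp_all add: insert_commute\<close>)
    next
      case 7
      have tr: "tri y x z = tri x y z" by (auto simp: tri_def insert_commute)
      show ?thesis
        by (rule lift_one[OF f s xyz(2) xyz(1) xyz(3) xyz(4)[symmetric] xyz(6) xyz(5)])
          (unfold tr, use xyz(7) 7 in \<open>simp_all add: insert_commute\<close>)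
    next
      case 8
      show ?thesis
        by (rule lift_one[OF f s xyz(1) xyz(2) xyz(3) xyz(4) xyz(5) xyz(6)])
          (use xyz(7) 8 in \<open>simp_all add: insert_commute\<close>)
    qed
  qed
qed

lemma lift_sim:
  assumes "peeled f" "sim W f h"
  shows "\<exists>g. peeled g \<and> sim V f g \<and> (\<forall>e \<in> edges W. g e = h e)"
  using assms(2)
proof (induction rule: rtranclp_induct)
  case base
  then show ?case using assms(1) by blast
next
  case (step h k)
  then obtain g where g: "peeled g" "sim V f g" "\<forall>e \<in> edges W. g e = h e" by blast
  have "step W g k" using step_cong_left[OF step(2)] g(3) by simp
  then obtain g' where "peeled g'" "sim V g g'" "\<forall>e \<in> edges W. g' e = k e"
    using lift_step[OF g(1)] by blast
  then show ?case using g(2) by (meson rtranclp_trans)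
qed

text \<open>The colours of \<open>S\<close> use \<open>card S\<close> tokens, so the remaining
  \<open>card W - card S\<close> tokens are the edges that A loses with v.\<close>

lemma peeled_state:
  assumes f: "peeled f"
  shows "state W S A (r - (card W - card S)) f"
proof -
  have stf: "st f" using f by (simp add: peeled_def)
  have cW: "card V - 1 = card W" using vV finV by simp
  have "valid W f" by (rule conjunct1[OF valid_star[OF vV, THEN iffD1, OF st_valid[OF stf]]])
  have "f ` edges W \<subseteq> insert A S"
    using stf edges_mono[of W V] unfolding state_def by blast
  have c: "card (F f c) = card W - 1" if "c \<in> S" for c
    using card_cls_star[OF finV vV, of f c] f that stf cW by (simp add: peeled_def state_def)
  have "card (T f A) + card S = card W"
    using token_sum[OF stf] f by (simp add: peeled_def)
  moreover have "card (F f A) + card (T f A) = r"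
    using card_cls_star[OF finV vV, of f A] stf by (simp add: state_def)
  ultimately have "card (F f A) = r - (card W - card S)" by arith
  then show ?thesis
    using \<open>valid W f\<close> \<open>f ` edges W \<subseteq> insert A S\<close> c unfolding state_def by blast
qed

text \<open>The induction step: both colourings are brought to peeled ones, the path between their
  restrictions is lifted, and its end agrees with the second peeled colouring off v, so
  \<open>retoken\<close> closes the gap.\<close>

lemma lift_connected:
  assumes peel: "\<And>f B. stuck f \<Longrightarrow> B \<in> S \<Longrightarrow> card (T f B) = 1"
    and con: "\<And>f g. state W S A (r - (card W - card S)) f \<Longrightarrow> state W S A (r - (card W - card S)) g \<Longrightarrow> sim W f g"
    and fg: "st f" "st g"
  shows "sim V f g"
proof -
  have ex: "\<exists>f'. sim V f f' \<and> peeled f'" if "st f" for f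
    using reach_stuck[OF that] peel stuck_st unfolding peeled_def by blast
  obtain f' g' where f': "sim V f f'" "peeled f'" and g': "sim V g g'" "peeled g'"
    using ex[OF fg(1)] ex[OF fg(2)] by blast
  have "sim W f' g'" using con[OF peeled_state[OF f'(2)] peeled_state[OF g'(2)]] .
  then obtain h where h: "peeled h" "sim V f' h" "\<forall>e \<in> edges W. h e = g' e"
    using lift_sim[OF f'(2)] by blast
  have "sim V h g'" by (rule retoken[OF h(1) g'(2) h(3)])
  then show ?thesis using f'(1) h(2) sim_sym[OF g'(1)] by (meson rtranclp_trans)
qed

end

section \<open>Induction over the removed vertices\<close>

lemma connected_zero:
  assumes "state V {} A r f" "state V {} A r g"
  shows "sim V f g"
proof -
  have "f e = g e" if "e \<in> edges V" for e
  proof -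
    have "f e \<in> {A}" "g e \<in> {A}" using assms that unfolding state_def by blast+
    then show ?thesis by simp
  qed
  then have "step V f g" using assms(1) by (intro step_agree) (auto simp: state_def)
  then show ?thesis by blast
qed

text \<open>Off v, A has \<open>k + 1 - ((2 * k + 2) - (k + 1)) = 0\<close> edges and disappears.
  Any B of \<open>S\<close> then takes over its part, which is the even case with one colour
  fewer.\<close>

lemma connected_odd:
  fixes S :: "'c set" and V :: "'a set"
  assumes IH: "\<And>(V :: 'a set) (S :: 'c set) A f g. finite V \<Longrightarrow> finite S \<Longrightarrow> A \<notin> S \<Longrightarrow> card S = k \<Longrightarrow>
      card V = 2 * k + 2 \<Longrightarrow> state V S A (card V - 1) f \<Longrightarrow> state V S A (card V - 1) g \<Longrightarrow> sim V f g"
    and k: "k \<in> {0, 1, 2}" and V: "finite V" "card V = 2 * k + 3" and S: "finite S" "card S = k + 1" "A \<notin> S"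
    and fg: "state V S A (k + 1) f" "state V S A (k + 1) g"
  shows "sim V f g"
proof -
  have "V \<noteq> {}" using V by auto
  then obtain v where v: "v \<in> V" by blast
  interpret peel V S A "k + 1" v using V S v by unfold_locales auto
  have cW: "card W = 2 * k + 2" using V v by simp
  have "S \<noteq> {}" using S by auto
  then obtain B where B: "B \<in> S" by blast
  show ?thesis
  proof (rule lift_connected[OF _ _ fg])
    show "card (T f B) = 1" if "stuck f" "B \<in> S" for f B
      by (rule odd_peeled[OF that(1) _ _ _ that(2)]) (use S cW k in auto)
    have st: "state W (S - {B}) B (card W - 1) f" if "state W S A (k + 1 - (card W - card S)) f" for f
    proof -
      have "card (cls W f A) = 0" using that cW S by (simp add: state_def)
      then have "cls W f A = {}" using V(1) by simp
      then have nA: "f e \<noteq> A" if "e \<in> edges W" for e using that unfolding cls_def by blast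
      have "f ` edges W \<subseteq> insert A S" using that by (simp add: state_def)
      then have "f ` edges W \<subseteq> insert B (S - {B})" using nA B by auto
      then show ?thesis using that B unfolding state_def by simp
    qed
    show "sim W f g" if "state W S A (k + 1 - (card W - card S)) f" "state W S A (k + 1 - (card W - card S)) g" for f g
      by (rule IH[OF _ _ _ _ cW st[OF that(1)] st[OF that(2)]]) (use V S B in auto)
  qed
qed

text \<open>Each induction step removes two vertices and one colour. The distinguished colour
  changes on the way, so A is generalised. The bound on k is that of \<open>even_peeled\<close> and
  \<open>odd_peeled\<close>.\<close>

lemma connected_even:
  fixes S :: "'c set" and V :: "'a set"
  assumes "finite V" "finite S" "A \<notin> S" "card S = k" "card V = 2 * k + 2" "k \<le> 3"
    "state V S A (card V - 1) f" "state V S A (card V - 1) g"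
  shows "sim V f g"
  using assms
proof (induction k arbitrary: V S A f g)
  case 0
  then show ?case using connected_zero by simp
next
  case (Suc k)
  have "V \<noteq> {}" using Suc.prems by auto
  then obtain v where v: "v \<in> V" by blast
  interpret peel V S A "card V - 1" v using Suc.prems v by unfold_locales auto
  have cW: "card W = 2 * k + 3" using Suc.prems v by simp
  show ?case
  proof (rule lift_connected[OF _ _ Suc.prems(7,8)])
    show "card (T f B) = 1" if "stuck f" "B \<in> S" for f B
      by (rule even_peeled[OF that(1) _ _ _ that(2)]) (use Suc.prems cW in auto)
    have e: "card V - 1 - (card W - card S) = k + 1" using Suc.prems cW by simp
    show "sim W f g" if "state W S A (card V - 1 - (card W - card S)) f" "state W S A (card V - 1 - (card W - card S)) g" for f g
    proof (rule connected_odd[where k = k and S = S and A = A])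
      show "sim V f g" if "finite V" "finite S" "A \<notin> S" "card S = k" "card V = 2 * k + 2"
        "state V S A (card V - 1) f" "state V S A (card V - 1) g" for V :: "'a set" and S :: "'c set" and A f g
        by (rule Suc.IH[OF that(1-5) _ that(6,7)]) (use Suc.prems in simp)
    qed (use that e cW Suc.prems in auto)
  qed
qed

section \<open>Cycle-free partitions\<close>

text \<open>When the walk returns to a vertex of the path built so far, the path is cut back to that
  vertex.\<close>

lemma conn_distinct_path:
  assumes "conn E x y"
  shows "\<exists>vs. vs \<noteq> [] \<and> hd vs = x \<and> last vs = y \<and> distinct vs \<and> successively (\<lambda>a b. {a, b} \<in> E) vs"
  using assms
proof (induction rule: conn_induct)
  case refl
  show ?case by (rule exI[of _ "[x]"]) simp
next
  case (step u w)
  then obtain vs where vs: "vs \<noteq> []" "hd vs = x" "last vs = u" "distinct vs" "successively (\<lambda>a b. {a, b} \<in> E) vs"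
    by blast
  show ?case
  proof (cases "w \<in> set vs")
    case True
    then obtain as bs where s: "vs = as @ w # bs" by (meson split_list)
    then have "vs = (as @ [w]) @ bs" by simp
    then have "distinct (as @ [w])" "successively (\<lambda>a b. {a, b} \<in> E) (as @ [w])"
      using vs(4,5) by (simp, metis successively_append_iff)
    moreover have "hd (as @ [w]) = x" using vs(2) s by (cases as) simp_all
    ultimately show ?thesis by (intro exI[of _ "as @ [w]"]) simp
  next
    case False
    have "successively (\<lambda>a b. {a, b} \<in> E) (vs @ [w])"
      using vs step(2) by (simp add: successively_append_iff)
    then show ?thesis using vs False by (intro exI[of _ "vs @ [w]"]) simp
  qed
qed

text \<open>Deleting one edge of a cycle leaves a path between its ends. Conversely, a simple path
  avoiding \<open>{x, y}\<close> closes up to a cycle, of length at least three because with two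
  vertices it would use \<open>{x, y}\<close> itself.\<close>

lemma forest_iff_no_cycle:
  fixes E :: "nat set set"
  assumes "E \<subseteq> edges V"
  shows "forest E \<longleftrightarrow> \<not> (\<exists>vs. is_cycle E vs)"
proof
  assume F: "forest E"
  show "\<not> (\<exists>vs. is_cycle E vs)"
  proof
    assume "\<exists>vs. is_cycle E vs"
    then obtain vs where n: "3 \<le> length vs" and d: "distinct vs"
      and e: "\<And>k. k < length vs \<Longrightarrow> {vs ! k, vs ! (Suc k mod length vs)} \<in> E" unfolding is_cycle_def by blast
    define m where "m = length vs - 1"
    have m: "Suc m = length vs" "2 \<le> m" using n by (auto simp: m_def)
    have last: "{vs ! 0, vs ! m} \<in> E" using e[of m] m(1) by (simp add: insert_commute)
    have "conn (E - {{vs ! 0, vs ! m}}) (vs ! 0) (vs ! k)" if "k \<le> m" for k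
      using that
    proof (induction k)
      case (Suc k)
      then have k: "k < length vs" "Suc k < length vs" using m by auto
      have "{vs ! k, vs ! Suc k} \<in> E" using e[OF k(1)] k(2) by simp
      moreover have "{vs ! k, vs ! Suc k} \<noteq> {vs ! 0, vs ! m}"
      proof
        assume "{vs ! k, vs ! Suc k} = {vs ! 0, vs ! m}"
        then have "vs ! k = vs ! 0 \<and> vs ! Suc k = vs ! m \<or> vs ! k = vs ! m \<and> vs ! Suc k = vs ! 0"
          by (simp add: doubleton_eq_iff)
        moreover have "0 < length vs" "m < length vs" using m by auto
        ultimately have "k = 0 \<and> Suc k = m \<or> k = m \<and> Suc k = 0" using d k nth_eq_iff_index_eq by metis
        then show False using m by auto
      qed
      ultimately have "{vs ! k, vs ! Suc k} \<in> E - {{vs ! 0, vs ! m}}" by simp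
      then show ?case using Suc conn_step by (metis Suc_leD)
    qed simp
    then show False using forestD[OF F last] by blast
  qed
next
  assume no: "\<not> (\<exists>vs. is_cycle E vs)"
  show "forest E"
    unfolding forest_def
  proof (intro allI impI notI)
    fix x y assume xy: "{x, y} \<in> E" and c: "conn (E - {{x, y}}) x y"
    have ne: "x \<noteq> y" using set_mp[OF assms xy] by simp
    obtain vs where vs: "vs \<noteq> []" "hd vs = x" "last vs = y" "distinct vs"
      "successively (\<lambda>a b. {a, b} \<in> E - {{x, y}}) vs" using conn_distinct_path[OF c] by blast
    have nth: "{vs ! k, vs ! Suc k} \<in> E - {{x, y}}" if "Suc k < length vs" for k
      using vs(5) that unfolding successively_conv_nth by blast
    have h: "vs ! 0 = x" using vs by (simp add: hd_conv_nth)
    have l: "vs ! (length vs - 1) = y" using vs by (simp add: last_conv_nth)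
    have "length vs \<noteq> 0" using vs by simp
    moreover have "length vs \<noteq> 1" using h l ne by auto
    moreover have "length vs \<noteq> 2"
    proof
      assume "length vs = 2"
      then show False using nth[of 0] h l by simp
    qed
    ultimately have "3 \<le> length vs" by linarith
    moreover have "{vs ! k, vs ! (Suc k mod length vs)} \<in> E" if "k < length vs" for k
    proof (cases "Suc k < length vs")
      case True then show ?thesis using nth by simp
    next
      case False
      then have "k = length vs - 1" "Suc k = length vs" using that by auto
      then have "{vs ! k, vs ! (Suc k mod length vs)} = {y, x}" using l h by simp
      then show ?thesis using xy by (simp add: insert_commute)
    qed
    ultimately have "is_cycle E vs" using vs(4) by (simp add: is_cycle_def)
    then show False using no by blast
  qed
qed

section \<open>Partitions as colourings by spanning trees\<close>

lemma complete_graph_edges_eq: "complete_graph_edges n = edges {1..n}"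
  by (simp add: complete_graph_edges_def edges_def)

lemma triangle_edges_eq: "triangle_edges = tri"
  by (intro ext) (simp add: triangle_edges_def tri_def)

lemma card_edges:
  assumes "finite V" shows "card (edges V) = card V choose 2"
proof -
  have "edges V = {B. B \<subseteq> V \<and> card B = 2}"
  proof (intro equalityI subsetI)
    fix e assume "e \<in> edges V"
    then show "e \<in> {B. B \<subseteq> V \<and> card B = 2}" by (rule edgesE) auto
  next
    fix e assume "e \<in> {B. B \<subseteq> V \<and> card B = 2}"
    then obtain x y where "e = {x, y}" "x \<noteq> y" "e \<subseteq> V" by (auto simp: card_2_iff)
    then show "e \<in> edges V" by simp
  qed
  then show ?thesis using n_subsets[OF assms] by simp
qed

definition classes :: "nat \<Rightarrow> (nat set \<Rightarrow> nat) \<Rightarrow> nat set set list" where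
  "classes d f = map (cls {1..2 * d} f) [0..<d]"

text \<open>The last colour plays the part of A. With \<open>r = 2 * d - 1\<close> it spans as well,
  so all d colours are on an equal footing.\<close>

abbreviation tree_coloring :: "nat \<Rightarrow> (nat set \<Rightarrow> nat) \<Rightarrow> bool" where
  "tree_coloring d \<equiv> state {1..2 * d} {..<d - 1} (d - 1) (2 * d - 1)"

lemma tree_coloring_iff:
  assumes "0 < d"
  shows "tree_coloring d f \<longleftrightarrow> valid {1..2 * d} f \<and> (\<forall>e \<in> edges {1..2 * d}. f e < d) \<and>
    (\<forall>c < d. card (cls {1..2 * d} f c) = 2 * d - 1)"
proof -
  have "insert (d - 1) {..<d - 1} = {..<d}" using assms by auto
  moreover have "(\<forall>c < d. P c) \<longleftrightarrow> (\<forall>c \<in> {..<d - 1}. P c) \<and> P (d - 1)" for P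
    using assms by (metis Suc_pred' lessThan_iff less_Suc_eq)
  ultimately show ?thesis unfolding state_def by (auto simp: image_subset_iff)
qed

lemma classes_cf:
  assumes d: "0 < d" and f: "tree_coloring d f"
  shows "classes d f \<in> cycle_free_partitions d (2 * d)"
proof -
  have n: "classes d f ! i = cls {1..2 * d} f i" if "i < d" for i using that by (simp add: classes_def)
  have "(\<Union>i < d. classes d f ! i) = edges {1..2 * d}"
    using f[unfolded tree_coloring_iff[OF d]] n by (auto simp: cls_def)
  moreover have "\<not> (\<exists>vs. is_cycle (classes d f ! i) vs)" if "i < d" for i
    unfolding n[OF that] forest_iff_no_cycle[OF cls_edges, symmetric]
    using f by (simp add: state_def valid_def)
  ultimately show ?thesis
    unfolding cycle_free_partitions_def partitions_def complete_graph_edges_eq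
    using n by (auto simp: classes_def cls_def)
qed

text \<open>Each of the d forests has at most \<open>2 * d - 1\<close> edges, and together they have
  the \<open>d * (2 * d - 1)\<close> edges of the complete graph, so every bound is
  attained.\<close>

lemma cf_classes:
  assumes d: "0 < d" and P: "P \<in> cycle_free_partitions d (2 * d)"
  obtains f where "tree_coloring d f" "P = classes d f"
proof -
  let ?V = "{1..2 * d}"
  have len: "length P = d" and disj: "\<And>i j. i < d \<Longrightarrow> j < d \<Longrightarrow> i \<noteq> j \<Longrightarrow> P ! i \<inter> P ! j = {}"
    and un: "(\<Union>i < d. P ! i) = edges ?V" and cf: "\<And>i. i < d \<Longrightarrow> \<not> (\<exists>vs. is_cycle (P ! i) vs)"
    using P unfolding cycle_free_partitions_def partitions_def complete_graph_edges_eq by auto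
  define f where "f e = (if e \<in> edges ?V then THE i. i < d \<and> e \<in> P ! i else 0)" for e
  have fe: "f e = i" if "i < d" "e \<in> P ! i" for i e
  proof -
    have "e \<in> edges ?V" using that un by blast
    moreover have "(THE i. i < d \<and> e \<in> P ! i) = i"
      by (rule the_equality) (use that disj in blast)+
    ultimately show ?thesis by (simp add: f_def)
  qed
  have ex: "\<exists>i < d. e \<in> P ! i" if "e \<in> edges ?V" for e using that un by blast
  have cl: "cls ?V f i = P ! i" if "i < d" for i
  proof (intro equalityI subsetI)
    fix e assume "e \<in> cls ?V f i"
    then have e: "e \<in> edges ?V" "f e = i" by (auto simp: cls_def)
    obtain j where "j < d" "e \<in> P ! j" using ex[OF e(1)] by blast
    then show "e \<in> P ! i" using fe e(2) by auto
  next
    fix e assume "e \<in> P ! i"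
    then show "e \<in> cls ?V f i" using fe that un by (auto simp: cls_def)
  qed
  have lt: "f e < d" if "e \<in> edges ?V" for e using ex[OF that] fe by auto
  have forest: "forest (cls ?V f c)" for c
  proof (cases "c < d")
    case True
    then show ?thesis using forest_iff_no_cycle[OF cls_edges[of ?V f c]] cf[OF True] cl[OF True] by simp
  next
    case False
    then have "cls ?V f c = {}" using lt by (auto simp: cls_def)
    then show ?thesis by simp
  qed
  have le: "card (cls ?V f c) \<le> 2 * d - 1" for c
    using forest_card_le[OF _ cls_edges forest[of c]] d by simp
  have "edges ?V = (\<Union>c\<in>{..<d}. cls ?V f c)" using lt by (auto simp: cls_def)
  moreover have "card (\<Union>c\<in>{..<d}. cls ?V f c) = (\<Sum>c\<in>{..<d}. card (cls ?V f c))"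
    by (rule card_UN_disjoint) (auto simp: cls_def)
  ultimately have sum: "(\<Sum>c<d. card (cls ?V f c)) = d * (2 * d - 1)"
    using card_edges[of ?V] by (simp add: choose_two)
  have eq: "card (cls ?V f c) = 2 * d - 1" if "c < d" for c
  proof (rule ccontr)
    assume "\<not> ?thesis"
    then have "card (cls ?V f c) < 2 * d - 1" using le[of c] by simp
    then have "(\<Sum>c<d. card (cls ?V f c)) < (\<Sum>c<d. 2 * d - 1)"
      using that le by (intro sum_strict_mono_ex1) auto
    then show False using sum by simp
  qed
  have "tree_coloring d f" unfolding tree_coloring_iff[OF d] valid_def using forest lt eq by blast
  moreover have "P = classes d f"
    by (rule nth_equalityI) (use len cl in \<open>auto simp: classes_def\<close>)
  ultimately show ?thesis by (rule that)
qed

lemma coincide_on_classes: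
  assumes "0 < d" "tree_coloring d f" "e \<in> edges {1..2 * d}"
  shows "coincide_on d (classes d f) (classes d g) e \<longleftrightarrow> f e = g e"
proof -
  have "f e < d" using assms(2,3) tree_coloring_iff[OF assms(1)] by blast
  then show ?thesis using assms(3) unfolding coincide_on_def by (auto simp: classes_def cls_def)
qed

lemma classes_cong: "(\<And>e. e \<in> edges {1..2 * d} \<Longrightarrow> f e = g e) \<Longrightarrow> classes d f = classes d g"
  unfolding classes_def using cls_cong[of "{1..2 * d}" f g] by simp

section \<open>Uniqueness of the nontrivial recolouring of a triangle\<close>

lemma rearrangement2:
  assumes "\<And>c. of_bool (b' = c) + of_bool (c' = c) = (of_bool (b = c) + of_bool (e = c) :: nat)"
  shows "b' = b \<and> c' = e \<or> b' = e \<and> c' = b"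
proof (cases "b' = b")
  case True
  then show ?thesis using assms[of e] by (cases "c' = e") auto
next
  case False
  then have "c' = b" using assms[of b] by (cases "c' = b") auto
  then show ?thesis using False assms[of b'] by (cases "b' = e") auto
qed

lemma rearrangement3:
  assumes "\<And>c. of_bool (a' = c) + of_bool (b' = c) + of_bool (c' = c) =
    (of_bool (a = c) + of_bool (b = c) + of_bool (e = c) :: nat)"
  shows "(a', b', c') \<in> {(a, b, e), (a, e, b), (b, a, e), (b, e, a), (e, a, b), (e, b, a)}"
proof -
  have "a' = a \<or> b' = a \<or> c' = a" using assms[of a] by (cases "a' = a"; cases "b' = a"; cases "c' = a") auto
  then show ?thesis
  proof (elim disjE)
    assume "a' = a"
    have "of_bool (b' = c) + of_bool (c' = c) = (of_bool (b = c) + of_bool (e = c) :: nat)" for c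
      using assms[of c] by (simp add: \<open>a' = a\<close>)
    from rearrangement2[OF this] show ?thesis using \<open>a' = a\<close> by auto
  next
    assume "b' = a"
    have "of_bool (a' = c) + of_bool (c' = c) = (of_bool (b = c) + of_bool (e = c) :: nat)" for c
      using assms[of c] by (simp add: \<open>b' = a\<close>)
    from rearrangement2[OF this] show ?thesis using \<open>b' = a\<close> by auto
  next
    assume "c' = a"
    have "of_bool (a' = c) + of_bool (b' = c) = (of_bool (b = c) + of_bool (e = c) :: nat)" for c
      using assms[of c] by (simp add: \<open>c' = a\<close>)
    from rearrangement2[OF this] show ?thesis using \<open>c' = a\<close> by auto
  qed
qed

text \<open>Here p, q, s are the colours of \<open>{x, y}\<close>, \<open>{x, z}\<close>,
  \<open>{y, z}\<close>, and Z, Y, X tell which colours join the ends of these edges outside the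
  triangle. A colour occurring once may stay or move to exactly one other edge. For three different
  colours these moves form a map without fixed points on three edges; it has exactly one cycle,
  hence one nontrivial rearrangement. If a colour is repeated, the move of the other one
  decides.\<close>

lemma fiber_combinatorics:
  fixes X Y Z :: "'c \<Rightarrow> bool"
  assumes P: "(p', q', s') \<in> {(p, q, s), (p, s, q), (q, p, s), (q, s, p), (s, p, q), (s, q, p)}"
    and P2: "(p'', q'', s'') \<in> {(p, q, s), (p, s, q), (q, p, s), (q, s, p), (s, p, q), (s, q, p)}"
    and ne: "(p', q', s') \<noteq> (p, q, s)" "(p'', q'', s'') \<noteq> (p, q, s)"
    and forb: "\<not> Z p" "\<not> Y q" "\<not> X s" "\<not> Z p'" "\<not> Y q'" "\<not> X s'" "\<not> Z p''" "\<not> Y q''" "\<not> X s''"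
    and tr: "\<And>c. X c \<Longrightarrow> Y c \<Longrightarrow> Z c" "\<And>c. X c \<Longrightarrow> Z c \<Longrightarrow> Y c" "\<And>c. Y c \<Longrightarrow> Z c \<Longrightarrow> X c"
    and one: "q \<noteq> p \<Longrightarrow> s \<noteq> p \<Longrightarrow> X p \<or> Y p" "p \<noteq> q \<Longrightarrow> s \<noteq> q \<Longrightarrow> X q \<or> Z q" "p \<noteq> s \<Longrightarrow> q \<noteq> s \<Longrightarrow> Y s \<or> Z s"
    and nall: "\<not> (p = q \<and> q = s)"
  shows "(p', q', s') = (p'', q'', s'')"
proof -
  have g: "(p', q', s') = (p, s, q) \<or> (p', q', s') = (q, p, s) \<or> (p', q', s') = (q, s, p) \<or>
    (p', q', s') = (s, p, q) \<or> (p', q', s') = (s, q, p)" using P ne(1) by (simp only: insert_iff empty_iff simp_thms)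
  have h: "(p'', q'', s'') = (p, s, q) \<or> (p'', q'', s'') = (q, p, s) \<or> (p'', q'', s'') = (q, s, p) \<or>
    (p'', q'', s'') = (s, p, q) \<or> (p'', q'', s'') = (s, q, p)" using P2 ne(2) by (simp only: insert_iff empty_iff simp_thms)
  have t: "\<not> (X p \<and> Y p)" "\<not> (X q \<and> Z q)" "\<not> (Y s \<and> Z s)" using tr forb(1-3) by blast+
  consider "p = q" "p \<noteq> s" | "p = s" "p \<noteq> q" | "q = s" "p \<noteq> q" | "p \<noteq> q" "p \<noteq> s" "q \<noteq> s" using nall by blast
  then show ?thesis
  proof cases
    case 1
    then show ?thesis using g h ne forb t one(3) by (elim disjE) auto
  next
    case 2
    then show ?thesis using g h ne forb t one(2) by (elim disjE) auto
  next
    case 3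
    then show ?thesis using g h ne forb t one(1) by (elim disjE) auto
  next
    case 4
    then show ?thesis using g h forb t one by (elim disjE) auto
  qed
qed

text \<open>A spanning tree that loses one edge of a triangle can be completed by exactly two of its edges.\<close>

lemma fiber_unique:
  assumes fin: "finite V" and f: "state V S A (card V - 1) f" and g: "valid V g" and h: "valid V h"
    and xyz: "x \<in> V" "y \<in> V" "z \<in> V" "x \<noteq> y" "x \<noteq> z" "y \<noteq> z"
    and gf: "\<forall>e \<in> edges V - tri x y z. g e = f e" and hf: "\<forall>e \<in> edges V - tri x y z. h e = f e"
    and gc: "\<And>c. card (cls V g c) = card (cls V f c)" and hc: "\<And>c. card (cls V h c) = card (cls V f c)"
    and ne: "\<exists>e \<in> tri x y z. g e \<noteq> f e" "\<exists>e \<in> tri x y z. h e \<noteq> f e"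
  shows "\<forall>e \<in> tri x y z. g e = h e"
proof -
  define X where "X c = conn (cls V f c - tri x y z) y z" for c
  define Y where "Y c = conn (cls V f c - tri x y z) x z" for c
  define Z where "Z c = conn (cls V f c - tri x y z) x y" for c
  have vf: "valid V f" using f by (simp add: state_def)
  have forb: "\<not> Z (k {x, y})" "\<not> Y (k {x, z})" "\<not> X (k {y, z})"
    if "valid V k" "\<forall>e \<in> edges V - tri x y z. k e = f e" for k
    using forest_cls_tri[OF vf xyz that(2), of "k {x, y}"] forest_cls_tri[OF vf xyz that(2), of "k {x, z}"]
      forest_cls_tri[OF vf xyz that(2), of "k {y, z}"] validD[OF that(1)]
    unfolding X_def Y_def Z_def by simp_all
  have tr: "X c \<Longrightarrow> Y c \<Longrightarrow> Z c" "X c \<Longrightarrow> Z c \<Longrightarrow> Y c" "Y c \<Longrightarrow> Z c \<Longrightarrow> X c" for c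
    unfolding X_def Y_def Z_def by (meson conn_sym conn_trans)+
  have perm: "(k {x, y}, k {x, z}, k {y, z}) \<in> {(f {x, y}, f {x, z}, f {y, z}), (f {x, y}, f {y, z}, f {x, z}),
      (f {x, z}, f {x, y}, f {y, z}), (f {x, z}, f {y, z}, f {x, y}), (f {y, z}, f {x, y}, f {x, z}),
      (f {y, z}, f {x, z}, f {x, y})}"
    if k: "\<forall>e \<in> edges V - tri x y z. k e = f e" and c: "\<And>c. card (cls V k c) = card (cls V f c)" for k
  proof (rule rearrangement3)
    show "of_bool (k {x, y} = c) + of_bool (k {x, z} = c) + of_bool (k {y, z} = c) =
      (of_bool (f {x, y} = c) + of_bool (f {x, z} = c) + of_bool (f {y, z} = c) :: nat)" for c
      using card_cls_tri[OF fin xyz k, where c = c] card_cls_tri[OF fin xyz, where g = f and f = f and c = c] c[of c]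
      by simp
  qed
  have full: "conn (cls V f c) a b" if "c \<in> f ` edges V" "a \<in> V" "b \<in> V" for c a b
  proof -
    have "c \<in> insert A S" using that f unfolding state_def by blast
    then have "card (cls V f c) = card V - 1" using f by (auto simp: state_def)
    then show ?thesis using forest_spanning[OF fin cls_edges validD[OF vf]] that by blast
  qed
  have inE: "f {x, y} \<in> f ` edges V" "f {x, z} \<in> f ` edges V" "f {y, z} \<in> f ` edges V" using xyz by auto
  have d: "{x, y} \<noteq> {x, z}" "{x, y} \<noteq> {y, z}" "{x, z} \<noteq> {y, z}"
    using tri_edges_distinct[OF xyz(4-6)] by auto
  have off: "\<forall>e \<in> edges V - tri x y z. f e = f e" by simp
  \<comment> \<open>Putting \<open>{x, y}\<close> back must connect z to x, so z was already joined
    to x or to y.\<close>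
  have fz: "X c \<or> Y c" if "f {x, y} = c" "f {x, z} \<noteq> c" "f {y, z} \<noteq> c" for c
  proof -
    have "cls V f c = insert {x, y} (cls V f c - tri x y z)"
      by (rule trans[OF cls_tri[OF xyz off, where c = c]]) (simp add: that)
    then have "conn (insert {x, y} (cls V f c - tri x y z)) x z" using full[of c x z] inE(1) that(1) xyz(1,3) by simp
    then show ?thesis unfolding conn_insert X_def Y_def by auto
  qed
  have fy: "X c \<or> Z c" if "f {x, z} = c" "f {x, y} \<noteq> c" "f {y, z} \<noteq> c" for c
  proof -
    have "cls V f c = insert {x, z} (cls V f c - tri x y z)"
      by (rule trans[OF cls_tri[OF xyz off, where c = c]]) (simp add: that)
    then have "conn (insert {x, z} (cls V f c - tri x y z)) x y" using full[of c x y] inE(2) that(1) xyz(1,2) by simp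
    then show ?thesis unfolding conn_insert X_def Z_def using conn_sym by metis
  qed
  have fx: "Y c \<or> Z c" if "f {y, z} = c" "f {x, y} \<noteq> c" "f {x, z} \<noteq> c" for c
  proof -
    have "cls V f c = insert {y, z} (cls V f c - tri x y z)"
      by (rule trans[OF cls_tri[OF xyz off, where c = c]]) (simp add: that)
    then have "conn (insert {y, z} (cls V f c - tri x y z)) x y" using full[of c x y] inE(3) that(1) xyz(1,2) by simp
    then show ?thesis unfolding conn_insert Y_def Z_def by auto
  qed
  have nall: "\<not> (f {x, y} = f {x, z} \<and> f {x, z} = f {y, z})"
    using forest_cls_tri[OF vf xyz off, of "f {x, y}"] validD[OF vf] by auto
  obtain p q s where pqs: "p = f {x, y}" "q = f {x, z}" "s = f {y, z}" by blast
  obtain gp gq gs where G: "gp = g {x, y}" "gq = g {x, z}" "gs = g {y, z}" by blast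
  obtain hp hq hs where Hh: "hp = h {x, y}" "hq = h {x, z}" "hs = h {y, z}" by blast
  have gne: "(gp, gq, gs) \<noteq> (p, q, s)" and hne: "(hp, hq, hs) \<noteq> (p, q, s)"
    using ne pqs G Hh by (auto simp: tri_def)
  note F1 = forb[OF vf off, folded pqs] and G1 = forb[OF g gf, folded G] and H1 = forb[OF h hf, folded Hh]
  note P1 = perm[OF gf gc, folded pqs G] and P2 = perm[OF hf hc, folded pqs Hh]
  note Fz = fz[folded pqs] and Fy = fy[folded pqs] and Fx = fx[folded pqs] and N = nall[folded pqs]
  have "(gp, gq, gs) = (hp, hq, hs)"
    by (rule fiber_combinatorics[where X = X and Y = Y and Z = Z, OF P1 P2 gne hne F1 G1 H1])
      (use tr Fz[OF refl] Fy[OF refl] Fx[OF refl] N in \<open>blast+\<close>)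
  then show ?thesis using G Hh by (auto simp: tri_def)
qed

section \<open>Steps as involutions\<close>

lemma tri_sorted:
  fixes x y z :: "'a :: linorder"
  assumes "x \<in> V" "y \<in> V" "z \<in> V" "x \<noteq> y" "x \<noteq> z" "y \<noteq> z"
  obtains a b c where "a \<in> V" "b \<in> V" "c \<in> V" "a < b" "b < c" "tri a b c = tri x y z"
proof -
  have t: "tri x z y = tri x y z" "tri y x z = tri x y z" "tri y z x = tri x y z" "tri z x y = tri x y z"
    "tri z y x = tri x y z" by (auto simp: tri_def insert_commute)
  consider "x < y" "y < z" | "x < z" "z < y" | "y < x" "x < z" | "y < z" "z < x" | "z < x" "x < y" | "z < y" "y < x"
    using assms(4-6) by (metis linorder_neqE)
  then show ?thesis using that assms(1-3) t by cases metis+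
qed

text \<open>\<open>fiber_unique\<close> resolves the definite description. At least two edges differ
  because changing a single one would alter the size of a class. The involution is applied to the
  later colouring g, as in \<open>involution_equivalent\<close>.\<close>

lemma step_involution:
  assumes d: "0 < d" and f: "tree_coloring d f" and s: "step {1..2 * d} f g"
  shows "classes d f = classes d g \<or>
    (\<exists>x y z. 1 \<le> x \<and> x < y \<and> y < z \<and> z \<le> 2 * d \<and> involution d (classes d g) x y z = classes d f)"
proof (cases "\<forall>e \<in> edges {1..2 * d}. f e = g e")
  case True
  then show ?thesis using classes_cong by blast
next
  case False
  let ?V = "{1..2 * d}"
  have fin: "finite ?V" by simp
  have cV: "card ?V - 1 = 2 * d - 1" by simp
  have g: "tree_coloring d g" by (rule state_step[OF fin f s])
  have vg: "valid ?V g" using g by (simp add: state_def)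
  obtain x0 y0 z0 where 0: "x0 \<in> ?V" "y0 \<in> ?V" "z0 \<in> ?V" "x0 \<noteq> y0" "x0 \<noteq> z0" "y0 \<noteq> z0"
    "\<forall>e \<in> edges ?V - tri x0 y0 z0. f e = g e" using s False unfolding step_def by blast
  obtain x y z where xyz: "x \<in> ?V" "y \<in> ?V" "z \<in> ?V" "x < y" "y < z" and t: "tri x y z = tri x0 y0 z0"
    using tri_sorted[OF 0(1-6)] by metis
  have ne: "x \<noteq> y" "x \<noteq> z" "y \<noteq> z" using xyz by auto
  have off: "\<forall>e \<in> edges ?V - tri x y z. f e = g e" using 0(7) t by simp
  have trE: "tri x y z \<subseteq> edges ?V" using xyz ne by (simp add: tri_def)
  have co: "coincide_on d (classes d g) (classes d h) e \<longleftrightarrow> g e = h e" if "e \<in> edges ?V" for h e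
    by (rule coincide_on_classes[OF d g that])
  have cnt: "card (cls ?V h c) = card (cls ?V g c)" if "tree_coloring d h" for h c
  proof (cases "c < d")
    case True
    then show ?thesis using that g tree_coloring_iff[OF d] by simp
  next
    case False
    then have "cls ?V h c = {}" "cls ?V g c = {}"
      using that g tree_coloring_iff[OF d] unfolding cls_def by auto
    then show ?thesis by simp
  qed
  have uniq: "k = classes d f" if k: "k \<in> cycle_free_partitions d (2 * d)"
    "\<forall>e \<in> edges ?V - tri x y z. coincide_on d (classes d g) k e"
    "2 \<le> card {e \<in> tri x y z. \<not> coincide_on d (classes d g) k e}" for k
  proof -
    obtain h where h: "tree_coloring d h" "k = classes d h" using cf_classes[OF d k(1)] by blast
    have hoff: "\<forall>e \<in> edges ?V - tri x y z. h e = g e" using k(2) co h(2) by (metis DiffD1)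
    have "\<exists>e \<in> tri x y z. \<not> coincide_on d (classes d g) k e"
    proof (rule ccontr)
      assume "\<not> ?thesis"
      then have none: "{e \<in> tri x y z. \<not> coincide_on d (classes d g) k e} = {}" by blast
      show False using k(3) unfolding none by simp
    qed
    then have hne: "\<exists>e \<in> tri x y z. h e \<noteq> g e" using co trE h(2) by (metis subsetD)
    have fne: "\<exists>e \<in> tri x y z. f e \<noteq> g e" using False off by blast
    have vh: "valid ?V h" and vf: "valid ?V f" using h f by (simp_all add: state_def)
    have "\<forall>e \<in> tri x y z. h e = f e"
      by (rule fiber_unique[OF fin g[folded cV] vh vf xyz(1-3) ne hoff off cnt[OF h(1)] cnt[OF f] hne fne])
    then have "h e = f e" if "e \<in> edges ?V" for e using hoff off that by (metis DiffI)
    then show ?thesis unfolding h(2) by (rule classes_cong)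
  qed
  have two: "2 \<le> card {e \<in> tri x y z. \<not> coincide_on d (classes d g) (classes d f) e}"
  proof -
    have eq: "{e \<in> tri x y z. \<not> coincide_on d (classes d g) (classes d f) e} = {e \<in> tri x y z. f e \<noteq> g e}"
      using co trE by (metis (no_types, lifting) subsetD)
    obtain e where e: "e \<in> tri x y z" "f e \<noteq> g e" using False off by blast
    have "\<exists>e' \<in> tri x y z. e' \<noteq> e \<and> f e' \<noteq> g e'"
    proof (rule ccontr)
      assume "\<not> ?thesis"
      then have same: "f e' = g e'" if "e' \<in> edges ?V" "e' \<noteq> e" for e' using that off by blast
      have eE: "e \<in> edges ?V" using e trE by blast
      have "cls ?V f (f e) = insert e (cls ?V g (f e))"
      proof (rule set_eqI)
        fix u
        show "u \<in> cls ?V f (f e) \<longleftrightarrow> u \<in> insert e (cls ?V g (f e))"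
          using same[of u] eE by (cases "u = e") (auto simp: cls_def simp del: One_nat_def)
      qed
      moreover have "e \<notin> cls ?V g (f e)" using e by (auto simp: cls_def)
      ultimately have "card (cls ?V f (f e)) = Suc (card (cls ?V g (f e)))" by simp
      then show False using cnt[OF f] by simp
    qed
    then obtain e' where e': "e' \<in> tri x y z" "e' \<noteq> e" "f e' \<noteq> g e'" by blast
    have "card {e, e'} \<le> card {e \<in> tri x y z. f e \<noteq> g e}"
      by (rule card_mono) (use e e' in \<open>auto simp: tri_def\<close>)
    then show ?thesis using e'(2) eq by simp
  qed
  have "involution d (classes d g) x y z = classes d f"
    unfolding involution_def complete_graph_edges_eq triangle_edges_eq
  proof (rule the_equality)
    have "\<forall>e \<in> edges ?V - tri x y z. coincide_on d (classes d g) (classes d f) e"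
      using co off by (metis DiffD1)
    then show "classes d f \<in> cycle_free_partitions d (2 * d) \<and>
      (\<forall>e \<in> edges ?V - tri x y z. coincide_on d (classes d g) (classes d f) e) \<and>
      2 \<le> card {e \<in> tri x y z. \<not> coincide_on d (classes d g) (classes d f) e}"
      using classes_cf[OF d f] two by blast
  qed (use uniq in blast)
  then show ?thesis using xyz by auto
qed

lemma involution_equivalent_step:
  assumes PQ: "involution_equivalent d P Q" and Q': "Q' \<in> cycle_free_partitions d (2 * d)"
    and xyz: "1 \<le> x" "x < y" "y < z" "z \<le> 2 * d" "involution d Q' x y z = Q"
  shows "involution_equivalent d P Q'"
  using PQ unfolding involution_equivalent_def
proof (elim exE conjE)
  fix n :: nat and R X Y Z
  assume R: "\<forall>i \<le> n. R i \<in> cycle_free_partitions d (2 * d)" "R 0 = P" "R n = Q"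
    "\<forall>i \<in> {1..n}. 1 \<le> X i \<and> X i < Y i \<and> Y i < Z i \<and> Z i \<le> 2 * d \<and> involution d (R i) (X i) (Y i) (Z i) = R (i - 1)"
  let ?R = "R(Suc n := Q')" and ?X = "X(Suc n := x)" and ?Y = "Y(Suc n := y)" and ?Z = "Z(Suc n := z)"
  have 1: "\<forall>i \<le> Suc n. ?R i \<in> cycle_free_partitions d (2 * d)" using R(1) Q' by simp
  have 2: "?R 0 = P" "?R (Suc n) = Q'" using R(2) by simp_all
  have 3: "\<forall>i \<in> {1..Suc n}. 1 \<le> ?X i \<and> ?X i < ?Y i \<and> ?Y i < ?Z i \<and> ?Z i \<le> 2 * d \<and>
    involution d (?R i) (?X i) (?Y i) (?Z i) = ?R (i - 1)"
  proof
    fix i assume i: "i \<in> {1..Suc n}"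
    show "1 \<le> ?X i \<and> ?X i < ?Y i \<and> ?Y i < ?Z i \<and> ?Z i \<le> 2 * d \<and>
      involution d (?R i) (?X i) (?Y i) (?Z i) = ?R (i - 1)"
    proof (cases "i = Suc n")
      case True
      then show ?thesis using xyz R(3) by simp
    next
      case False
      then have "i \<in> {1..n}" "i \<noteq> Suc n" "i - 1 \<noteq> Suc n" using i by auto
      then show ?thesis using R(4) by simp
    qed
  qed
  show "\<exists>(n :: nat) R x y z. (\<forall>i \<le> n. R i \<in> cycle_free_partitions d (2 * d)) \<and> R 0 = P \<and> R n = Q' \<and>
    (\<forall>i \<in> {1..n}. 1 \<le> x i \<and> x i < y i \<and> y i < z i \<and> z i \<le> 2 * d \<and>
      involution d (R i) (x i) (y i) (z i) = R (i - 1))"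
    by (rule exI[of _ "Suc n"], rule exI[of _ ?R], rule exI[of _ ?X], rule exI[of _ ?Y], rule exI[of _ ?Z])
      (intro conjI 1 2 3)
qed

lemma sim_involution_equivalent:
  assumes d: "0 < d" and f: "tree_coloring d f" and s: "sim {1..2 * d} f g"
  shows "involution_equivalent d (classes d f) (classes d g)"
  using s
proof (induction rule: rtranclp_induct)
  case base
  show ?case
    unfolding involution_equivalent_def
    by (rule exI[of _ 0], rule exI[of _ "\<lambda>_. classes d f"]) (simp add: classes_cf[OF d f])
next
  case (step g h)
  have g: "tree_coloring d g" by (rule state_sim[OF _ f step(1)]) simp
  have h: "tree_coloring d h" by (rule state_step[OF _ g step(2)]) simp
  from step_involution[OF d g step(2)] show ?case
  proof
    assume "classes d g = classes d h"
    then show ?thesis using step.IH by simp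
  next
    assume "\<exists>x y z. 1 \<le> x \<and> x < y \<and> y < z \<and> z \<le> 2 * d \<and> involution d (classes d h) x y z = classes d g"
    then obtain x y z where xyz: "1 \<le> x" "x < y" "y < z" "z \<le> 2 * d"
      "involution d (classes d h) x y z = classes d g" by blast
    then show ?thesis using involution_equivalent_step[OF step.IH classes_cf[OF d h]] by blast
  qed
qed

theorem corollary4p7:
  fixes P Q :: "nat set set list"
  assumes "P \<in> cycle_free_partitions 4 8"
    and "Q \<in> cycle_free_partitions 4 8"
  shows "involution_equivalent 4 P Q"
proof -
  obtain f where f: "tree_coloring 4 f" "P = classes 4 f" using cf_classes[of 4 P] assms(1) by auto
  obtain g where g: "tree_coloring 4 g" "Q = classes 4 g" using cf_classes[of 4 Q] assms(2) by auto
  have "sim {1..2 * 4} f g"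
    \<comment> \<open>Three colours besides the distinguished one, and \<open>2 * 3 + 2 = 8\<close>
      vertices.\<close>
    by (rule connected_even[of "{1..2 * 4}" "{..<4 - 1}" "4 - 1" 3]) (use f(1) g(1) in simp_all)
  then show ?thesis using sim_involution_equivalent[of 4 f g] f g by simp
qed

end
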